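(* Let $\mathcal{R}\subset\mathbb{R}^2$ be an admissible ambit set (defined in the context). Let $L$ be a real-valued homogeneous Lévy basis on $\mathbb{R}^2$ with characteristic triplet $(\gamma,b,\nu)$, let $F:\mathbb{R}^2\to\mathbb{R}^2$ be measurable and continuously differentiable on $-\overline{\mathcal{R}}$, and put $$X(p)=\int_{\mathcal{R}+p}F(p-q)\,L(\mathrm{d}q),\qquad p\in\mathbb{R}^2 .$$ Suppose that one of the following (not necessarily mutually exclusive) cases holds: i) $b=0$ and $\int_{\mathbb{R}}(1\wedge|x|)\,\nu(\mathrm{d}x)<\infty$; ii) $F|_{-\partial\mathcal{R}}\equiv0$. Then, for every $p\in\mathbb{R}^2$, as $r\downarrow0$, $$\frac{1}{\pi r^2}\mathscr{C}_r(p;X)\overset{\mathbb{P}}{\to}\omega(p),\qquad \frac{1}{\pi r^2}\mathscr{D}_r(p;X)\overset{\mathbb{P}}{\to}\sigma(p),$$ where $$\omega(p)=\int_{\mathcal{R}+p}\nabla^\perp\cdot F(p-q)\,\tilde L(\mathrm{d}q),\qquad \sigma(p)=\int_{\mathcal{R}+p}\nabla\cdot F(p-q)\,\tilde L(\mathrm{d}q),$$ $\nabla=(\partial_x,\partial_y)'$, $\nabla^\perp=(-\partial_y,\partial_x)'$, $\tilde L=L-\gamma_d\,Leb$, with $\gamma_d=\gamma-\int_{|x|\le1}x\,\nu(\mathrm{d}x)$ in case i) and $\gamma_d=\gamma$ in case ii).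
   Context: Notation. $Leb$ is Lebesgue measure; $(x,y)^\perp=(-y,x)$; $u(\theta)=(\cos\theta,\sin\theta)'$; $-B=\{-x:x\in B\}$; $B^*=\overline{B^c}$ is the closure of the complement. In the integrands, $\nabla\cdot F(p-q)$ and $\nabla^\perp\cdot F(p-q)$ are the functions $\nabla\cdot F$, $\nabla^\perp\cdot F$ evaluated at $p-q$. Flux and circulation. For a vector-valued random field $X$ (taken in a measurable version), $r>0$, $p\in\mathbb{R}^2$: $\mathscr{C}_r(p;X)=r\int_0^{2\pi}X(p+ru(\theta))\cdot u^\perp(\theta)\,\mathrm{d}\theta$ and $\mathscr{D}_r(p;X)=r\int_0^{2\pi}X(p+ru(\theta))\cdot u(\theta)\,\mathrm{d}\theta$. Lévy bases. A homogeneous Lévy basis with characteristic triplet $(\gamma,b,\nu)$ is a family $\{L(B):Leb(B)<\infty\}$ of infinitely divisible real random variables that is a.s. $\sigma$-additive, with $L(B),L(B')$ independent when $B\cap B'=\emptyset$, and $\log\mathbb{E}e^{izL(B)}=Leb(B)\psi(z)$, where $\psi(z)=i\gamma z-\frac12b^2z^2+\int_{\mathbb{R}\setminus\{0\}}(e^{izx}-1-izx\mathbf{1}_{|x|\le1})\nu(\mathrm{d}x)$, $\gamma\in\mathbb{R}$, $b\ge0$, $\nu$ a Lévy measure. Integrals of deterministic functions with respect to $L$ are in the sense of Rajput–Rosiński. Geometry. For closed $A\subseteq\mathbb{R}^2$ and $p\in A$: $\mathrm{Tan}(A,p)$ is the set of tangent vectors, where $v\neq 0$ belongs to it iff there are $p_n\in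 A\setminus\{p\}$ with $p_n\to p$ and $\frac{p_n-p}{\|p_n-p\|}\to\frac{v}{\|v\|}$; $\mathrm{nor}(A,p)=\{u:u\cdot v\le0\ \forall v\in\mathrm{Tan}(A,p)\}$. Let $d_A(q)=\inf_{p\in A}\|p-q\|$, let $\mathrm{Unp}(A)$ be the set of points $q$ having a unique nearest point $\Pi_A(q)$ in $A$, $N(A)=\{(\Pi_A(q),\frac{q-\Pi_A(q)}{\|q-\Pi_A(q)\|}):q\in\mathrm{Unp}(A)\setminus A\}$, and $\delta_A(q,u)=\inf\{t\ge0:q+tu\notin\mathrm{Unp}(A)\}$ for $(q,u)\in N(A)$ (and $0$ otherwise). $\mathcal{H}^1$ is 1-dimensional Hausdorff measure. A Jordan domain is a compact set $A\subseteq\mathbb{R}^2$ with connected interior whose boundary is a Jordan curve. It has Lipschitz-regular boundary if $\partial A$ has a Lipschitz parametrization and for $\mathcal{H}^1$-a.a. $q\in\partial A$ there is a unit vector $u_A(q)$ orthogonal to $\mathrm{Tan}(\partial A,q)$ with $\mathrm{nor}(A,q)=\{\lambda u_A(q):\lambda\ge0\}$ and $\mathrm{nor}(A^*,q)=\{-\lambda u_A(q):\lambda\ge0\}$. Admissible ambit set: $\mathcal{R}=\mathcal{R}_1\setminus\bigcup_{i=2}^n\mathcal{R}_i$, where $\mathcal{R}_1,\dots,\mathcal{R}_n$ are Jordan domains with Lipschitz-regular boundary, $\mathcal{R}_i\subset\mathcal{R}_1$ and $\mathcal{R}_i\cap\mathcal{R}_j=\emptyset$ for $i\ne j$ in $\{2,\dots,n\}$,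 and for $i=1,\dots,n$ $$\int_{\mathbb{S}^1}\Big\{\sum_{q:(q,u)\in N(\mathcal{R}_i)}(\delta_{\mathcal{R}_i}(q,u)\wedge1)+\sum_{q:(q,u)\in N(\mathcal{R}_i^* )}(\delta_{\mathcal{R}_i^*}(q,u)\wedge1)\Big\}\mathcal{H}^1(\mathrm{d}u)<\infty .$$ *)

theory Defs
  imports "HOL-Probability.Probability"
begin

type_synonym plane = "real \<times> real"


section \<open>Vector calculus\<close>

definition perp :: "plane \<Rightarrow> plane" where
  "perp p = (- snd p, fst p)"

definition unit_dir :: "real \<Rightarrow> plane" where
  "unit_dir \<theta> = (cos \<theta>, sin \<theta>)"

text \<open>Divergence and curl (the latter for the operator \<open>(- \<partial>\<^sub>y, \<partial>\<^sub>x)\<close>) of a planar field, expressed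
  through its total derivative \<open>D\<close>.\<close>

definition divergence :: "(plane \<Rightarrow> plane \<Rightarrow>\<^sub>L plane) \<Rightarrow> plane \<Rightarrow> real" where
  "divergence D x = fst (blinfun_apply (D x) (1, 0)) + snd (blinfun_apply (D x) (0, 1))"

definition curl :: "(plane \<Rightarrow> plane \<Rightarrow>\<^sub>L plane) \<Rightarrow> plane \<Rightarrow> real" where
  "curl D x = - fst (blinfun_apply (D x) (0, 1)) + snd (blinfun_apply (D x) (1, 0))"

text \<open>On a closed set \<open>S\<close>, differentiability is relative to \<open>S\<close>; nothing is required of \<open>F\<close> off \<open>S\<close>.
  If \<open>S\<close> is the closure of its interior, then \<open>D\<close> is determined on \<open>S\<close> by \<open>F\<close>.\<close>

definition has_continuous_derivative_on ::
    "(plane \<Rightarrow> plane) \<Rightarrow> (plane \<Rightarrow> plane \<Rightarrow>\<^sub>L plane) \<Rightarrow> plane set \<Rightarrow> bool" where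
  "has_continuous_derivative_on F D S \<longleftrightarrow>
     (\<forall>x\<in>S. (F has_derivative blinfun_apply (D x)) (at x within S)) \<and> continuous_on S D"

definition circulation :: "(plane \<Rightarrow> 'w \<Rightarrow> plane) \<Rightarrow> real \<Rightarrow> plane \<Rightarrow> 'w \<Rightarrow> real" where
  "circulation X r p w =
     r * (LBINT \<theta>:{0..2 * pi}. X (p + r *\<^sub>R unit_dir \<theta>) w \<bullet> perp (unit_dir \<theta>))"

definition flux :: "(plane \<Rightarrow> 'w \<Rightarrow> plane) \<Rightarrow> real \<Rightarrow> plane \<Rightarrow> 'w \<Rightarrow> real" where
  "flux X r p w =
     r * (LBINT \<theta>:{0..2 * pi}. X (p + r *\<^sub>R unit_dir \<theta>) w \<bullet> unit_dir \<theta>)"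


section \<open>One-dimensional Hausdorff measure\<close>

text \<open>\<^const>\<open>outer_measure\<close> takes the infimum over countable disjoint covers. Disjointness is no
  restriction here, since passing to subsets does not increase diameters.\<close>

definition hausdorff1_pre :: "real \<Rightarrow> 'a::metric_space set \<Rightarrow> ennreal" where
  "hausdorff1_pre d =
     outer_measure UNIV (\<lambda>U. if bounded U \<and> diameter U \<le> d then ennreal (diameter U) else \<infinity>)"

definition hausdorff1_outer :: "'a::metric_space set \<Rightarrow> ennreal" where
  "hausdorff1_outer E = (SUP d\<in>{0<..}. hausdorff1_pre d E)"

text \<open>The measure is defined on all sets that are measurable in the sense of Caratheodory.\<close>

definition hausdorff1 :: "'a::metric_space measure" where
  "hausdorff1 = measure_of UNIV (lambda_system UNIV UNIV hausdorff1_outer) hausdorff1_outer"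

lemma outer_measure_space_hausdorff1_pre:
  assumes "d > 0"
  shows "outer_measure_space UNIV (hausdorff1_pre d :: 'a::metric_space set \<Rightarrow> ennreal)"
proof -
  let ?f = "\<lambda>U :: 'a set. if bounded U \<and> diameter U \<le> d then ennreal (diameter U) else \<infinity>"
  interpret ring_of_sets "UNIV :: 'a set" "UNIV :: 'a set set"
    using ring_of_sets_Pow[of "UNIV :: 'a set"] by simp
  have "positive UNIV ?f"
    using assms by (simp add: positive_def)
  moreover have "increasing UNIV ?f"
  proof (unfold increasing_def, intro ballI impI)
    fix U V :: "'a set"
    assume UV: "U \<subseteq> V"
    show "?f U \<le> ?f V"
    proof (cases "bounded V \<and> diameter V \<le> d")
      case True
      then have "bounded U" "diameter U \<le> diameter V"
        using UV bounded_subset diameter_subset by blast+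
      then show ?thesis
        using True by (auto intro: ennreal_leI)
    qed auto
  qed
  ultimately show ?thesis
    using outer_measure_space_outer_measure[of ?f] by (simp add: hausdorff1_pre_def)
qed

lemma outer_measure_space_hausdorff1:
  "outer_measure_space UNIV (hausdorff1_outer :: 'a::metric_space set \<Rightarrow> ennreal)"
proof -
  note pre = outer_measure_space_hausdorff1_pre[where 'a = 'a, unfolded outer_measure_space_def]
  have pos: "hausdorff1_pre d ({} :: 'a set) = 0" if "d > 0" for d
    using pre[OF that] by (simp add: positive_def)
  have inc: "hausdorff1_pre d U \<le> hausdorff1_pre d V" if "d > 0" "U \<subseteq> V" for d and U V :: "'a set"
    using pre[OF that(1)] that(2) by (simp add: increasing_def)
  have sub: "hausdorff1_pre d (\<Union>i. A i) \<le> (\<Sum>i. hausdorff1_pre d (A i))"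
    if "d > 0" "disjoint_family A" for d and A :: "nat \<Rightarrow> 'a set"
    using pre[OF that(1)] that(2) by (simp add: countably_subadditive_def)
  have le: "hausdorff1_pre d U \<le> hausdorff1_outer U" if "d > 0" for d and U :: "'a set"
    unfolding hausdorff1_outer_def using that by (intro SUP_upper) simp
  have "positive UNIV (hausdorff1_outer :: 'a set \<Rightarrow> ennreal)"
    using pos by (auto simp: positive_def hausdorff1_outer_def)
  moreover have "increasing UNIV (hausdorff1_outer :: 'a set \<Rightarrow> ennreal)"
    using inc by (auto simp: increasing_def hausdorff1_outer_def intro!: SUP_mono)
  moreover have "countably_subadditive UNIV (hausdorff1_outer :: 'a set \<Rightarrow> ennreal)"
  proof (unfold countably_subadditive_def, intro allI impI)
    fix A :: "nat \<Rightarrow> 'a set"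
    assume "disjoint_family A"
    then have "hausdorff1_pre d (\<Union>i. A i) \<le> (\<Sum>i. hausdorff1_outer (A i))" if "d > 0" for d
      using sub[OF that] le[OF that] by (intro order_trans[OF sub[OF that] suminf_le]) auto
    then show "hausdorff1_outer (\<Union>i. A i) \<le> (\<Sum>i. hausdorff1_outer (A i))"
      unfolding hausdorff1_outer_def[of "\<Union>i. A i"] by (intro SUP_least) simp
  qed
  ultimately show ?thesis
    by (simp add: outer_measure_space_def)
qed

lemma
  fixes E :: "'a::metric_space set"
  shows space_hausdorff1: "space (hausdorff1 :: 'a measure) = UNIV"
    and sets_hausdorff1: "sets (hausdorff1 :: 'a measure) = lambda_system UNIV UNIV hausdorff1_outer"
    and emeasure_hausdorff1: "E \<in> sets hausdorff1 \<Longrightarrow> emeasure hausdorff1 E = hausdorff1_outer E"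
proof -
  interpret sigma_algebra "UNIV :: 'a set" "UNIV :: 'a set set"
    using sigma_algebra_Pow[of "UNIV :: 'a set"] by simp
  have ms: "measure_space UNIV (lambda_system UNIV UNIV hausdorff1_outer) (hausdorff1_outer :: 'a set \<Rightarrow> ennreal)"
    by (rule caratheodory_lemma[OF outer_measure_space_hausdorff1])
  then have sa: "sigma_algebra UNIV (lambda_system UNIV UNIV (hausdorff1_outer :: 'a set \<Rightarrow> ennreal))"
    by (simp add: measure_space_def)
  show "space (hausdorff1 :: 'a measure) = UNIV"
    by (simp add: hausdorff1_def)
  show sets: "sets (hausdorff1 :: 'a measure) = lambda_system UNIV UNIV hausdorff1_outer"
    using sigma_algebra.sets_measure_of_eq[OF sa] by (simp add: hausdorff1_def)
  show "emeasure hausdorff1 E = hausdorff1_outer E" if "E \<in> sets hausdorff1"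
    using that[unfolded sets] ms
    by (intro emeasure_measure_of[OF hausdorff1_def])
       (auto simp: sets measure_space_def)
qed


section \<open>Geometry of planar sets\<close>

text \<open>Only nonzero tangent vectors are collected; adding the zero vector would change neither
  \<open>normal_cone\<close> nor orthogonality to the tangent vectors.\<close>

definition tangent_vectors :: "plane set \<Rightarrow> plane \<Rightarrow> plane set" where
  "tangent_vectors A p = {v. v \<noteq> 0 \<and> (\<exists>s. (\<forall>n. s n \<in> A - {p}) \<and> s \<longlonglongrightarrow> p \<and>
     (\<lambda>n. (s n - p) /\<^sub>R norm (s n - p)) \<longlonglongrightarrow> v /\<^sub>R norm v)}"

definition normal_cone :: "plane set \<Rightarrow> plane \<Rightarrow> plane set" where
  "normal_cone A p = {u. \<forall>v\<in>tangent_vectors A p. u \<bullet> v \<le> 0}"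

definition closed_complement :: "plane set \<Rightarrow> plane set" where
  "closed_complement A = closure (- A)"

definition unique_nearest :: "plane set \<Rightarrow> plane set" where
  "unique_nearest A = {q. \<exists>!p. p \<in> A \<and> dist p q = infdist q A}"

definition metric_projection :: "plane set \<Rightarrow> plane \<Rightarrow> plane" where
  "metric_projection A q = (THE p. p \<in> A \<and> dist p q = infdist q A)"

definition normal_bundle :: "plane set \<Rightarrow> (plane \<times> plane) set" where
  "normal_bundle A =
     {(metric_projection A q,
       (q - metric_projection A q) /\<^sub>R norm (q - metric_projection A q)) | q. q \<in> unique_nearest A - A}"

definition reach_fun :: "plane set \<Rightarrow> plane \<Rightarrow> plane \<Rightarrow> ennreal" where
  "reach_fun A q u =
     (if (q, u) \<in> normal_bundle A
      then Inf {ennreal t | t. 0 \<le> t \<and> q + t *\<^sub>R u \<notin> unique_nearest A}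
      else 0)"

definition truncated_reach_sum :: "plane set \<Rightarrow> plane \<Rightarrow> ennreal" where
  "truncated_reach_sum A u = (\<Sum>\<^sub>\<infinity>q\<in>{q. (q, u) \<in> normal_bundle A}. min (reach_fun A q u) 1)"

definition jordan_domain :: "plane set \<Rightarrow> bool" where
  "jordan_domain A \<longleftrightarrow> compact A \<and> connected (interior A) \<and>
     (\<exists>g. simple_path g \<and> pathfinish g = pathstart g \<and> path_image g = frontier A)"

definition lipschitz_regular_boundary :: "plane set \<Rightarrow> bool" where
  "lipschitz_regular_boundary A \<longleftrightarrow>
     (\<exists>g C. simple_path g \<and> pathfinish g = pathstart g \<and> path_image g = frontier A \<and>
        C-lipschitz_on {0..1} g) \<and>
     (AE q in hausdorff1. q \<in> frontier A \<longrightarrow>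
        (\<exists>u. norm u = 1 \<and> (\<forall>v\<in>tangent_vectors (frontier A) q. u \<bullet> v = 0) \<and>
           normal_cone A q = {c *\<^sub>R u | c. 0 \<le> c} \<and>
           normal_cone (closed_complement A) q = {- (c *\<^sub>R u) | c. 0 \<le> c}))"

definition admissible_ambit_set :: "plane set \<Rightarrow> bool" where
  "admissible_ambit_set R \<longleftrightarrow>
     (\<exists>(n::nat) (Q :: nat \<Rightarrow> plane set). 1 \<le> n \<and> R = Q 1 - (\<Union>i\<in>{2..n}. Q i) \<and>
        (\<forall>i\<in>{1..n}. jordan_domain (Q i) \<and> lipschitz_regular_boundary (Q i)) \<and>
        (\<forall>i\<in>{2..n}. Q i \<subseteq> Q 1) \<and>
        (\<forall>i\<in>{2..n}. \<forall>j\<in>{2..n}. i \<noteq> j \<longrightarrow> Q i \<inter> Q j = {}) \<and>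
        (\<forall>i\<in>{1..n}.
           (\<integral>\<^sup>+u\<in>sphere 0 1. (truncated_reach_sum (Q i) u +
              truncated_reach_sum (closed_complement (Q i)) u) \<partial>hausdorff1) < \<infinity>))"


section \<open>Levy bases and Rajput-Rosinski integrals\<close>

definition tendsto_in_prob ::
    "'w measure \<Rightarrow> ('i \<Rightarrow> 'w \<Rightarrow> real) \<Rightarrow> ('w \<Rightarrow> real) \<Rightarrow> 'i filter \<Rightarrow> bool" where
  "tendsto_in_prob M Y Z G \<longleftrightarrow>
     Z \<in> borel_measurable M \<and> (\<forall>\<^sub>F i in G. Y i \<in> borel_measurable M) \<and>
     (\<forall>\<epsilon>>0. ((\<lambda>i. measure M {w \<in> space M. \<epsilon> < \<bar>Y i w - Z w\<bar>}) \<longlongrightarrow> 0) G)"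

definition infinitely_divisible :: "real measure \<Rightarrow> bool" where
  "infinitely_divisible \<mu> \<longleftrightarrow>
     (\<forall>n::nat. 0 < n \<longrightarrow> (\<exists>\<rho>. real_distribution \<rho> \<and>
        \<mu> = distr (\<Pi>\<^sub>M i\<in>{..<n}. \<rho>) borel (\<lambda>x. \<Sum>i<n. x i)))"

definition levy_measure :: "real measure \<Rightarrow> bool" where
  "levy_measure \<nu> \<longleftrightarrow> sets \<nu> = sets borel \<and> emeasure \<nu> {0} = 0 \<and>
     (\<integral>\<^sup>+x. ennreal (min 1 (x\<^sup>2)) \<partial>\<nu>) < \<infinity>"

definition levy_exponent :: "real \<Rightarrow> real \<Rightarrow> real measure \<Rightarrow> real \<Rightarrow> complex" where
  "levy_exponent \<gamma> b \<nu> z =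
     \<i> * complex_of_real (\<gamma> * z) - complex_of_real (b\<^sup>2 * z\<^sup>2 / 2) +
     (CLINT x|\<nu>. iexp (z * x) - 1 - \<i> * complex_of_real (z * x * indicator {-1..1} x))"

definition finite_area_sets :: "plane set set" where
  "finite_area_sets = {B \<in> sets borel. emeasure lborel B < \<infinity>}"

text \<open>A Levy basis is independently scattered: its values on any sequence of pairwise disjoint sets
  are mutually independent (for two disjoint sets, pad with empty sets).\<close>

definition homogeneous_levy_basis ::
    "'w measure \<Rightarrow> real \<Rightarrow> real \<Rightarrow> real measure \<Rightarrow> (plane set \<Rightarrow> 'w \<Rightarrow> real) \<Rightarrow> bool" where
  "homogeneous_levy_basis M \<gamma> b \<nu> L \<longleftrightarrow>
     0 \<le> b \<and> levy_measure \<nu> \<and>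
     (\<forall>B\<in>finite_area_sets. L B \<in> borel_measurable M \<and>
        infinitely_divisible (distr M borel (L B)) \<and>
        (\<forall>z. char (distr M borel (L B)) z =
               exp (complex_of_real (measure lborel B) * levy_exponent \<gamma> b \<nu> z))) \<and>
     (\<forall>B :: nat \<Rightarrow> plane set. range B \<subseteq> finite_area_sets \<and> disjoint_family B \<longrightarrow>
        prob_space.indep_vars M (\<lambda>_. borel) (\<lambda>i. L (B i)) UNIV \<and>
        ((\<Union>i. B i) \<in> finite_area_sets \<longrightarrow>
           (AE w in M. (\<lambda>i. L (B i) w) sums L (\<Union>i. B i) w)))"

definition simple_integrand :: "(plane \<Rightarrow> real) \<Rightarrow> bool" where
  "simple_integrand f \<longleftrightarrow> simple_function borel f \<and> emeasure lborel {q. f q \<noteq> 0} < \<infinity>"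

definition simple_levy_integral ::
    "(plane set \<Rightarrow> 'w \<Rightarrow> real) \<Rightarrow> plane set \<Rightarrow> (plane \<Rightarrow> real) \<Rightarrow> 'w \<Rightarrow> real" where
  "simple_levy_integral L B f w = (\<Sum>y\<in>range f - {0}. y * L (B \<inter> f -` {y}) w)"

text \<open>\<open>has_levy_integral M L A f Y\<close>: the random variable \<open>Y\<close> is a version of the integral of \<open>f\<close> over
  \<open>A\<close>. The integrand is cut off outside \<open>A\<close>, so that only the values of \<open>f\<close> on \<open>A\<close> matter.\<close>

definition has_levy_integral ::
    "'w measure \<Rightarrow> (plane set \<Rightarrow> 'w \<Rightarrow> real) \<Rightarrow> plane set \<Rightarrow> (plane \<Rightarrow> real) \<Rightarrow> ('w \<Rightarrow> real) \<Rightarrow> bool" where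
  "has_levy_integral M L A f Y \<longleftrightarrow>
     (\<lambda>q. indicator A q * f q) \<in> borel_measurable borel \<and>
     (\<exists>s. (\<forall>n. simple_integrand (s n)) \<and>
        (AE q in lborel. (\<lambda>n. s n q) \<longlonglongrightarrow> indicator A q * f q) \<and>
        (\<forall>B\<in>sets borel. \<exists>Z. tendsto_in_prob M (\<lambda>n. simple_levy_integral L B (s n)) Z sequentially) \<and>
        tendsto_in_prob M (\<lambda>n. simple_levy_integral L UNIV (s n)) Y sequentially)"

definition levy_integrable ::
    "'w measure \<Rightarrow> (plane set \<Rightarrow> 'w \<Rightarrow> real) \<Rightarrow> plane set \<Rightarrow> (plane \<Rightarrow> real) \<Rightarrow> bool" where
  "levy_integrable M L A f \<longleftrightarrow> (\<exists>Y. has_levy_integral M L A f Y)"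

text \<open>The integral is determined only up to null sets; an arbitrary version is selected.\<close>

definition levy_integral ::
    "'w measure \<Rightarrow> (plane set \<Rightarrow> 'w \<Rightarrow> real) \<Rightarrow> plane set \<Rightarrow> (plane \<Rightarrow> real) \<Rightarrow> 'w \<Rightarrow> real" where
  "levy_integral M L A f = (SOME Y. has_levy_integral M L A f Y)"

definition shifted_basis :: "(plane set \<Rightarrow> 'w \<Rightarrow> real) \<Rightarrow> real \<Rightarrow> plane set \<Rightarrow> 'w \<Rightarrow> real" where
  "shifted_basis L c B w = L B w - c * measure lborel B"

text \<open>\<open>X\<close> is a jointly measurable version of the field \<open>p \<mapsto> \<integral>\<^bsub>R + p\<^esub> F (p - q) L(dq)\<close>, the
  vector-valued integral being taken componentwise.\<close>

definition ambit_field ::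
    "'w measure \<Rightarrow> (plane set \<Rightarrow> 'w \<Rightarrow> real) \<Rightarrow> plane set \<Rightarrow> (plane \<Rightarrow> plane) \<Rightarrow>
     (plane \<Rightarrow> 'w \<Rightarrow> plane) \<Rightarrow> bool" where
  "ambit_field M L R F X \<longleftrightarrow>
     (\<lambda>(p, w). X p w) \<in> borel_measurable (borel \<Otimes>\<^sub>M M) \<and>
     (\<forall>p. has_levy_integral M L ((\<lambda>x. x + p) ` R) (\<lambda>q. fst (F (p - q))) (\<lambda>w. fst (X p w)) \<and>
          has_levy_integral M L ((\<lambda>x. x + p) ` R) (\<lambda>q. snd (F (p - q))) (\<lambda>w. snd (X p w)))"

end

theory Submission
  imports Defs "HOL-Real_Asymp.Real_Asymp"
begin

text \<open>
  Write \<open>G\<close> for the field \<open>F\<close> cut off outside \<open>S = - R\<close>, so that \<open>X p\<close> is the integral of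
  \<open>q \<mapsto> G (p - q)\<close>. A stochastic Fubini theorem turns the normalised circulation into the integral of
  \<open>q \<mapsto> h\<^sub>r (p - q)\<close>, where \<open>h\<^sub>r x\<close> is \<open>1 / (\<pi> r)\<close> times the integral of \<open>G (x + r u(\<theta>)) \<bullet> u\<^sup>\<bottom>(\<theta>)\<close> over
  the angle. By the definition of the derivative, \<open>h\<^sub>r\<close> tends to the curl in the interior of \<open>S\<close> and to
  zero outside its closure; the boundary, contained in finitely many Lipschitz curves, is a null set. The flux
  is the same with \<open>u\<close> in place of \<open>u\<^sup>\<bottom>\<close>. It remains to pass to the limit under the stochastic
  integral.

  The tool for this is a modulus \<open>\<kappa>\<close>: if the characteristic exponent of the basis is at most
  \<open>\<kappa> \<bar>z\<bar>\<close>, then the integral of \<open>f\<close> exceeds \<open>c\<close> with probability at most a constant times the area integral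
  of \<open>\<kappa> (8 \<bar>f\<bar> / c)\<close> (\<open>levy_integral_tail\<close>). If \<open>F\<close> vanishes on the boundary, then
  \<open>\<bar>F\<bar>\<close> is at most a multiple of the distance to the boundary, so the \<open>h\<^sub>r\<close> are uniformly bounded and
  dominated convergence applies. Otherwise \<open>h\<^sub>r\<close> is still bounded at distance more than \<open>r\<close> from the
  boundary, and of order \<open>1 / r\<close> in a tube whose area is of order \<open>r\<close>; the tube contributes
  \<open>r \<kappa> (a / r)\<close>. For a basis of finite variation without drift and Gaussian part \<open>\<kappa>\<close> can be taken to
  be \<open>z \<mapsto> \<integral> min 2 (z \<bar>x\<bar>) \<nu>(dx)\<close>, for which this tends to zero
  (\<open>finite_variation_modulus\<close>, \<open>error_modulus_tendsto\<close>). The drift is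
  harmless: it changes \<open>X\<close> by a constant vector, and constants have neither circulation nor flux.

  Two facts about the stochastic integral need real work. The limit that defines the integral is
  independent of the approximating simple functions (\<open>vanishing_integrands_limit\<close>, a gliding hump
  argument in the spirit of the Vitali-Hahn-Saks theorem). And the Fubini theorem
  (\<open>integral_of_integrals\<close>) has to do without moments, since the Levy measure may have heavy tails. On
  the event that no cell of a partition carries a value above \<open>K\<close>, first moments of integrals are bounded by the
  \<open>L\<^sup>2\<close> norm of the integrand, and the probability of this event tends to one as \<open>K\<close> grows,
  uniformly over all partitions (\<open>tail_weighted_sum\<close>); so the path \<open>\<theta> \<mapsto> X (p + r u(\<theta>))\<close> can be
  compared with step functions in \<open>L\<^sup>1\<close> without decomposing the basis into jumps.
\<close>

section \<open>Convergence in probability\<close>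

lemma tendsto_in_probD:
  assumes "tendsto_in_prob M Y Z G"
  shows "Z \<in> borel_measurable M" "\<forall>\<^sub>F i in G. Y i \<in> borel_measurable M"
    "\<epsilon> > 0 \<Longrightarrow> ((\<lambda>i. measure M {w \<in> space M. \<epsilon> < \<bar>Y i w - Z w\<bar>}) \<longlongrightarrow> 0) G"
  using assms by (auto simp: tendsto_in_prob_def)

context prob_space
begin

lemma tail_mono:
  assumes "AE w in M. \<bar>A w\<bar> \<le> \<bar>B w\<bar>" "B \<in> borel_measurable M"
  shows "prob {w \<in> space M. (e::real) < \<bar>A w\<bar>} \<le> prob {w \<in> space M. e < \<bar>B w\<bar>}"
  using assms by (intro finite_measure_mono_AE) (auto intro: AE_mp)

lemma tail_add:
  assumes [measurable]: "A \<in> borel_measurable M" "B \<in> borel_measurable M"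
    and "AE w in M. \<bar>C w\<bar> \<le> \<bar>A w\<bar> + \<bar>B w\<bar>"
  shows "prob {w \<in> space M. (a + b :: real) < \<bar>C w\<bar>}
    \<le> prob {w \<in> space M. a < \<bar>A w\<bar>} + prob {w \<in> space M. b < \<bar>B w\<bar>}"
proof -
  have "prob {w \<in> space M. a + b < \<bar>C w\<bar>}
      \<le> prob ({w \<in> space M. a < \<bar>A w\<bar>} \<union> {w \<in> space M. b < \<bar>B w\<bar>})"
    using assms(3) by (intro finite_measure_mono_AE) (auto elim!: eventually_mono)
  also have "\<dots> \<le> prob {w \<in> space M. a < \<bar>A w\<bar>} + prob {w \<in> space M. b < \<bar>B w\<bar>}"
    by (intro measure_Un_le) auto
  finally show ?thesis .
qed

lemma tendsto_in_probI_bound: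
  assumes "Z \<in> borel_measurable M" "\<forall>\<^sub>F i in G. Y i \<in> borel_measurable M"
    and "\<And>\<epsilon>. \<epsilon> > 0 \<Longrightarrow> (u \<epsilon> \<longlongrightarrow> (0::real)) G"
    and "\<And>\<epsilon>. \<epsilon> > 0 \<Longrightarrow> \<forall>\<^sub>F i in G. prob {w \<in> space M. \<epsilon> < \<bar>Y i w - Z w\<bar>} \<le> u \<epsilon> i"
  shows "tendsto_in_prob M Y Z G"
  unfolding tendsto_in_prob_def
proof (intro conjI allI impI assms(1,2))
  fix \<epsilon> :: real assume e: "0 < \<epsilon>"
  show "((\<lambda>i. prob {w \<in> space M. \<epsilon> < \<bar>Y i w - Z w\<bar>}) \<longlongrightarrow> 0) G"
    by (rule tendsto_sandwich[OF _ assms(4)[OF e] tendsto_const assms(3)[OF e]]) auto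
qed

text \<open>The algebraic closure properties of convergence in probability below all follow from this
  domination principle, with a constant \<open>k\<close> chosen for each operation.\<close>

lemma tendsto_in_prob_dominated:
  assumes A: "tendsto_in_prob M A A' G" and B: "tendsto_in_prob M B B' G"
    and C: "C' \<in> borel_measurable M" "\<forall>\<^sub>F i in G. C i \<in> borel_measurable M"
    and "\<forall>\<^sub>F i in G. AE w in M. \<bar>C i w - C' w\<bar> \<le> k * \<bar>A i w - A' w\<bar> + k * \<bar>B i w - B' w\<bar>"
    and k: "k > 0"
  shows "tendsto_in_prob M C C' G"
proof (rule tendsto_in_probI_bound[OF C])
  fix \<epsilon> :: real assume e: "\<epsilon> > 0"
  note a = tendsto_in_probD[OF A] and b = tendsto_in_probD[OF B]
  let ?e = "\<epsilon> / (2 * k)"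
  let ?u = "\<lambda>i. prob {w \<in> space M. ?e < \<bar>A i w - A' w\<bar>} + prob {w \<in> space M. ?e < \<bar>B i w - B' w\<bar>}"
  show "(?u \<longlongrightarrow> 0) G"
    using tendsto_add[OF a(3) b(3), of ?e ?e] e k by simp
  show "\<forall>\<^sub>F i in G. prob {w \<in> space M. \<epsilon> < \<bar>C i w - C' w\<bar>} \<le> ?u i"
    using a(2) b(2) assms(5)
  proof eventually_elim
    case (elim i)
    note [measurable] = elim(1,2) a(1) b(1)
    have [measurable]: "(\<lambda>w. k * (A i w - A' w)) \<in> borel_measurable M"
      "(\<lambda>w. k * (B i w - B' w)) \<in> borel_measurable M" by measurable
    have "prob {w \<in> space M. \<epsilon> / 2 + \<epsilon> / 2 < \<bar>C i w - C' w\<bar>}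
      \<le> prob {w \<in> space M. \<epsilon> / 2 < \<bar>k * (A i w - A' w)\<bar>} + prob {w \<in> space M. \<epsilon> / 2 < \<bar>k * (B i w - B' w)\<bar>}"
      using elim(3) k by (intro tail_add) (auto simp: abs_mult)
    moreover have "(\<epsilon> / 2 < \<bar>k * x\<bar>) = (?e < \<bar>x\<bar>)" for x
      using k by (simp add: abs_mult field_simps)
    ultimately show ?case by simp
  qed
qed

lemma tendsto_in_prob_const: "Z \<in> borel_measurable M \<Longrightarrow> tendsto_in_prob M (\<lambda>_. Z) Z G"
  by (simp add: tendsto_in_prob_def)

lemma tendsto_in_prob_add:
  assumes A: "tendsto_in_prob M A A' G" and B: "tendsto_in_prob M B B' G"
  shows "tendsto_in_prob M (\<lambda>i w. A i w + B i w) (\<lambda>w. A' w + B' w) G"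
proof (rule tendsto_in_prob_dominated[OF A B, where k = 1])
  show "\<forall>\<^sub>F i in G. (\<lambda>w. A i w + B i w) \<in> borel_measurable M"
    using tendsto_in_probD(2)[OF A] tendsto_in_probD(2)[OF B] by eventually_elim measurable
qed (use tendsto_in_probD(1)[OF A] tendsto_in_probD(1)[OF B] in \<open>auto intro!: always_eventually AE_I2\<close>)

lemma tendsto_in_prob_diff:
  assumes A: "tendsto_in_prob M A A' G" and B: "tendsto_in_prob M B B' G"
  shows "tendsto_in_prob M (\<lambda>i w. A i w - B i w) (\<lambda>w. A' w - B' w) G"
proof (rule tendsto_in_prob_dominated[OF A B, where k = 1])
  show "\<forall>\<^sub>F i in G. (\<lambda>w. A i w - B i w) \<in> borel_measurable M"
    using tendsto_in_probD(2)[OF A] tendsto_in_probD(2)[OF B] by eventually_elim measurable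
qed (use tendsto_in_probD(1)[OF A] tendsto_in_probD(1)[OF B] in \<open>auto intro!: always_eventually AE_I2\<close>)

lemma tendsto_in_prob_cmult:
  assumes A: "tendsto_in_prob M A A' G"
  shows "tendsto_in_prob M (\<lambda>i w. c * A i w) (\<lambda>w. c * A' w) G"
proof (rule tendsto_in_prob_dominated[OF A A, where k = "\<bar>c\<bar> + 1"])
  show "\<forall>\<^sub>F i in G. (\<lambda>w. c * A i w) \<in> borel_measurable M"
    using tendsto_in_probD(2)[OF A] by eventually_elim measurable
  have *: "\<bar>c * a - c * b\<bar> \<le> (\<bar>c\<bar> + 1) * \<bar>a - b\<bar> + (\<bar>c\<bar> + 1) * \<bar>a - b\<bar>" for a b
  proof -
    have "\<bar>c * a - c * b\<bar> = \<bar>c\<bar> * \<bar>a - b\<bar>" by (simp flip: abs_mult add: right_diff_distrib)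
    also have "\<dots> \<le> (\<bar>c\<bar> + 1) * \<bar>a - b\<bar>" by (intro mult_right_mono) auto
    finally show ?thesis by (smt (verit) mult_nonneg_nonneg abs_ge_zero)
  qed
  show "\<forall>\<^sub>F i in G. AE w in M. \<bar>c * A i w - c * A' w\<bar> \<le> (\<bar>c\<bar> + 1) * \<bar>A i w - A' w\<bar> + (\<bar>c\<bar> + 1) * \<bar>A i w - A' w\<bar>"
    using * by (intro always_eventually allI AE_I2)
qed (use tendsto_in_probD(1)[OF A] in auto)

lemma tendsto_in_prob_abs:
  assumes A: "tendsto_in_prob M A A' G"
  shows "tendsto_in_prob M (\<lambda>i w. \<bar>A i w\<bar>) (\<lambda>w. \<bar>A' w\<bar>) G"
proof (rule tendsto_in_prob_dominated[OF A A, where k = 1])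
  show "\<forall>\<^sub>F i in G. (\<lambda>w. \<bar>A i w\<bar>) \<in> borel_measurable M"
    using tendsto_in_probD(2)[OF A] by eventually_elim measurable
  have "\<bar>\<bar>x\<bar> - \<bar>y\<bar>\<bar> \<le> 1 * \<bar>x - y\<bar> + 1 * \<bar>x - y\<bar>" for x y  :: real by (simp add: abs_if)
  then show "\<forall>\<^sub>F i in G. AE w in M. \<bar>\<bar>A i w\<bar> - \<bar>A' w\<bar>\<bar> \<le> 1 * \<bar>A i w - A' w\<bar> + 1 * \<bar>A i w - A' w\<bar>"
    by (intro always_eventually allI AE_I2)
qed (use tendsto_in_probD(1)[OF A] in auto)

lemma tendsto_in_prob_sum:
  assumes "finite J" "\<And>j. j \<in> J \<Longrightarrow> tendsto_in_prob M (A j) (A' j) G"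
  shows "tendsto_in_prob M (\<lambda>i w. \<Sum>j\<in>J. A j i w) (\<lambda>w. \<Sum>j\<in>J. A' j w) G"
  using assms by (induction J) (auto intro!: tendsto_in_prob_add tendsto_in_prob_const)

lemma tendsto_in_prob_cong_AE:
  assumes "tendsto_in_prob M A A' G" "\<And>i. AE w in M. B i w = A i w" "AE w in M. B' w = A' w"
    and "\<forall>\<^sub>F i in G. B i \<in> borel_measurable M" "B' \<in> borel_measurable M"
  shows "tendsto_in_prob M B B' G"
proof (rule tendsto_in_prob_dominated[OF assms(1,1,5,4), where k = 1])
  have "AE w in M. \<bar>B i w - B' w\<bar> \<le> 1 * \<bar>A i w - A' w\<bar> + 1 * \<bar>A i w - A' w\<bar>" for i
    using assms(2)[of i] assms(3) by eventually_elim auto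
  then show "\<forall>\<^sub>F i in G. AE w in M. \<bar>B i w - B' w\<bar> \<le> 1 * \<bar>A i w - A' w\<bar> + 1 * \<bar>A i w - A' w\<bar>"
    by simp
qed auto

text \<open>Tail bounds survive limits in probability at the price of an arbitrarily small increase of the
  level.\<close>

lemma tail_limit:
  assumes A: "tendsto_in_prob M A A' G" and "G \<noteq> bot"
    and le: "\<forall>\<^sub>F i in G. prob {w \<in> space M. c < \<bar>A i w\<bar>} \<le> u i" and u: "(u \<longlongrightarrow> b) G" and e: "e > 0"
  shows "prob {w \<in> space M. c + e < \<bar>A' w\<bar>} \<le> b"
proof -
  note a = tendsto_in_probD[OF A]
  have "\<forall>\<^sub>F i in G. prob {w \<in> space M. c + e < \<bar>A' w\<bar>} \<le> u i + prob {w \<in> space M. e < \<bar>A i w - A' w\<bar>}"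
    using a(2) le
  proof eventually_elim
    case (elim i)
    note [measurable] = elim(1) a(1)
    have "prob {w \<in> space M. c + e < \<bar>A' w\<bar>} \<le> prob {w \<in> space M. c < \<bar>A i w\<bar>} + prob {w \<in> space M. e < \<bar>A i w - A' w\<bar>}"
      by (intro tail_add) auto
    with elim(2) show ?case by simp
  qed
  moreover have "((\<lambda>i. u i + prob {w \<in> space M. e < \<bar>A i w - A' w\<bar>}) \<longlongrightarrow> b + 0) G"
    using u a(3)[OF e] by (rule tendsto_add)
  ultimately show ?thesis
    using tendsto_lowerbound[OF _ _ \<open>G \<noteq> bot\<close>] by fastforce
qed

lemma AE_zero_if_tails_zero:
  assumes [measurable]: "A \<in> borel_measurable M" and "\<And>e. e > 0 \<Longrightarrow> prob {w \<in> space M. e < \<bar>A w\<bar>} \<le> (0::real)"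
  shows "AE w in M. A w = (0::real)"
proof -
  have "AE w in M. \<bar>A w\<bar> \<le> 1 / real (Suc n)" for n
  proof -
    have "prob {w \<in> space M. 1 / real (Suc n) < \<bar>A w\<bar>} = 0"
      using assms(2)[of "1 / real (Suc n)"] by (simp add: measure_le_0_iff)
    then have "AE w in M. \<not> (1 / real (Suc n) < \<bar>A w\<bar>)"
      by (subst (asm) prob_eq_0) auto
    then show ?thesis by (auto simp: not_less)
  qed
  then have "AE w in M. \<forall>n. \<bar>A w\<bar> \<le> 1 / real (Suc n)" by (simp add: AE_all_countable)
  then show ?thesis
  proof eventually_elim
    case (elim w)
    show ?case
    proof (rule ccontr)
      assume "A w \<noteq> 0"
      then obtain n where "1 / real (Suc n) < \<bar>A w\<bar>"
        using reals_Archimedean[of "\<bar>A w\<bar>"] by (auto simp: inverse_eq_divide)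
      with elim show False by (auto simp: not_less[symmetric])
    qed
  qed
qed

lemma tendsto_in_prob_unique:
  assumes A: "tendsto_in_prob M A A' G" and B: "tendsto_in_prob M A B' G" and "G \<noteq> bot"
  shows "AE w in M. A' w = B' w"
proof -
  have *: "tendsto_in_prob M (\<lambda>i w. A i w - A i w) (\<lambda>w. A' w - B' w) G"
    by (rule tendsto_in_prob_diff[OF A B])
  have "AE w in M. A' w - B' w = 0"
  proof (rule AE_zero_if_tails_zero)
    show "(\<lambda>w. A' w - B' w) \<in> borel_measurable M"
      using tendsto_in_probD(1)[OF *] .
    show "prob {w \<in> space M. e < \<bar>A' w - B' w\<bar>} \<le> 0" if "e > 0" for e
      using tail_limit[OF * \<open>G \<noteq> bot\<close>, of "e/2" "\<lambda>_. 0" 0 "e/2"] that by auto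
  qed
  then show ?thesis by eventually_elim auto
qed

lemma tendsto_in_prob_subseq:
  assumes "tendsto_in_prob M A A' sequentially" "strict_mono r"
  shows "tendsto_in_prob M (\<lambda>n. A (r n)) A' sequentially"
  using assms filterlim_subseq[OF assms(2)]
  unfolding tendsto_in_prob_def
  by (auto intro: filterlim_compose eventually_compose_filterlim)

lemma tendsto_in_prob_AE:
  assumes [measurable]: "\<And>n. A n \<in> borel_measurable M" "A' \<in> borel_measurable M"
    and lim: "AE w in M. (\<lambda>n. A n w :: real) \<longlonglongrightarrow> A' w"
  shows "tendsto_in_prob M A A' sequentially"
  unfolding tendsto_in_prob_def
proof (intro conjI allI impI)
  fix \<epsilon> :: real assume e: "\<epsilon> > 0"
  have "(\<lambda>n. \<integral>w. indicator {w \<in> space M. \<epsilon> < \<bar>A n w - A' w\<bar>} w \<partial>M) \<longlonglongrightarrow> (\<integral>w. (0::real) \<partial>M)"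
  proof (rule integral_dominated_convergence[where w = "\<lambda>_. 1"])
    show "AE w in M. (\<lambda>n. indicator {w \<in> space M. \<epsilon> < \<bar>A n w - A' w\<bar>} w) \<longlonglongrightarrow> (0::real)"
      using lim
    proof eventually_elim
      case (elim w)
      have "\<forall>\<^sub>F n in sequentially. dist (A n w) (A' w) < \<epsilon>"
        using tendstoD[OF elim e] .
      then show ?case
        by (intro tendsto_eventually) (auto elim!: eventually_mono simp: dist_real_def)
    qed
  qed (auto split: split_indicator)
  then show "(\<lambda>n. prob {w \<in> space M. \<epsilon> < \<bar>A n w - A' w\<bar>}) \<longlonglongrightarrow> 0"
    by simp
qed auto

text \<open>A subsequence with geometrically small increments converges almost surely, by the
  Borel-Cantelli lemma; the Cauchy property transfers its limit to the whole sequence.\<close>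

lemma Cauchy_in_prob_convergent:
  assumes m[measurable]: "\<And>n. A n \<in> borel_measurable M"
    and cau: "\<And>e. e > 0 \<Longrightarrow> \<exists>N. \<forall>m\<ge>N. \<forall>n\<ge>N. prob {w \<in> space M. e < \<bar>A m w - A n w :: real\<bar>} \<le> e"
  shows "\<exists>Z. tendsto_in_prob M A Z sequentially"
proof -
  have "\<forall>k. \<exists>N. \<forall>m\<ge>N. \<forall>n\<ge>N. prob {w \<in> space M. (1/2)^k < \<bar>A m w - A n w :: real\<bar>} \<le> (1/2)^k"
    using cau by simp
  then obtain N where N: "\<And>k m n. m \<ge> N k \<Longrightarrow> n \<ge> N k \<Longrightarrow>
      prob {w \<in> space M. (1/2)^k < \<bar>A m w - A n w\<bar>} \<le> (1/2)^k" by metis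
  define r where "r k = (\<Sum>i\<le>k. N i) + k" for k
  have r: "strict_mono r" by (intro strict_monoI_Suc) (simp add: r_def)
  have rN: "r m \<ge> N k" if "k \<le> m" for k m
  proof -
    have "N k \<le> (\<Sum>i\<le>m. N i)" using that by (intro member_le_sum) auto
    then show ?thesis by (simp add: r_def)
  qed
  define E where "E k = {w \<in> space M. (1/2)^k < \<bar>A (r (Suc k)) w - A (r k) w\<bar>}" for k
  have Em[measurable]: "E k \<in> sets M" for k unfolding E_def by measurable
  have "summable (\<lambda>k. prob (E k))"
  proof (rule summable_comparison_test)
    show "\<exists>n0. \<forall>k\<ge>n0. norm (prob (E k)) \<le> (1/2)^k"
      using N rN by (auto simp: E_def)
  qed (auto intro!: summable_geometric)
  then have "AE w in M. eventually (\<lambda>k. w \<in> space M - E k) sequentially"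
    by (intro borel_cantelli_AE1) (auto simp: emeasure_eq_measure)
  then have conv: "AE w in M. convergent (\<lambda>k. A (r k) w)"
  proof eventually_elim
    case (elim w)
    then have "\<forall>\<^sub>F k in sequentially. norm (A (r (Suc k)) w - A (r k) w) \<le> (1/2)^k"
      by eventually_elim (auto simp: E_def)
    then have "summable (\<lambda>k. A (r (Suc k)) w - A (r k) w)"
      by (rule summable_comparison_test_ev) (auto intro!: summable_geometric)
    then have "convergent (\<lambda>n. (\<Sum>k<n. A (r (Suc k)) w - A (r k) w))"
      by (simp add: summable_iff_convergent)
    then have "convergent (\<lambda>n. (A (r n) w - A (r 0) w) + A (r 0) w)"
      by (subst (asm) sum_lessThan_telescope) (intro convergent_add convergent_const)
    then show ?case by simp
  qed
  define Z where "Z w = lim (\<lambda>k. A (r k) w)" for w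
  have [measurable]: "Z \<in> borel_measurable M" unfolding Z_def by measurable
  have sub: "tendsto_in_prob M (\<lambda>k. A (r k)) Z sequentially"
    using conv by (intro tendsto_in_prob_AE) (auto simp: Z_def convergent_LIMSEQ_iff)
  have "tendsto_in_prob M (\<lambda>n w. A n w - A (r n) w) (\<lambda>w. 0) sequentially"
    unfolding tendsto_in_prob_def
  proof (intro conjI allI impI)
    fix \<epsilon> :: real assume e: "\<epsilon> > 0"
    show "(\<lambda>n. prob {w \<in> space M. \<epsilon> < \<bar>A n w - A (r n) w - 0\<bar>}) \<longlonglongrightarrow> 0"
    proof (rule LIMSEQ_I)
      fix d :: real assume d: "d > 0"
      define e' where "e' = min \<epsilon> (d/2)"
      obtain K where K: "\<forall>m\<ge>K. \<forall>n\<ge>K. prob {w \<in> space M. e' < \<bar>A m w - A n w\<bar>} \<le> e'"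
        using cau[of e'] e d by (auto simp: e'_def)
      have "prob {w \<in> space M. \<epsilon> < \<bar>A n w - A (r n) w\<bar>} < d" if "n \<ge> K" for n
      proof -
        have "prob {w \<in> space M. \<epsilon> < \<bar>A n w - A (r n) w\<bar>} \<le> prob {w \<in> space M. e' < \<bar>A n w - A (r n) w\<bar>}"
          by (intro finite_measure_mono) (auto simp: e'_def)
        also have "\<dots> \<le> e'" using K that seq_suble[OF r, of n] by (metis le_trans)
        finally show ?thesis using d by (simp add: e'_def)
      qed
      then show "\<exists>no. \<forall>n\<ge>no. norm (prob {w \<in> space M. \<epsilon> < \<bar>A n w - A (r n) w - 0\<bar>} - 0) < d"
        by auto
    qed
  qed auto
  from tendsto_in_prob_add[OF this sub] show ?thesis by auto
qed

end

section \<open>Independently scattered set functions with a continuity modulus\<close>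

lemma (in prob_space) expectation_one_minus_cos_le:
  assumes X[measurable]: "X \<in> borel_measurable M"
  shows "expectation (\<lambda>w. 1 - cos (t * X w)) \<le> cmod (char (distr M borel X) t - 1)"
proof -
  have int: "integrable M (\<lambda>w. iexp (t * X w))"
    by (rule integrable_const_bound[where B = 1]) auto
  have "expectation (\<lambda>w. 1 - cos (t * X w)) = 1 - expectation (\<lambda>w. Re (iexp (t * X w)))"
    by (subst Bochner_Integration.integral_diff)
       (auto simp: Re_exp prob_space intro!: integrable_const_bound[where B = 1])
  also have "\<dots> = 1 - Re (char (distr M borel X) t)"
    using int by (simp add: char_def integral_distr integral_Re[OF int])
  also have "\<dots> \<le> cmod (char (distr M borel X) t - 1)"
    using abs_Re_le_cmod[of "char (distr M borel X) t - 1"] by simp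
  finally show ?thesis .
qed

lemma (in prob_space) expectation_sin_le:
  assumes X[measurable]: "X \<in> borel_measurable M"
  shows "\<bar>expectation (\<lambda>w. sin (t * X w))\<bar> \<le> cmod (char (distr M borel X) t - 1)"
proof -
  have int: "integrable M (\<lambda>w. iexp (t * X w))"
    by (rule integrable_const_bound[where B = 1]) auto
  have "expectation (\<lambda>w. sin (t * X w)) = expectation (\<lambda>w. Im (iexp (t * X w)))"
    by (simp add: Im_exp)
  also have "\<dots> = Im (char (distr M borel X) t - 1)"
    using int by (simp add: char_def integral_distr integral_Im[OF int])
  finally show ?thesis using abs_Im_le_cmod[of "char (distr M borel X) t - 1"] by simp
qed

text \<open>The average of \<open>1 - cos (t x)\<close> over \<open>t \<in> [0, 2 / c]\<close> is at least one half once \<open>\<bar>x\<bar> > c\<close>;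
  so tails are controlled by the characteristic function near zero.\<close>

lemma (in prob_space) tail_le_char:
  assumes X[measurable]: "X \<in> borel_measurable M" and c: "c > 0"
    and b: "\<And>t. 0 \<le> t \<Longrightarrow> t \<le> 2 / c \<Longrightarrow> cmod (char (distr M borel X) t - 1) \<le> b"
  shows "prob {w \<in> space M. c < \<bar>X w\<bar>} \<le> 2 * b"
proof -
  define a where "a = 2 / c"
  have a: "a > 0" using c by (simp add: a_def)
  define \<mu> where "\<mu> = restrict_space lborel {0..a}"
  interpret \<mu>: finite_measure \<mu>
    by (intro finite_measureI) (simp add: \<mu>_def space_restrict_space emeasure_restrict_space a less_imp_le)
  interpret P: pair_sigma_finite \<mu> M ..
  have inner: "(\<integral>t. 1 - cos (t * x) \<partial>\<mu>) \<ge> a / 2 * indicator {x. c < \<bar>x\<bar>} x" for x :: real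
  proof (cases "c < \<bar>x\<bar>")
    case True
    then have x: "x \<noteq> 0" using c by auto
    have "has_bochner_integral lborel (\<lambda>t. (1 - cos (t * x)) * indicator {0..a} t) ((a - sin (a * x) / x) - (0 - sin (0 * x) / x))"
      using a x by (intro has_bochner_integral_FTC_Icc_real) (auto intro!: derivative_eq_intros continuous_intros)
    then have "(\<integral>t. 1 - cos (t * x) \<partial>\<mu>) = a - sin (a * x) / x"
      unfolding \<mu>_def by (subst integral_restrict_space) (auto simp: has_bochner_integral_iff mult.commute)
    moreover have "sin (a * x) / x \<le> 1 / c"
    proof -
      have "sin (a * x) / x \<le> \<bar>sin (a * x)\<bar> / \<bar>x\<bar>" by (metis abs_divide abs_ge_self)
      also have "\<dots> \<le> 1 / c" using True c by (intro frac_le) auto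
      finally show ?thesis .
    qed
    ultimately show ?thesis using True by (simp add: a_def)
  next
    case False
    then show ?thesis by (auto intro!: Bochner_Integration.integral_nonneg)
  qed
  have int: "integrable (\<mu> \<Otimes>\<^sub>M M) (\<lambda>(t, w). 1 - cos (t * X w))"
  proof -
    interpret PF: finite_measure "\<mu> \<Otimes>\<^sub>M M"
      by (rule finite_measure_pair_measure) (auto simp: \<mu>.finite_measure_axioms finite_measure_axioms)
    have [measurable]: "(\<lambda>t. t) \<in> borel_measurable \<mu>" by (simp add: \<mu>_def measurable_restrict_space1)
    have "\<bar>1 - cos x\<bar> \<le> 2" for x :: real
      using cos_ge_minus_one[of x] cos_le_one[of x] by linarith
    then show ?thesis
      by (intro PF.integrable_const_bound[where B = 2] AE_I2) (simp_all add: case_prod_beta)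
  qed
  have "a / 2 * prob {w \<in> space M. c < \<bar>X w\<bar>} = expectation (\<lambda>w. a / 2 * indicator {x. c < \<bar>x\<bar>} (X w))"
  proof -
    have "expectation (\<lambda>w. indicator {x. c < \<bar>x\<bar>} (X w)) = expectation (indicator {w \<in> space M. c < \<bar>X w\<bar>} :: _ \<Rightarrow> real)"
      by (intro Bochner_Integration.integral_cong) (auto split: split_indicator)
    then show ?thesis by simp
  qed
  also have "\<dots> \<le> expectation (\<lambda>w. \<integral>t. 1 - cos (t * X w) \<partial>\<mu>)"
  proof (rule integral_mono)
    show "integrable M (\<lambda>w. a / 2 * indicator {x. c < \<bar>x\<bar>} (X w) :: real)"
      by (intro integrable_mult_right integrable_const_bound[where B = 1]) (auto split: split_indicator)
    show "integrable M (\<lambda>w. \<integral>t. 1 - cos (t * X w) \<partial>\<mu>)"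
      using P.integrable_snd[OF int] by simp
  qed (rule inner)
  also have "\<dots> = (\<integral>t. expectation (\<lambda>w. 1 - cos (t * X w)) \<partial>\<mu>)"
    using P.Fubini_integral[of "\<lambda>t w. 1 - cos (t * X w)"] int by simp
  also have "\<dots> \<le> (\<integral>t. b \<partial>\<mu>)"
  proof (rule integral_mono_AE)
    show "integrable \<mu> (\<lambda>t. expectation (\<lambda>w. 1 - cos (t * X w)))"
      using P.integrable_fst'[OF int] by simp
    show "AE t in \<mu>. expectation (\<lambda>w. 1 - cos (t * X w)) \<le> b"
      using b unfolding \<mu>_def
      by (intro AE_I2 order_trans[OF expectation_one_minus_cos_le]) (auto simp: space_restrict_space a_def)
  qed auto
  also have "\<dots> = a * b"
    using a by (simp add: \<mu>_def measure_restrict_space space_restrict_space)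
  finally show ?thesis using a by (simp add: field_simps)
qed

lemma (in prob_space) indep_vars_reindex_inj:
  assumes inj: "inj_on h I" and ind: "indep_vars N X (h ` I)"
  shows "indep_vars (\<lambda>i. N (h i)) (\<lambda>i. X (h i)) I"
  unfolding indep_vars_def2
proof (intro conjI)
  show "\<forall>i\<in>I. random_variable (N (h i)) (X (h i))"
    using ind by (auto simp: indep_vars_def2)
  define F where "F i = {X i -` A \<inter> space M |A. A \<in> sets (N i)}" for i
  have F: "indep_sets F (h ` I)" using ind unfolding indep_vars_def2 F_def[abs_def] by simp
  have "indep_sets (\<lambda>i. F (h i)) I"
  proof (rule indep_setsI)
    show "F (h i) \<subseteq> events" if "i \<in> I" for i using F that by (auto simp: indep_sets_def)
    fix A J assume J: "J \<noteq> {}" "J \<subseteq> I" "finite J" and A: "\<forall>j\<in>J. A j \<in> F (h j)"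
    have injJ: "inj_on h J" using inj J(2) by (rule inj_on_subset)
    have inv: "inv_into J h (h j) = j" if "j \<in> J" for j using injJ that by simp
    have "prob (\<Inter>k\<in>h ` J. A (inv_into J h k)) = (\<Prod>k\<in>h ` J. prob (A (inv_into J h k)))"
      using J A inv by (intro indep_setsD[OF F]) auto
    then show "prob (\<Inter>j\<in>J. A j) = (\<Prod>j\<in>J. prob (A j))"
      using inv by (simp add: prod.reindex[OF injJ])
  qed
  then show "indep_sets (\<lambda>i. {X (h i) -` A \<inter> space M |A. A \<in> sets (N (h i))}) I"
    by (simp add: F_def)
qed

lemma finite_area_sets_subset:
  assumes "A \<in> finite_area_sets" "B \<in> sets borel" "B \<subseteq> A"
  shows "B \<in> finite_area_sets"
proof -
  have "emeasure lborel B \<le> emeasure lborel A"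
    using assms by (intro emeasure_mono) (auto simp: finite_area_sets_def)
  then show ?thesis using assms by (auto simp: finite_area_sets_def)
qed

lemma finite_area_cball: "cball (a :: plane) r \<in> finite_area_sets"
  using emeasure_bounded_finite[OF bounded_cball, of a r] by (simp add: finite_area_sets_def)

lemma finite_area_sets_UN:
  assumes "finite I" "\<And>i. i \<in> I \<Longrightarrow> E i \<in> finite_area_sets"
  shows "(\<Union>i\<in>I. E i) \<in> finite_area_sets"
proof -
  have "emeasure lborel (\<Union>i\<in>I. E i) \<le> (\<Sum>i\<in>I. emeasure lborel (E i))"
    using assms by (intro emeasure_subadditive_finite) (auto simp: finite_area_sets_def)
  also have "\<dots> < \<infinity>" using assms by (auto simp: finite_area_sets_def)
  finally show ?thesis using assms by (auto simp: finite_area_sets_def)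
qed

lemma finite_area_sets_Un:
  assumes "A \<in> finite_area_sets" "B \<in> finite_area_sets"
  shows "A \<union> B \<in> finite_area_sets"
  using assms emeasure_subadditive[of A lborel B]
  by (auto simp: finite_area_sets_def intro: le_less_trans)

lemma finite_area_sets_empty [simp]: "{} \<in> finite_area_sets"
  by (simp add: finite_area_sets_def)

lemma finite_area_setsD:
  assumes "B \<in> finite_area_sets"
  shows "B \<in> sets borel" "emeasure lborel B < \<infinity>" "B \<in> fmeasurable lborel"
  using assms by (auto simp: finite_area_sets_def fmeasurable_def)

text \<open>An abstraction of a homogeneous Levy basis that keeps independence, additivity and, of the
  characteristic triplet, only a modulus \<open>\<kappa>\<close> bounding the distance of characteristic functions from one. One basis
  can be used with several moduli, and a basis and its drift-shifted versions are treated alike.\<close>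

locale controlled_basis = prob_space M for M :: "'w measure" +
  fixes \<Lambda> :: "plane set \<Rightarrow> 'w \<Rightarrow> real" and \<kappa> :: "real \<Rightarrow> real"
  assumes basis_measurable: "B \<in> finite_area_sets \<Longrightarrow> \<Lambda> B \<in> borel_measurable M"
    and char_bound: "B \<in> finite_area_sets \<Longrightarrow>
      cmod (char (distr M borel (\<Lambda> B)) z - 1) \<le> measure lborel B * \<kappa> \<bar>z\<bar>"
    and scattered: "\<And>B :: nat \<Rightarrow> plane set. range B \<subseteq> finite_area_sets \<Longrightarrow> disjoint_family B \<Longrightarrow>
      indep_vars (\<lambda>_. borel) (\<lambda>i. \<Lambda> (B i)) UNIV"
    and sigma_additive: "\<And>B :: nat \<Rightarrow> plane set. range B \<subseteq> finite_area_sets \<Longrightarrow> disjoint_family B \<Longrightarrow>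
      (\<Union>i. B i) \<in> finite_area_sets \<Longrightarrow> AE w in M. (\<lambda>i. \<Lambda> (B i) w) sums \<Lambda> (\<Union>i. B i) w"
    and modulus_mono: "mono \<kappa>" and modulus_0: "\<kappa> 0 = 0" and modulus_tendsto_0: "(\<kappa> \<longlongrightarrow> 0) (at 0)"
begin

lemma modulus_nonneg: "0 \<le> x \<Longrightarrow> 0 \<le> \<kappa> x"
  using monoD[OF modulus_mono, of 0 x] modulus_0 by simp

lemma modulus_le: "x \<le> y \<Longrightarrow> \<kappa> x \<le> \<kappa> y"
  by (rule monoD[OF modulus_mono])

lemma modulus_measurable [measurable]: "\<kappa> \<in> borel_measurable borel"
  by (rule borel_measurable_mono[OF modulus_mono])

lemma modulus_tendsto: "(f \<longlongrightarrow> 0) G \<Longrightarrow> ((\<lambda>x. \<kappa> (f x)) \<longlongrightarrow> 0) G"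
  using isCont_tendsto_compose[of 0 \<kappa> f G] modulus_tendsto_0 modulus_0 by (simp add: isCont_def)

lemma basis_empty: "AE w in M. \<Lambda> {} w = 0"
proof -
  have "AE w in M. (\<lambda>i::nat. \<Lambda> {} w) sums \<Lambda> {} w"
    using sigma_additive[of "\<lambda>_. {}"] by (auto simp: disjoint_family_on_def)
  then show ?thesis
    by eventually_elim (auto dest!: sums_summable summable_LIMSEQ_zero simp: LIMSEQ_const_iff)
qed

text \<open>Independence and additivity are postulated for sequences, so finite families are padded with
  empty sets.\<close>

lemma finite_family_as_sequence:
  assumes fin: "finite I" and dis: "disjoint_family_on E I" and E: "\<And>i. i \<in> I \<Longrightarrow> E i \<in> finite_area_sets"
  obtains B :: "nat \<Rightarrow> plane set" and h :: "'i \<Rightarrow> nat"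
  where "range B \<subseteq> finite_area_sets" "disjoint_family B" "inj_on h I" "h ` I = {..<card I}"
    "\<And>i. i \<in> I \<Longrightarrow> B (h i) = E i" "\<And>n. \<not> n < card I \<Longrightarrow> B n = {}"
proof -
  obtain h where h: "bij_betw h I {..<card I}"
    using fin by (metis bij_betw_iff_card finite_lessThan card_lessThan)
  define B where "B n = (if n < card I then E (inv_into I h n) else {})" for n
  have inv: "inv_into I h n \<in> I" "h (inv_into I h n) = n" if "n < card I" for n
    using h that by (auto simp: bij_betw_def inv_into_into f_inv_into_f)
  have "disjoint_family B"
    unfolding disjoint_family_on_def
  proof (intro ballI impI)
    fix m n :: nat assume mn: "m \<noteq> n"
    show "B m \<inter> B n = {}"
    proof (cases "m < card I \<and> n < card I")
      case True
      then have "inv_into I h m \<noteq> inv_into I h n" using inv mn by metis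
      then show ?thesis
        using True inv disjoint_family_onD[OF dis] by (simp add: B_def)
    qed (auto simp: B_def)
  qed
  moreover have "range B \<subseteq> finite_area_sets" using E inv by (auto simp: B_def)
  moreover have "B (h i) = E i" if "i \<in> I" for i
    using h that by (auto simp: B_def bij_betw_def)
  ultimately show ?thesis using h by (intro that[of B h]) (auto simp: bij_betw_def B_def)
qed

lemma indep_finite_family:
  assumes "finite I" "disjoint_family_on E I" "\<And>i. i \<in> I \<Longrightarrow> E i \<in> finite_area_sets"
  shows "indep_vars (\<lambda>_. borel) (\<lambda>i. \<Lambda> (E i)) I"
proof -
  obtain B h where Bh: "range B \<subseteq> finite_area_sets" "disjoint_family B" "inj_on h I"
    "h ` I = {..<card I}" "\<And>i. i \<in> I \<Longrightarrow> B (h i) = E i" "\<And>n. \<not> n < card I \<Longrightarrow> B n = {}"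
    by (rule finite_family_as_sequence[OF assms]) (assumption, rule that)
  have "indep_vars (\<lambda>_. borel) (\<lambda>i. \<Lambda> (B i)) (h ` I)"
    by (rule indep_vars_subset[OF scattered[OF Bh(1,2)]]) auto
  from indep_vars_reindex_inj[OF Bh(3) this] have "indep_vars (\<lambda>_. borel) (\<lambda>i. \<Lambda> (B (h i))) I"
    by (simp add: comp_def)
  then show ?thesis using Bh(5) by (subst (asm) indep_vars_cong[OF refl]) auto
qed

lemma finitely_additive:
  assumes "finite I" "disjoint_family_on E I" "\<And>i. i \<in> I \<Longrightarrow> E i \<in> finite_area_sets"
  shows "AE w in M. \<Lambda> (\<Union>i\<in>I. E i) w = (\<Sum>i\<in>I. \<Lambda> (E i) w)"
proof -
  obtain B h where Bh: "range B \<subseteq> finite_area_sets" "disjoint_family B" "inj_on h I"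
    "h ` I = {..<card I}" "\<And>i. i \<in> I \<Longrightarrow> B (h i) = E i" "\<And>n. \<not> n < card I \<Longrightarrow> B n = {}"
    by (rule finite_family_as_sequence[OF assms]) (assumption, rule that)
  have U: "(\<Union>n. B n) = (\<Union>i\<in>I. E i)"
  proof -
    have "n < card I" if "x \<in> B n" for x n
      using that Bh(6)[of n] by (cases "n < card I") auto
    then have "(\<Union>n. B n) = (\<Union>n\<in>{..<card I}. B n)" by blast
    also have "\<dots> = (\<Union>i\<in>I. B (h i))" unfolding Bh(4)[symmetric] by simp
    finally show ?thesis using Bh(5) by simp
  qed
  have "AE w in M. (\<lambda>i. \<Lambda> (B i) w) sums \<Lambda> (\<Union>i. B i) w"
    using Bh(1,2) U finite_area_sets_UN[OF assms(1,3)] by (intro sigma_additive) simp_all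
  with basis_empty show ?thesis
  proof eventually_elim
    case (elim w)
    have "(\<lambda>i. \<Lambda> (B i) w) sums (\<Sum>i<card I. \<Lambda> (B i) w)"
      using Bh(6) elim(1) by (intro sums_finite) auto
    then have "\<Lambda> (\<Union>i. B i) w = (\<Sum>i<card I. \<Lambda> (B i) w)"
      using elim(2) sums_unique2 by blast
    also have "\<dots> = (\<Sum>i\<in>I. \<Lambda> (E i) w)"
      unfolding Bh(4)[symmetric] using Bh(5) by (simp add: sum.reindex[OF Bh(3)])
    finally show ?case by (simp add: U)
  qed
qed

text \<open>By independence the characteristic function of the sum is a product, and products of numbers in
  the unit disc differ from one by at most the sum of the differences of the factors.\<close>

lemma char_sum_bound:
  assumes fin: "finite I" and dis: "disjoint_family_on E I" and E: "\<And>i. i \<in> I \<Longrightarrow> E i \<in> finite_area_sets"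
  shows "cmod (char (distr M borel (\<lambda>w. \<Sum>i\<in>I. y i * \<Lambda> (E i) w)) z - 1)
    \<le> (\<Sum>i\<in>I. measure lborel (E i) * \<kappa> (\<bar>z\<bar> * \<bar>y i\<bar>))"
proof -
  have m[measurable]: "i \<in> I \<Longrightarrow> \<Lambda> (E i) \<in> borel_measurable M" for i
    using E basis_measurable by auto
  have ind: "indep_vars (\<lambda>_. borel) (\<lambda>i w. y i * \<Lambda> (E i) w) I"
    by (rule indep_vars_compose2[OF indep_finite_family[OF assms], where Y = "\<lambda>i x. y i * x"]) auto
  have c: "char (distr M borel (\<lambda>w. y i * \<Lambda> (E i) w)) z = char (distr M borel (\<Lambda> (E i))) (z * y i)" if "i \<in> I" for i
    using that by (simp add: char_def integral_distr mult.assoc)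
  have "char (distr M borel (\<lambda>w. \<Sum>i\<in>I. y i * \<Lambda> (E i) w)) z
      = (\<Prod>i\<in>I. char (distr M borel (\<lambda>w. y i * \<Lambda> (E i) w)) z)"
    by (rule char_distr_sum[OF ind])
  also have "\<dots> = (\<Prod>i\<in>I. char (distr M borel (\<Lambda> (E i))) (z * y i))"
    using c by simp
  finally have "cmod (char (distr M borel (\<lambda>w. \<Sum>i\<in>I. y i * \<Lambda> (E i) w)) z - 1)
    = cmod ((\<Prod>i\<in>I. char (distr M borel (\<Lambda> (E i))) (z * y i)) - (\<Prod>i\<in>I. 1))" by simp
  also have "\<dots> \<le> (\<Sum>i\<in>I. cmod (char (distr M borel (\<Lambda> (E i))) (z * y i) - 1))"
  proof (rule norm_prod_diff)
    fix i assume i: "i \<in> I"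
    have "real_distribution (distr M borel (\<Lambda> (E i)))" using i by (simp add: real_distribution_distr)
    then show "cmod (char (distr M borel (\<Lambda> (E i))) (z * y i)) \<le> 1"
      by (rule real_distribution.cmod_char_le_1)
  qed auto
  also have "\<dots> \<le> (\<Sum>i\<in>I. measure lborel (E i) * \<kappa> \<bar>z * y i\<bar>)"
    using E char_bound by (intro sum_mono) auto
  finally show ?thesis by (simp add: abs_mult)
qed

lemma tail_sum_bound:
  assumes fin: "finite I" and dis: "disjoint_family_on E I" and E: "\<And>i. i \<in> I \<Longrightarrow> E i \<in> finite_area_sets"
    and c: "c > 0"
  shows "prob {w \<in> space M. c < \<bar>\<Sum>i\<in>I. y i * \<Lambda> (E i) w\<bar>}
    \<le> 2 * (\<Sum>i\<in>I. \<kappa> (2 / c * \<bar>y i\<bar>) * measure lborel (E i))"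
proof (rule tail_le_char[OF _ c])
  have m[measurable]: "i \<in> I \<Longrightarrow> \<Lambda> (E i) \<in> borel_measurable M" for i
    using E basis_measurable by auto
  show "(\<lambda>w. \<Sum>i\<in>I. y i * \<Lambda> (E i) w) \<in> borel_measurable M" by measurable
  fix t assume t: "0 \<le> t" "t \<le> 2 / c"
  show "cmod (char (distr M borel (\<lambda>w. \<Sum>i\<in>I. y i * \<Lambda> (E i) w)) t - 1)
      \<le> (\<Sum>i\<in>I. \<kappa> (2 / c * \<bar>y i\<bar>) * measure lborel (E i))"
    using t mult_right_mono[OF t(2) abs_ge_zero]
    by (intro order_trans[OF char_sum_bound[OF fin dis E]] sum_mono)
       (simp_all add: mult.commute[of "measure lborel _"] mult_right_mono modulus_le)
qed

end

section \<open>Integrals of simple functions\<close>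

lemma simple_integrand_measurable: "simple_integrand f \<Longrightarrow> f \<in> borel_measurable borel"
  by (auto simp: simple_integrand_def intro: borel_measurable_simple_function)

lemma simple_integrand_support:
  assumes f: "simple_integrand f"
  shows "{q. f q \<noteq> 0} \<in> finite_area_sets"
proof -
  note [measurable] = simple_integrand_measurable[OF f]
  have "{q. f q \<noteq> 0} \<in> sets borel" by measurable
  then show ?thesis using f by (simp add: simple_integrand_def finite_area_sets_def)
qed

lemma simple_integrandI:
  assumes "simple_function borel f" "{q. f q \<noteq> 0} \<subseteq> B" "B \<in> finite_area_sets"
  shows "simple_integrand f"
proof -
  note [measurable] = borel_measurable_simple_function[OF assms(1)]
  have "{q. f q \<noteq> 0} \<in> sets borel" by measurable
  then have "{q. f q \<noteq> 0} \<in> finite_area_sets" using finite_area_sets_subset assms by blast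
  then show ?thesis using assms(1) by (simp add: simple_integrand_def finite_area_sets_def)
qed

lemma simple_integrand_level_set:
  assumes f: "simple_integrand f" and B: "B \<in> sets borel" and y: "y \<noteq> 0"
  shows "B \<inter> f -` {y} \<in> finite_area_sets"
proof -
  note [measurable] = simple_integrand_measurable[OF f]
  have "{q. f q \<noteq> 0} \<in> finite_area_sets"
    by (rule simple_integrand_support[OF f])
  moreover have "B \<inter> f -` {y} \<in> sets borel" using B by measurable
  ultimately show ?thesis
    by (rule finite_area_sets_subset) (use y in auto)
qed

lemma simple_integrand_compose2:
  assumes "simple_integrand f" "simple_integrand g" "\<phi> 0 0 = 0"
  shows "simple_integrand (\<lambda>q. \<phi> (f q) (g q))"
proof -
  show ?thesis
  proof (rule simple_integrandI)
    show "simple_function borel (\<lambda>q. \<phi> (f q) (g q))"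
      using assms(1,2) unfolding simple_integrand_def
      by (intro simple_function_compose2[where h = \<phi>, of borel f g]) blast+
    show "{q. f q \<noteq> 0} \<union> {q. g q \<noteq> 0} \<in> finite_area_sets"
      using assms by (intro finite_area_sets_Un simple_integrand_support)
    show "{q. \<phi> (f q) (g q) \<noteq> 0} \<subseteq> {q. f q \<noteq> 0} \<union> {q. g q \<noteq> 0}"
      using assms(3) by auto
  qed
qed

lemma simple_integrand_diff:
  "simple_integrand f \<Longrightarrow> simple_integrand g \<Longrightarrow> simple_integrand (\<lambda>q. f q - g q)"
  by (rule simple_integrand_compose2[where \<phi> = "(-)"]) auto

lemma simple_integrand_cmult: "simple_integrand f \<Longrightarrow> simple_integrand (\<lambda>q. c * f q)"
  by (rule simple_integrand_compose2[where \<phi> = "\<lambda>x y. c * x"]) auto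

text \<open>Cells are indexed by the tuple of values taken on them: this makes distinct cells disjoint, and
  the value of an integrand on a cell is read off the index.\<close>

lemma common_refinement:
  fixes f :: "'j \<Rightarrow> plane \<Rightarrow> real"
  assumes fin: "finite J" and f: "\<And>j. j \<in> J \<Longrightarrow> simple_integrand (f j)" and B: "B \<in> sets borel"
  obtains I :: "('j \<Rightarrow> real) set" and E where "finite I" "disjoint_family_on E I"
    "\<And>i. i \<in> I \<Longrightarrow> E i \<in> finite_area_sets" "\<And>i. i \<in> I \<Longrightarrow> E i \<subseteq> B"
    "\<And>i j q. i \<in> I \<Longrightarrow> j \<in> J \<Longrightarrow> q \<in> E i \<Longrightarrow> f j q = i j"
    "\<And>j. j \<in> J \<Longrightarrow> B \<inter> {q. f j q \<noteq> 0} \<subseteq> (\<Union>i\<in>I. E i)"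
proof -
  define v where "v q = restrict (\<lambda>j. f j q) J" for q
  define B' where "B' = B \<inter> (\<Union>j\<in>J. {q. f j q \<noteq> 0})"
  have m[measurable]: "j \<in> J \<Longrightarrow> f j \<in> borel_measurable borel" for j
    using f simple_integrand_measurable by auto
  have "(\<Union>j\<in>J. {q. f j q \<noteq> 0}) \<in> finite_area_sets"
    using f fin by (intro finite_area_sets_UN simple_integrand_support)
  then have B': "B' \<in> finite_area_sets"
    using B by (rule_tac finite_area_sets_subset) (auto simp: B'_def finite_area_sets_def)
  define E where "E i = B' \<inter> {q. \<forall>j\<in>J. f j q = i j}" for i
  have E: "E i \<in> finite_area_sets" for i
  proof (rule finite_area_sets_subset[OF B'])
    have "{q. \<forall>j\<in>J. f j q = i j} \<in> sets borel" using fin m by measurable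
    then show "E i \<in> sets borel" using B' by (auto simp: E_def finite_area_sets_def)
  qed (auto simp: E_def)
  have vI: "q \<in> E (v q)" if "q \<in> B'" for q using that by (auto simp: E_def v_def)
  show ?thesis
  proof (rule that[of "v ` B'" E])
    have "v ` B' \<subseteq> PiE J (\<lambda>j. range (f j))" by (auto simp: v_def)
    then show "finite (v ` B')"
      using fin f by (rule_tac finite_subset) (auto intro!: finite_PiE simp: simple_integrand_def simple_function_def)
    show "disjoint_family_on E (v ` B')"
      unfolding disjoint_family_on_def
    proof (intro ballI impI)
      fix i i' assume i: "i \<in> v ` B'" "i' \<in> v ` B'" "i \<noteq> i'"
      show "E i \<inter> E i' = {}"
      proof (rule ccontr)
        assume "E i \<inter> E i' \<noteq> {}"
        then obtain q where "\<forall>j\<in>J. i j = i' j" by (auto simp: E_def)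
        with i show False by (auto simp: v_def fun_eq_iff restrict_def split: if_splits)
      qed
    qed
    show "B \<inter> {q. f j q \<noteq> 0} \<subseteq> (\<Union>i\<in>v ` B'. E i)" if "j \<in> J" for j
      using that vI by (auto simp: B'_def)
  qed (use E in \<open>auto simp: E_def B'_def\<close>)
qed

lemma integral_refinement:
  fixes \<phi> :: "real \<Rightarrow> real"
  assumes I: "finite I" "disjoint_family_on E I" "\<And>i. i \<in> I \<Longrightarrow> E i \<in> finite_area_sets"
    and EB: "\<And>i. i \<in> I \<Longrightarrow> E i \<subseteq> B" and val: "\<And>i q. i \<in> I \<Longrightarrow> q \<in> E i \<Longrightarrow> f q = y i"
    and cov: "B \<inter> {q. f q \<noteq> 0} \<subseteq> (\<Union>i\<in>I. E i)" and \<phi>: "\<phi> 0 = 0"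
  shows "integrable lborel (\<lambda>q. indicator B q * \<phi> (f q))"
    and "(\<integral>q. indicator B q * \<phi> (f q) \<partial>lborel) = (\<Sum>i\<in>I. \<phi> (y i) * measure lborel (E i))"
proof -
  have eq: "indicator B q * \<phi> (f q) = (\<Sum>i\<in>I. \<phi> (y i) * indicator (E i) q)" for q
  proof (cases "q \<in> (\<Union>i\<in>I. E i)")
    case True
    then obtain i where i: "i \<in> I" "q \<in> E i" by auto
    have "(\<Sum>i\<in>I. \<phi> (y i) * indicator (E i) q) = (\<Sum>i'\<in>{i}. \<phi> (y i') * indicator (E i') q :: real)"
      using i I(1) disjoint_family_onD[OF I(2), of i]
      by (intro sum.mono_neutral_right) (auto split: split_indicator)
    moreover have "q \<in> B" using i EB by blast
    ultimately show ?thesis using i val[OF i] by simp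
  next
    case False
    then have "(\<Sum>i\<in>I. \<phi> (y i) * indicator (E i) q) = (0::real)" by (intro sum.neutral) auto
    moreover have "indicator B q * \<phi> (f q) = 0" using False cov \<phi> by (auto split: split_indicator)
    ultimately show ?thesis by simp
  qed
  have int: "integrable lborel (\<lambda>q. \<phi> (y i) * indicator (E i) q)" if "i \<in> I" for i
    using I(3)[OF that] by (auto simp: finite_area_sets_def)
  show "integrable lborel (\<lambda>q. indicator B q * \<phi> (f q))"
    unfolding eq using int by (rule Bochner_Integration.integrable_sum)
  show "(\<integral>q. indicator B q * \<phi> (f q) \<partial>lborel) = (\<Sum>i\<in>I. \<phi> (y i) * measure lborel (E i))"
    unfolding eq using int by (subst Bochner_Integration.integral_sum) auto
qed

context controlled_basis
begin

lemma simple_integral_measurable: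
  assumes "simple_integrand f" "B \<in> sets borel"
  shows "simple_levy_integral \<Lambda> B f \<in> borel_measurable M"
  unfolding simple_levy_integral_def[abs_def]
  using simple_integrand_level_set[OF assms] basis_measurable by measurable

text \<open>Integrals of simple functions are defined by level sets; through this lemma they can be computed
  from any finer partition, and hence several of them from a common one.\<close>

lemma simple_integral_refinement:
  assumes f: "simple_integrand f" and B: "B \<in> sets borel"
    and I: "finite I" "disjoint_family_on E I" "\<And>i. i \<in> I \<Longrightarrow> E i \<in> finite_area_sets"
    and EB: "\<And>i. i \<in> I \<Longrightarrow> E i \<subseteq> B" and val: "\<And>i q. i \<in> I \<Longrightarrow> q \<in> E i \<Longrightarrow> f q = y i"
    and cov: "B \<inter> {q. f q \<noteq> 0} \<subseteq> (\<Union>i\<in>I. E i)"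
  shows "AE w in M. simple_levy_integral \<Lambda> B f w = (\<Sum>i\<in>I. y i * \<Lambda> (E i) w)"
proof -
  let ?R = "range f - {0}"
  have finR: "finite ?R" using f by (auto simp: simple_integrand_def simple_function_def)
  have lev: "B \<inter> f -` {z} = (\<Union>i\<in>{i\<in>I. y i = z}. E i)" if "z \<noteq> 0" for z
  proof (intro equalityI subsetI)
    fix q assume q: "q \<in> B \<inter> f -` {z}"
    then obtain i where i: "i \<in> I" "q \<in> E i" using cov \<open>z \<noteq> 0\<close> by auto
    then have "y i = z" using val[OF i] q by simp
    with i show "q \<in> (\<Union>i\<in>{i\<in>I. y i = z}. E i)" by blast
  next
    fix q assume "q \<in> (\<Union>i\<in>{i\<in>I. y i = z}. E i)"
    then obtain i where i: "i \<in> I" "q \<in> E i" "y i = z" by blast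
    then show "q \<in> B \<inter> f -` {z}" using val[OF i(1,2)] EB[OF i(1)] by auto
  qed
  have "AE w in M. \<forall>z\<in>?R. \<Lambda> (B \<inter> f -` {z}) w = (\<Sum>i | i \<in> I \<and> y i = z. \<Lambda> (E i) w)"
  proof (rule AE_finite_allI[OF finR])
    fix z assume z: "z \<in> ?R"
    have "AE w in M. \<Lambda> (\<Union>i\<in>{i\<in>I. y i = z}. E i) w = (\<Sum>i | i \<in> I \<and> y i = z. \<Lambda> (E i) w)"
      using I by (intro finitely_additive) (auto intro: disjoint_family_on_mono)
    then show "AE w in M. \<Lambda> (B \<inter> f -` {z}) w = (\<Sum>i | i \<in> I \<and> y i = z. \<Lambda> (E i) w)"
      using lev z by simp
  qed
  with basis_empty show ?thesis
  proof eventually_elim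
    case (elim w)
    have "simple_levy_integral \<Lambda> B f w = (\<Sum>z\<in>?R. z * (\<Sum>i | i \<in> I \<and> y i = z. \<Lambda> (E i) w))"
      unfolding simple_levy_integral_def using elim(2) by (intro sum.cong) auto
    also have "\<dots> = (\<Sum>z\<in>?R. \<Sum>i | i \<in> {i\<in>I. y i \<in> ?R} \<and> y i = z. y i * \<Lambda> (E i) w)"
      unfolding sum_distrib_left by (intro sum.cong) auto
    also have "\<dots> = (\<Sum>i\<in>{i\<in>I. y i \<in> ?R}. y i * \<Lambda> (E i) w)"
      using I(1) finR by (intro sum.group) auto
    also have "\<dots> = (\<Sum>i\<in>I. y i * \<Lambda> (E i) w)"
    proof (rule sum.mono_neutral_left)
      show "\<forall>i\<in>I - {i \<in> I. y i \<in> ?R}. y i * \<Lambda> (E i) w = 0"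
      proof
        fix i assume i: "i \<in> I - {i \<in> I. y i \<in> ?R}"
        show "y i * \<Lambda> (E i) w = 0"
        proof (cases "E i = {}")
          case False
          then obtain q where "q \<in> E i" by blast
          moreover have "i \<in> I" using i by blast
          ultimately have "y i = f q" using val by metis
          then have "y i \<in> range f" by (simp only: rangeI)
          with i have "y i = 0" by blast
          then show ?thesis by simp
        qed (simp add: elim(1))
      qed
    qed (use I in auto)
    finally show ?case .
  qed
qed

lemma simple_integral_diff:
  assumes f: "simple_integrand f" and g: "simple_integrand g" and B: "B \<in> sets borel"
  shows "AE w in M. simple_levy_integral \<Lambda> B (\<lambda>q. f q - g q) w
    = simple_levy_integral \<Lambda> B f w - simple_levy_integral \<Lambda> B g w"
proof -
  have s: "simple_integrand (case_bool f g j)" for j using f g by (auto split: bool.split)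
  obtain I E where I: "finite I" "disjoint_family_on E I"
    "\<And>i. i \<in> I \<Longrightarrow> E i \<in> finite_area_sets" "\<And>i. i \<in> I \<Longrightarrow> E i \<subseteq> B"
    and v: "\<And>i j q. i \<in> I \<Longrightarrow> j \<in> (UNIV::bool set) \<Longrightarrow> q \<in> E i \<Longrightarrow> case_bool f g j q = i j"
    and c: "\<And>j. j \<in> (UNIV::bool set) \<Longrightarrow> B \<inter> {q. case_bool f g j q \<noteq> 0} \<subseteq> (\<Union>i\<in>I. E i)"
    using common_refinement[of "UNIV::bool set" "case_bool f g" B] s B by auto
  have "B \<inter> {q. f q - g q \<noteq> 0} \<subseteq> (B \<inter> {q. f q \<noteq> 0}) \<union> (B \<inter> {q. g q \<noteq> 0})" by auto
  then have cov: "B \<inter> {q. f q - g q \<noteq> 0} \<subseteq> (\<Union>i\<in>I. E i)"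
    using c[of True] c[of False] by auto
  have "AE w in M. simple_levy_integral \<Lambda> B f w = (\<Sum>i\<in>I. i True * \<Lambda> (E i) w)"
    using v[of _ True] c[of True] by (intro simple_integral_refinement f B I) auto
  moreover have "AE w in M. simple_levy_integral \<Lambda> B g w = (\<Sum>i\<in>I. i False * \<Lambda> (E i) w)"
    using v[of _ False] c[of False] by (intro simple_integral_refinement g B I) auto
  moreover have "AE w in M. simple_levy_integral \<Lambda> B (\<lambda>q. f q - g q) w = (\<Sum>i\<in>I. (i True - i False) * \<Lambda> (E i) w)"
    using v[of _ False] v[of _ True] cov
    by (intro simple_integral_refinement simple_integrand_diff f g B I) auto
  ultimately show ?thesis
    by eventually_elim (simp add: left_diff_distrib sum_subtractf)
qed

lemma simple_refinement:
  assumes f: "simple_integrand f" and B: "B \<in> sets borel"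
  obtains I :: "(unit \<Rightarrow> real) set" and E where "finite I" "disjoint_family_on E I"
    "\<And>i. i \<in> I \<Longrightarrow> E i \<in> finite_area_sets" "\<And>i. i \<in> I \<Longrightarrow> E i \<subseteq> B"
    "\<And>i q. i \<in> I \<Longrightarrow> q \<in> E i \<Longrightarrow> f q = i ()" "B \<inter> {q. f q \<noteq> 0} \<subseteq> (\<Union>i\<in>I. E i)"
  using common_refinement[of "UNIV::unit set" "\<lambda>_. f" B] assms by auto

lemma simple_integral_cmult:
  assumes f: "simple_integrand f" and B: "B \<in> sets borel"
  shows "AE w in M. simple_levy_integral \<Lambda> B (\<lambda>q. c * f q) w = c * simple_levy_integral \<Lambda> B f w"
proof -
  obtain I :: "(unit \<Rightarrow> real) set" and E where I: "finite I" "disjoint_family_on E I"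
    "\<And>i. i \<in> I \<Longrightarrow> E i \<in> finite_area_sets" "\<And>i. i \<in> I \<Longrightarrow> E i \<subseteq> B"
    and v: "\<And>i q. i \<in> I \<Longrightarrow> q \<in> E i \<Longrightarrow> f q = i ()" and c: "B \<inter> {q. f q \<noteq> 0} \<subseteq> (\<Union>i\<in>I. E i)"
    using simple_refinement[OF assms] by blast
  have "AE w in M. simple_levy_integral \<Lambda> B f w = (\<Sum>i\<in>I. i () * \<Lambda> (E i) w)"
    by (intro simple_integral_refinement f B I v c)
  moreover have "AE w in M. simple_levy_integral \<Lambda> B (\<lambda>q. c * f q) w = (\<Sum>i\<in>I. (c * i ()) * \<Lambda> (E i) w)"
    using v c by (intro simple_integral_refinement simple_integrand_cmult f B I) auto
  ultimately show ?thesis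
    by eventually_elim (simp add: sum_distrib_left mult.assoc)
qed

lemma simple_integral_split:
  assumes f: "simple_integrand f" and B: "B \<in> sets borel" and C: "C \<in> sets borel"
  shows "AE w in M. simple_levy_integral \<Lambda> B f w
    = simple_levy_integral \<Lambda> (B \<inter> C) f w + simple_levy_integral \<Lambda> (B - C) f w"
proof -
  have finR: "finite (range f - {0})" using f by (auto simp: simple_integrand_def simple_function_def)
  have "AE w in M. \<forall>z\<in>range f - {0}. \<Lambda> (B \<inter> f -` {z}) w = \<Lambda> (B \<inter> C \<inter> f -` {z}) w + \<Lambda> ((B - C) \<inter> f -` {z}) w"
  proof (rule AE_finite_allI[OF finR])
    fix z assume z: "z \<in> range f - {0}"
    let ?E = "case_bool (B \<inter> C \<inter> f -` {z}) ((B - C) \<inter> f -` {z})"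
    have "AE w in M. \<Lambda> (\<Union>i\<in>UNIV. ?E i) w = (\<Sum>i\<in>UNIV. \<Lambda> (?E i) w)"
      using z B C simple_integrand_level_set[OF f] sets.Int[OF B C] sets.Diff[OF B C]
      by (intro finitely_additive) (auto simp: disjoint_family_on_def split: bool.splits)
    moreover have "(\<Union>i\<in>UNIV. ?E i) = B \<inter> f -` {z}" by (auto simp: UN_bool_eq)
    ultimately show "AE w in M. \<Lambda> (B \<inter> f -` {z}) w = \<Lambda> (B \<inter> C \<inter> f -` {z}) w + \<Lambda> ((B - C) \<inter> f -` {z}) w"
      by (simp add: UNIV_bool add.commute)
  qed
  then show ?thesis
  proof eventually_elim
    case (elim w)
    then show ?case
      unfolding simple_levy_integral_def sum.distrib[symmetric]
      by (intro sum.cong) (auto simp: distrib_left)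
  qed
qed

lemma simple_integral_tail:
  assumes f: "simple_integrand f" and B: "B \<in> sets borel" and c: "c > 0"
  shows "prob {w \<in> space M. c < \<bar>simple_levy_integral \<Lambda> B f w\<bar>}
      \<le> 2 * (\<integral>q. indicator B q * \<kappa> (2 / c * \<bar>f q\<bar>) \<partial>lborel)"
    and "integrable lborel (\<lambda>q. indicator B q * \<kappa> (2 / c * \<bar>f q\<bar>))"
proof -
  obtain I :: "(unit \<Rightarrow> real) set" and E where I: "finite I" "disjoint_family_on E I"
    "\<And>i. i \<in> I \<Longrightarrow> E i \<in> finite_area_sets" "\<And>i. i \<in> I \<Longrightarrow> E i \<subseteq> B"
    and v: "\<And>i q. i \<in> I \<Longrightarrow> q \<in> E i \<Longrightarrow> f q = i ()" and cov: "B \<inter> {q. f q \<noteq> 0} \<subseteq> (\<Union>i\<in>I. E i)"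
    using simple_refinement[OF f B] by blast
  have AE: "AE w in M. simple_levy_integral \<Lambda> B f w = (\<Sum>i\<in>I. i () * \<Lambda> (E i) w)"
    by (intro simple_integral_refinement f B I v cov)
  note ir = integral_refinement[OF I v cov, where \<phi> = "\<lambda>y. \<kappa> (2 / c * \<bar>y\<bar>)"]
  show "integrable lborel (\<lambda>q. indicator B q * \<kappa> (2 / c * \<bar>f q\<bar>))"
    using ir(1) by (simp add: modulus_0)
  have "prob {w \<in> space M. c < \<bar>simple_levy_integral \<Lambda> B f w\<bar>} \<le> prob {w \<in> space M. c < \<bar>\<Sum>i\<in>I. i () * \<Lambda> (E i) w\<bar>}"
    using AE I(3) basis_measurable by (intro tail_mono) (auto elim!: eventually_mono)
  also have "\<dots> \<le> 2 * (\<Sum>i\<in>I. \<kappa> (2 / c * \<bar>i ()\<bar>) * measure lborel (E i))"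
    by (rule tail_sum_bound[OF I(1,2,3) c])
  also have "\<dots> = 2 * (\<integral>q. indicator B q * \<kappa> (2 / c * \<bar>f q\<bar>) \<partial>lborel)"
    using ir(2) by (simp add: modulus_0)
  finally show "prob {w \<in> space M. c < \<bar>simple_levy_integral \<Lambda> B f w\<bar>}
      \<le> 2 * (\<integral>q. indicator B q * \<kappa> (2 / c * \<bar>f q\<bar>) \<partial>lborel)" .
qed

end

section \<open>Integrals of deterministic functions\<close>

lemma has_levy_integral_indicator:
  "has_levy_integral M L A f Y \<longleftrightarrow> has_levy_integral M L UNIV (\<lambda>q. indicator A q * f q) Y"
  by (simp add: has_levy_integral_def)

lemma has_levy_integral_UNIV_I:
  assumes "f \<in> borel_measurable borel" "\<And>n. simple_integrand (s n)" "AE q in lborel. (\<lambda>n. s n q) \<longlonglongrightarrow> f q"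
    and "\<And>B. B \<in> sets borel \<Longrightarrow> \<exists>Z. tendsto_in_prob M (\<lambda>n. simple_levy_integral L B (s n)) Z sequentially"
    and "tendsto_in_prob M (\<lambda>n. simple_levy_integral L UNIV (s n)) Y sequentially"
  shows "has_levy_integral M L UNIV f Y"
  unfolding has_levy_integral_def using assms by (simp add: exI[of _ s])

lemma has_levy_integral_UNIV_E:
  assumes "has_levy_integral M L UNIV f Y"
  obtains s where "\<And>n. simple_integrand (s n)" "AE q in lborel. (\<lambda>n. s n q) \<longlonglongrightarrow> f q"
    "\<And>B. B \<in> sets borel \<Longrightarrow> \<exists>Z. tendsto_in_prob M (\<lambda>n. simple_levy_integral L B (s n)) Z sequentially"
    "tendsto_in_prob M (\<lambda>n. simple_levy_integral L UNIV (s n)) Y sequentially"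
  using assms unfolding has_levy_integral_def by auto

lemma has_levy_integral_measurable:
  assumes "has_levy_integral M L UNIV f Y"
  shows "f \<in> borel_measurable borel" "Y \<in> borel_measurable M"
  using assms by (auto simp: has_levy_integral_def tendsto_in_prob_def)

context controlled_basis
begin

lemma modulus_integrable:
  assumes [measurable]: "f \<in> borel_measurable borel" and B: "B \<in> finite_area_sets"
    and f: "\<And>q. \<bar>f q\<bar> \<le> C * indicator B q" and a: "a \<ge> 0"
  shows "integrable lborel (\<lambda>q. \<kappa> (a * \<bar>f q\<bar>))"
proof (rule Bochner_Integration.integrable_bound)
  show "integrable lborel (\<lambda>q. \<kappa> (a * C) * indicator B q)"
    using B by (auto simp: finite_area_sets_def)
  have "norm (\<kappa> (a * \<bar>f q\<bar>)) \<le> norm (\<kappa> (a * C) * indicator B q)" for q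
  proof (cases "q \<in> B")
    case True
    then show ?thesis using f[of q] a modulus_nonneg[of "a * \<bar>f q\<bar>"] modulus_le[of "a * \<bar>f q\<bar>" "a * C"]
      by (auto simp: mult_left_mono)
  next
    case False
    then show ?thesis using f[of q] modulus_0 by auto
  qed
  then show "AE q in lborel. norm (\<kappa> (a * \<bar>f q\<bar>)) \<le> norm (\<kappa> (a * C) * indicator B q)" by simp
qed auto

lemma modulus_integral_tendsto:
  assumes m[measurable]: "\<And>n::nat. f n \<in> borel_measurable borel" and B: "B \<in> finite_area_sets"
    and f: "\<And>n q. \<bar>f n q\<bar> \<le> C * indicator B q" and a: "a \<ge> 0"
    and lim: "AE q in lborel. (\<lambda>n. f n q) \<longlonglongrightarrow> 0"
  shows "(\<lambda>n. \<integral>q. \<kappa> (a * \<bar>f n q\<bar>) \<partial>lborel) \<longlonglongrightarrow> 0"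
proof -
  have "(\<lambda>n. \<integral>q. \<kappa> (a * \<bar>f n q\<bar>) \<partial>lborel) \<longlonglongrightarrow> (\<integral>q. 0 \<partial>(lborel :: plane measure))"
  proof (rule integral_dominated_convergence)
    show "integrable lborel (\<lambda>q. \<kappa> (a * \<bar>C * indicator B q\<bar>))"
      using B by (intro modulus_integrable[where C = "\<bar>C\<bar>" and B = B] a)
        (auto simp: finite_area_sets_def split: split_indicator)
    show "AE q in lborel. (\<lambda>n. \<kappa> (a * \<bar>f n q\<bar>)) \<longlonglongrightarrow> 0"
      using lim
    proof eventually_elim
      case (elim q)
      have "(\<lambda>n. a * \<bar>f n q\<bar>) \<longlonglongrightarrow> a * \<bar>0\<bar>"
        by (intro tendsto_intros elim)
      then show ?case by (intro modulus_tendsto) simp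
    qed
    show "AE q in lborel. norm (\<kappa> (a * \<bar>f n q\<bar>)) \<le> \<kappa> (a * \<bar>C * indicator B q\<bar>)" for n
      using a f by (auto intro!: modulus_le mult_left_mono order_trans[OF f abs_ge_self] simp: modulus_nonneg)
  qed auto
  then show ?thesis by simp
qed

text \<open>The modulus need not be subadditive, but it is monotone, and the larger of two summands is at
  least half the sum.\<close>

lemma modulus_add_le:
  assumes "a \<ge> 0" "z \<le> \<bar>x\<bar> + \<bar>y\<bar>"
  shows "\<kappa> (a * z) \<le> \<kappa> (2 * a * \<bar>x\<bar>) + \<kappa> (2 * a * \<bar>y\<bar>)"
proof -
  define m where "m = max \<bar>x\<bar> \<bar>y\<bar>"
  have "a * z \<le> a * (2 * m)" using assms by (intro mult_left_mono) (auto simp: m_def)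
  then have "\<kappa> (a * z) \<le> \<kappa> (2 * a * m)" by (intro modulus_le) (simp add: mult_ac)
  also have "\<dots> \<le> \<kappa> (2 * a * \<bar>x\<bar>) + \<kappa> (2 * a * \<bar>y\<bar>)"
    using assms modulus_nonneg[of "2 * a * \<bar>x\<bar>"] modulus_nonneg[of "2 * a * \<bar>y\<bar>"]
    by (auto simp: m_def max_def)
  finally show ?thesis .
qed

lemma simple_integral_tail_subset:
  assumes f: "simple_integrand f" and D: "D \<in> sets borel" and B: "B \<in> sets borel" and DB: "D \<subseteq> B" and c: "c > 0"
  shows "prob {w \<in> space M. c < \<bar>simple_levy_integral \<Lambda> D f w\<bar>}
      \<le> 2 * (\<integral>q. indicator B q * \<kappa> (2 / c * \<bar>f q\<bar>) \<partial>lborel)"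
proof -
  have "(\<integral>q. indicator D q * \<kappa> (2 / c * \<bar>f q\<bar>) \<partial>lborel) \<le> (\<integral>q. indicator B q * \<kappa> (2 / c * \<bar>f q\<bar>) \<partial>lborel)"
    using DB c modulus_nonneg
    by (intro integral_mono simple_integral_tail(2) f D B) (auto split: split_indicator)
  then show ?thesis using simple_integral_tail(1)[OF f D c] by linarith
qed

text \<open>The integral of the zero function vanishes, whatever simple functions are used to approximate
  it. On a set where these are eventually bounded this is dominated convergence. If a nonzero limit
  \<open>Z\<close> were left over, its mass would have to escape from every set of that kind; a gliding hump then
  yields one Borel set over which the integrals are close to \<open>Z\<close> infinitely often, and close to zero
  infinitely often.\<close>

lemma vanishing_integrands_limit:
  assumes d: "\<And>n. simple_integrand (d n)" and lim: "AE q in lborel. (\<lambda>n. d n q) \<longlonglongrightarrow> 0"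
    and conv: "\<And>B. B \<in> sets borel \<Longrightarrow> \<exists>Z. tendsto_in_prob M (\<lambda>n. simple_levy_integral \<Lambda> B (d n)) Z sequentially"
    and Z: "tendsto_in_prob M (\<lambda>n. simple_levy_integral \<Lambda> UNIV (d n)) Z sequentially"
  shows "AE w in M. Z w = 0"
proof -
  \<comment> \<open>Integrals over subsets of \<open>B k\<close> vanish in the limit, and the sets \<open>B k\<close> exhaust the plane up to a null set.\<close>
  define B where "B k = {q \<in> cball 0 (real k). \<forall>n\<ge>k. \<bar>d n q\<bar> \<le> 1}" for k :: nat
  let ?S = "\<lambda>D n. simple_levy_integral \<Lambda> D (d n)"
  note [measurable] = simple_integrand_measurable[OF d]
  have Bm[measurable]: "B k \<in> sets borel" for k unfolding B_def by measurable
  have Bf: "B k \<in> finite_area_sets" for k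
  proof (rule finite_area_sets_subset[OF _ Bm])
    show "cball 0 (real k) \<in> finite_area_sets" by (rule finite_area_cball)
  qed (auto simp: B_def)
  have Bmono: "B k \<subseteq> B k'" if "k \<le> k'" for k k' using that by (fastforce simp: B_def)
  have Bex: "AE q in lborel. \<forall>\<^sub>F k in sequentially. q \<in> B k"
    using lim
  proof eventually_elim
    case (elim q)
    have "\<forall>\<^sub>F n in sequentially. dist (d n q) 0 < 1" by (rule tendstoD[OF elim]) simp
    then obtain N where N: "\<forall>n\<ge>N. \<bar>d n q\<bar> < 1" by (auto simp: eventually_sequentially)
    have "q \<in> B k" if "k \<ge> max N (nat \<lceil>norm q\<rceil>)" for k
    proof -
      have "norm q \<le> real k" using that by (simp add: nat_le_iff ceiling_le_iff)
      moreover have "\<bar>d n q\<bar> \<le> 1" if "n \<ge> k" for n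
        using N \<open>k \<ge> max N (nat \<lceil>norm q\<rceil>)\<close> that by (intro less_imp_le) auto
      ultimately show ?thesis by (simp add: B_def)
    qed
    then show ?case unfolding eventually_sequentially by blast
  qed
  have Sm[measurable]: "?S D n \<in> borel_measurable M" if "D \<in> sets borel" for D n
    using simple_integral_measurable[OF d that] .
  have Zm[measurable]: "Z \<in> borel_measurable M" using tendsto_in_probD(1)[OF Z] .
  have inner: "(\<lambda>n. \<integral>q. indicator (B k) q * \<kappa> (2 / c * \<bar>d n q\<bar>) \<partial>lborel) \<longlonglongrightarrow> 0" if c: "c > 0" for c k
  proof -
    have "(\<lambda>n. \<integral>q. \<kappa> (2 / c * \<bar>indicator (B k) q * d (n + k) q\<bar>) \<partial>lborel) \<longlonglongrightarrow> 0"
    proof (rule modulus_integral_tendsto[OF _ Bf[of k], where C = 1])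
      show "\<bar>indicator (B k) q * d (n + k) q\<bar> \<le> 1 * indicator (B k) q" for n q
        by (auto simp: B_def split: split_indicator)
      show "AE q in lborel. (\<lambda>n. indicator (B k) q * d (n + k) q) \<longlonglongrightarrow> 0"
        using lim
      proof eventually_elim
        case (elim q)
        from tendsto_mult_right_zero[OF LIMSEQ_ignore_initial_segment[OF elim, of k]] show ?case .
      qed
    qed (use c in auto)
    moreover have "\<kappa> (2 / c * \<bar>indicator (B k) q * x\<bar>) = indicator (B k) q * \<kappa> (2 / c * \<bar>x\<bar>)" for q x
      by (auto simp: modulus_0 split: split_indicator)
    ultimately show ?thesis by (auto intro: LIMSEQ_offset[where k = k])
  qed
  have outer: "(\<lambda>k. \<integral>q. indicator (- B k) q * \<kappa> (2 / c * \<bar>d n q\<bar>) \<partial>lborel) \<longlonglongrightarrow> 0" if c: "c > 0" for c n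
  proof -
    have "(\<lambda>k. \<integral>q. indicator (- B k) q * \<kappa> (2 / c * \<bar>d n q\<bar>) \<partial>lborel) \<longlonglongrightarrow> (\<integral>q. 0 \<partial>(lborel :: plane measure))"
    proof (rule integral_dominated_convergence)
      show "integrable lborel (\<lambda>q. indicator UNIV q * \<kappa> (2 / c * \<bar>d n q\<bar>))"
        using simple_integral_tail(2)[OF d _ c, of UNIV] by simp
      show "AE q in lborel. (\<lambda>k. indicator (- B k) q * \<kappa> (2 / c * \<bar>d n q\<bar>)) \<longlonglongrightarrow> 0"
        using Bex by eventually_elim (auto intro!: tendsto_eventually elim!: eventually_mono)
      show "AE q in lborel. norm (indicator (- B k) q * \<kappa> (2 / c * \<bar>d n q\<bar>)) \<le> indicator UNIV q * \<kappa> (2 / c * \<bar>d n q\<bar>)" for k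
        using c by (auto simp: modulus_nonneg split: split_indicator)
    qed auto
    then show ?thesis by simp
  qed
  have in_small: "prob {w \<in> space M. c < \<bar>?S D n w\<bar>} \<le> 2 * (\<integral>q. indicator (B k) q * \<kappa> (2 / c * \<bar>d n q\<bar>) \<partial>lborel)"
    if "c > 0" "D \<in> sets borel" "D \<subseteq> B k" for c D n k
    using simple_integral_tail_subset[OF d _ Bm] that by auto
  have out_small: "prob {w \<in> space M. c < \<bar>?S D n w\<bar>} \<le> 2 * (\<integral>q. indicator (- B k) q * \<kappa> (2 / c * \<bar>d n q\<bar>) \<partial>lborel)"
    if "c > 0" "D \<in> sets borel" "D \<subseteq> - B k" for c D n k
    using simple_integral_tail_subset[OF d, of D "- B k"] that by auto
  have complement_lim: "tendsto_in_prob M (?S (- B k)) Z sequentially" for k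
  proof -
    have "tendsto_in_prob M (?S (B k)) (\<lambda>_. 0) sequentially"
      by (rule tendsto_in_probI_bound[where u = "\<lambda>c n. 2 * (\<integral>q. indicator (B k) q * \<kappa> (2 / c * \<bar>d n q\<bar>) \<partial>lborel)"])
         (use inner in_small in \<open>auto intro!: tendsto_mult_right_zero always_eventually\<close>)
    from tendsto_in_prob_diff[OF Z this]
    have "tendsto_in_prob M (\<lambda>n w. ?S UNIV n w - ?S (B k) n w) Z sequentially" by simp
    then show ?thesis
    proof (rule tendsto_in_prob_cong_AE)
      show "AE w in M. ?S (- B k) n w = ?S UNIV n w - ?S (B k) n w" for n
        using simple_integral_split[OF d, of UNIV "B k" n] by (auto simp: Compl_eq_Diff_UNIV)
    qed auto
  qed
  have "prob {w \<in> space M. e < \<bar>Z w\<bar>} \<le> 0" if e: "e > 0" for e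
  proof (rule ccontr)
    define c where "c = e / 8"
    define p where "p = prob {w \<in> space M. e < \<bar>Z w\<bar>}"
    define \<eta> where "\<eta> = p / 8"
    assume "\<not> prob {w \<in> space M. e < \<bar>Z w\<bar>} \<le> 0"
    then have p: "p > 0" by (simp add: p_def)
    then have \<eta>: "\<eta> > 0" by (simp add: \<eta>_def)
    have c: "c > 0" using e by (simp add: c_def)
    define J where "J k n = 2 * (\<integral>q. indicator (B k) q * \<kappa> (2 / c * \<bar>d n q\<bar>) \<partial>lborel)" for k n
    define K where "K k n = 2 * (\<integral>q. indicator (- B k) q * \<kappa> (2 / c * \<bar>d n q\<bar>) \<partial>lborel)" for k n
    \<comment> \<open>At stage \<open>j\<close> the sets \<open>B (ks j)\<close> and \<open>- B (ks (Suc j))\<close> are negligible for \<open>d (ns j)\<close>, so almost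
      the whole integral \<open>Z\<close> sits in the ring between them.\<close>
    define Q where "Q k N n k' \<longleftrightarrow> n \<ge> N \<and> k' > k \<and> J k n \<le> \<eta> \<and>
      prob {w \<in> space M. c < \<bar>?S (- B k) n w - Z w\<bar>} \<le> \<eta> \<and> K k' n \<le> \<eta>" for k N n k'
    have Qex: "\<exists>n k'. Q k N n k'" for k N
    proof -
      have "\<forall>\<^sub>F n in sequentially. J k n < \<eta>"
        using tendsto_mult_right_zero[OF inner[OF c, of k], of 2] \<eta> unfolding J_def by (rule order_tendstoD)
      moreover have "\<forall>\<^sub>F n in sequentially. prob {w \<in> space M. c < \<bar>?S (- B k) n w - Z w\<bar>} < \<eta>"
        using tendsto_in_probD(3)[OF complement_lim c] \<eta> by (rule order_tendstoD)
      ultimately have "\<forall>\<^sub>F n in sequentially. n \<ge> N \<and> J k n < \<eta> \<and> prob {w \<in> space M. c < \<bar>?S (- B k) n w - Z w\<bar>} < \<eta>"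
        using eventually_ge_at_top[of N] by eventually_elim auto
      then obtain n where n: "n \<ge> N" "J k n < \<eta>" "prob {w \<in> space M. c < \<bar>?S (- B k) n w - Z w\<bar>} < \<eta>"
        by (auto dest: eventually_happens)
      have "\<forall>\<^sub>F k' in sequentially. K k' n < \<eta>"
        using tendsto_mult_right_zero[OF outer[OF c, of n], of 2] \<eta> unfolding K_def by (rule order_tendstoD)
      then have "\<forall>\<^sub>F k' in sequentially. k < k' \<and> K k' n < \<eta>"
        using eventually_gt_at_top[of k] by eventually_elim auto
      then obtain k' where "k < k'" "K k' n < \<eta>" by (auto dest: eventually_happens)
      then show ?thesis using n by (intro exI[of _ n] exI[of _ k']) (auto simp: Q_def)
    qed
    define nn where "nn k N = (SOME n. \<exists>k'. Q k N n k')" for k N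
    define kk where "kk k N = (SOME k'. Q k N (nn k N) k')" for k N
    have "Q k N (nn k N) (kk k N)" for k N
      unfolding kk_def nn_def by (rule someI_ex, rule someI_ex, rule Qex)
    then have nk: "\<And>k N. nn k N \<ge> N" "\<And>k N. kk k N > k" "\<And>k N. J k (nn k N) \<le> \<eta>"
      "\<And>k N. prob {w \<in> space M. c < \<bar>?S (- B k) (nn k N) w - Z w\<bar>} \<le> \<eta>" "\<And>k N. K (kk k N) (nn k N) \<le> \<eta>"
      unfolding Q_def by blast+
    define st where "st = rec_nat (0, 0) (\<lambda>_ (k, N). (kk k N, Suc (nn k N)))"
    define ks where "ks j = fst (st j)" for j
    define ns where "ns j = nn (fst (st j)) (snd (st j))" for j
    have st_Suc: "st (Suc j) = (kk (fst (st j)) (snd (st j)), Suc (nn (fst (st j)) (snd (st j))))" for j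
      by (simp add: st_def split: prod.split)
    have "Suc (ns j) \<le> ns (Suc j)" for j
      using nk(1)[of "snd (st (Suc j))" "fst (st (Suc j))"] unfolding ns_def st_Suc snd_conv .
    then have ns_mono: "strict_mono ns" by (intro strict_monoI_Suc) (simp add: Suc_le_eq)
    have ks_Suc: "ks (Suc j) = kk (ks j) (snd (st j))" for j by (simp add: ks_def st_Suc)
    have ks_less: "ks j < ks (Suc j)" for j using nk(2) by (simp add: ks_Suc)
    have ks_mono: "ks i \<le> ks j" if "i \<le> j" for i j
      by (rule lift_Suc_mono_le[of ks, OF less_imp_le[OF ks_less] that])
    have bnd: "J (ks j) (ns j) \<le> \<eta>" "prob {w \<in> space M. c < \<bar>?S (- B (ks j)) (ns j) w - Z w\<bar>} \<le> \<eta>"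
      "K (ks (Suc j)) (ns j) \<le> \<eta>" for j
      using nk(3-5) by (auto simp: ks_def ns_def st_Suc)
    have inJ: "prob {w \<in> space M. c < \<bar>?S D (ns j) w\<bar>} \<le> \<eta>" if "D \<in> sets borel" "D \<subseteq> B (ks j)" for D j
      using in_small[OF c that, of "ns j"] bnd(1)[of j] unfolding J_def by (rule order_trans)
    have outK: "prob {w \<in> space M. c < \<bar>?S D (ns j) w\<bar>} \<le> \<eta>" if "D \<in> sets borel" "D \<subseteq> - B (ks (Suc j))" for D j
      using out_small[OF c that, of "ns j"] bnd(3)[of j] unfolding K_def by (rule order_trans)
    define ring where "ring j = B (ks (Suc j)) - B (ks j)" for j
    \<comment> \<open>Taking every other ring makes the integrals over \<open>E\<close> oscillate between \<open>Z\<close> and zero.\<close>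
    define E where "E = (\<Union>j\<in>{j. even j}. ring j)"
    have Em[measurable]: "E \<in> sets borel" unfolding E_def ring_def by measurable
    have ring_int: "E \<inter> (B (ks (Suc j)) - B (ks j)) = (if even j then B (ks (Suc j)) - B (ks j) else {})" for j
    proof -
      have "i = j" if "q \<in> ring i" "q \<in> ring j" for i q
      proof (rule ccontr)
        assume "i \<noteq> j"
        then consider "Suc i \<le> j" | "Suc j \<le> i" by linarith
        then show False
        proof cases
          case 1
          from Bmono[OF ks_mono[OF 1]] that show False unfolding ring_def by blast
        next
          case 2
          from Bmono[OF ks_mono[OF 2]] that show False unfolding ring_def by blast
        qed
      qed
      then show ?thesis by (auto simp: E_def ring_def[symmetric])
    qed
    obtain W where W: "tendsto_in_prob M (?S E) W sequentially" using conv[OF Em] by auto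
    have Wm[measurable]: "W \<in> borel_measurable M" using tendsto_in_probD(1)[OF W] .
    have split: "AE w in M. ?S A n w = ?S (A \<inter> D) n w + ?S (A - D) n w"
      if "A \<in> sets borel" "D \<in> sets borel" for A D n
      by (rule simple_integral_split[OF d that])
    have odd: "prob {w \<in> space M. c + c < \<bar>?S E (ns j) w\<bar>} \<le> \<eta> + \<eta>" if "odd j" for j
    proof -
      let ?n = "ns j" let ?k = "ks j" let ?k' = "ks (Suc j)"
      have eq: "E \<inter> B ?k' = E \<inter> B ?k"
        using ring_int[of j] that Bmono[OF ks_mono, of j "Suc j"] by auto
      have "prob {w \<in> space M. c + c < \<bar>?S E ?n w\<bar>}
        \<le> prob {w \<in> space M. c < \<bar>?S (E \<inter> B ?k') ?n w\<bar>} + prob {w \<in> space M. c < \<bar>?S (E - B ?k') ?n w\<bar>}"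
        using split[OF Em Bm, of ?n ?k'] by (intro tail_add) (auto elim!: eventually_mono)
      also have "\<dots> \<le> \<eta> + \<eta>"
        unfolding eq by (intro add_mono inJ outK) auto
      finally show ?thesis .
    qed
    have even: "prob {w \<in> space M. (c + c) + (c + c) < \<bar>?S E (ns j) w - Z w\<bar>} \<le> (\<eta> + \<eta>) + (\<eta> + \<eta>)" if "even j" for j
    proof -
      let ?n = "ns j" let ?k = "ks j" let ?k' = "ks (Suc j)"
      have eq: "(E - B ?k) \<inter> B ?k' = - B ?k \<inter> B ?k'"
        using ring_int[of j] that by auto
      have m: "E \<inter> B ?k \<in> sets borel" "- B ?k \<in> sets borel" "- B ?k - B ?k' \<in> sets borel" "E - B ?k - B ?k' \<in> sets borel"
        by measurable
      have "AE w in M. ?S E ?n w - Z w = (?S (E \<inter> B ?k) ?n w + (?S (- B ?k) ?n w - Z w))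
           + (?S (E - B ?k - B ?k') ?n w - ?S (- B ?k - B ?k') ?n w)"
        using split[of E "B ?k" ?n, OF Em Bm] split[of "E - B ?k" "B ?k'" ?n, OF sets.Diff[OF Em Bm] Bm]
          split[of "- B ?k" "B ?k'" ?n, OF m(2) Bm]
        by eventually_elim (simp add: eq)
      then have "prob {w \<in> space M. (c + c) + (c + c) < \<bar>?S E ?n w - Z w\<bar>}
        \<le> prob {w \<in> space M. c + c < \<bar>?S (E \<inter> B ?k) ?n w + (?S (- B ?k) ?n w - Z w)\<bar>}
          + prob {w \<in> space M. c + c < \<bar>?S (E - B ?k - B ?k') ?n w - ?S (- B ?k - B ?k') ?n w\<bar>}"
        using m by (intro tail_add) (auto elim!: eventually_mono)
      also have "\<dots> \<le> (prob {w \<in> space M. c < \<bar>?S (E \<inter> B ?k) ?n w\<bar>} + prob {w \<in> space M. c < \<bar>?S (- B ?k) ?n w - Z w\<bar>})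
          + (prob {w \<in> space M. c < \<bar>?S (E - B ?k - B ?k') ?n w\<bar>} + prob {w \<in> space M. c < \<bar>?S (- B ?k - B ?k') ?n w\<bar>})"
        using m by (intro add_mono tail_add) auto
      also have "\<dots> \<le> (\<eta> + \<eta>) + (\<eta> + \<eta>)"
        using m by (intro add_mono inJ outK bnd(2)) auto
      finally show ?thesis .
    qed
    have sub: "strict_mono (\<lambda>j. ns (2 * j))" "strict_mono (\<lambda>j. ns (2 * j + 1))"
      using ns_mono by (auto simp: strict_mono_def)
    have "prob {w \<in> space M. (c + c) + c < \<bar>W w\<bar>} \<le> \<eta> + \<eta>"
      using odd c by (intro tail_limit[OF tendsto_in_prob_subseq[OF W sub(2)], where u = "\<lambda>_. \<eta> + \<eta>"]) auto
    moreover have "prob {w \<in> space M. ((c + c) + (c + c)) + c < \<bar>W w - Z w\<bar>} \<le> (\<eta> + \<eta>) + (\<eta> + \<eta>)"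
      using even c tendsto_in_prob_diff[OF tendsto_in_prob_subseq[OF W sub(1)] tendsto_in_prob_const[OF Zm]]
      by (intro tail_limit[where u = "\<lambda>_. (\<eta> + \<eta>) + (\<eta> + \<eta>)" and A = "\<lambda>j w. ?S E (ns (2 * j)) w - Z w"]) auto
    moreover have "prob {w \<in> space M. ((c + c) + c) + (((c + c) + (c + c)) + c) < \<bar>Z w\<bar>}
      \<le> prob {w \<in> space M. (c + c) + c < \<bar>W w\<bar>} + prob {w \<in> space M. ((c + c) + (c + c)) + c < \<bar>W w - Z w\<bar>}"
      by (intro tail_add) auto
    ultimately have "p \<le> 6 * \<eta>" by (simp add: p_def c_def)
    then show False using p by (simp add: \<eta>_def)
  qed
  then show ?thesis by (intro AE_zero_if_tails_zero) auto
qed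

lemma has_levy_integral_diff:
  assumes f: "has_levy_integral M \<Lambda> UNIV f Y" and g: "has_levy_integral M \<Lambda> UNIV g Z"
  shows "has_levy_integral M \<Lambda> UNIV (\<lambda>q. f q - g q) (\<lambda>w. Y w - Z w)"
proof -
  obtain s where s: "\<And>n. simple_integrand (s n)" "AE q in lborel. (\<lambda>n. s n q) \<longlonglongrightarrow> f q"
    and cs: "\<And>B. B \<in> sets borel \<Longrightarrow> \<exists>Z. tendsto_in_prob M (\<lambda>n. simple_levy_integral \<Lambda> B (s n)) Z sequentially"
      "tendsto_in_prob M (\<lambda>n. simple_levy_integral \<Lambda> UNIV (s n)) Y sequentially"
    by (rule has_levy_integral_UNIV_E[OF f]) (rule that)
  obtain t where t: "\<And>n. simple_integrand (t n)" "AE q in lborel. (\<lambda>n. t n q) \<longlonglongrightarrow> g q"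
    and ct: "\<And>B. B \<in> sets borel \<Longrightarrow> \<exists>Z. tendsto_in_prob M (\<lambda>n. simple_levy_integral \<Lambda> B (t n)) Z sequentially"
      "tendsto_in_prob M (\<lambda>n. simple_levy_integral \<Lambda> UNIV (t n)) Z sequentially"
    by (rule has_levy_integral_UNIV_E[OF g]) (rule that)
  let ?d = "\<lambda>n q. s n q - t n q"
  have d: "simple_integrand (?d n)" for n by (intro simple_integrand_diff s t)
  have *: "tendsto_in_prob M (\<lambda>n. simple_levy_integral \<Lambda> B (?d n)) (\<lambda>w. Y' w - Z' w) sequentially"
    if B: "B \<in> sets borel" and Y': "tendsto_in_prob M (\<lambda>n. simple_levy_integral \<Lambda> B (s n)) Y' sequentially"
      and Z': "tendsto_in_prob M (\<lambda>n. simple_levy_integral \<Lambda> B (t n)) Z' sequentially" for B Y' Z'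
    using tendsto_in_probD(1)[OF Y'] tendsto_in_probD(1)[OF Z']
    by (intro tendsto_in_prob_cong_AE[OF tendsto_in_prob_diff[OF Y' Z']] simple_integral_diff s t B)
       (auto intro!: always_eventually simple_integral_measurable simple_integral_cmult d s B)
  show ?thesis
  proof (rule has_levy_integral_UNIV_I[where s = ?d])
    show "AE q in lborel. (\<lambda>n. ?d n q) \<longlonglongrightarrow> f q - g q"
      using s(2) t(2) by eventually_elim (rule tendsto_diff)
    show "\<exists>Z. tendsto_in_prob M (\<lambda>n. simple_levy_integral \<Lambda> B (?d n)) Z sequentially" if B: "B \<in> sets borel" for B
      using *[OF B] cs(1)[OF B] ct(1)[OF B] by blast
    show "(\<lambda>q. f q - g q) \<in> borel_measurable borel"
      using has_levy_integral_measurable(1)[OF f] has_levy_integral_measurable(1)[OF g] by measurable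
    show "tendsto_in_prob M (\<lambda>n. simple_levy_integral \<Lambda> UNIV (?d n)) (\<lambda>w. Y w - Z w) sequentially"
      by (rule *[OF _ cs(2) ct(2)]) simp
  qed (rule d)
qed

lemma has_levy_integral_cmult:
  assumes f: "has_levy_integral M \<Lambda> UNIV f Y"
  shows "has_levy_integral M \<Lambda> UNIV (\<lambda>q. c * f q) (\<lambda>w. c * Y w)"
proof -
  obtain s where s: "\<And>n. simple_integrand (s n)" "AE q in lborel. (\<lambda>n. s n q) \<longlonglongrightarrow> f q"
    and cs: "\<And>B. B \<in> sets borel \<Longrightarrow> \<exists>Z. tendsto_in_prob M (\<lambda>n. simple_levy_integral \<Lambda> B (s n)) Z sequentially"
      "tendsto_in_prob M (\<lambda>n. simple_levy_integral \<Lambda> UNIV (s n)) Y sequentially"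
    by (rule has_levy_integral_UNIV_E[OF f]) (rule that)
  let ?d = "\<lambda>n q. c * s n q"
  have d: "simple_integrand (?d n)" for n by (intro simple_integrand_cmult s)
  have *: "tendsto_in_prob M (\<lambda>n. simple_levy_integral \<Lambda> B (?d n)) (\<lambda>w. c * Y' w) sequentially"
    if B: "B \<in> sets borel" and Y': "tendsto_in_prob M (\<lambda>n. simple_levy_integral \<Lambda> B (s n)) Y' sequentially" for B Y'
  proof (rule tendsto_in_prob_cong_AE[OF tendsto_in_prob_cmult[OF Y']])
    show "AE w in M. simple_levy_integral \<Lambda> B (?d n) w = c * simple_levy_integral \<Lambda> B (s n) w" for n
      by (rule simple_integral_cmult[OF s(1) B])
  qed (use tendsto_in_probD(1)[OF Y'] in \<open>auto intro!: always_eventually simple_integral_measurable d B\<close>)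
  show ?thesis
  proof (rule has_levy_integral_UNIV_I[where s = ?d])
    show "AE q in lborel. (\<lambda>n. ?d n q) \<longlonglongrightarrow> c * f q"
      using s(2) by eventually_elim (rule tendsto_mult_left)
    show "\<exists>Z. tendsto_in_prob M (\<lambda>n. simple_levy_integral \<Lambda> B (?d n)) Z sequentially" if B: "B \<in> sets borel" for B
      using *[OF B] cs(1)[OF B] by blast
    show "(\<lambda>q. c * f q) \<in> borel_measurable borel"
      using has_levy_integral_measurable(1)[OF f] by measurable
    show "tendsto_in_prob M (\<lambda>n. simple_levy_integral \<Lambda> UNIV (?d n)) (\<lambda>w. c * Y w) sequentially"
      by (rule *[OF _ cs(2)]) simp
  qed (rule d)
qed

lemma has_levy_integral_add:
  assumes f: "has_levy_integral M \<Lambda> UNIV f Y" and g: "has_levy_integral M \<Lambda> UNIV g Z"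
  shows "has_levy_integral M \<Lambda> UNIV (\<lambda>q. f q + g q) (\<lambda>w. Y w + Z w)"
  using has_levy_integral_diff[OF f has_levy_integral_cmult[OF g, of "-1"]] by simp

lemma has_levy_integral_cong_AE:
  assumes f: "has_levy_integral M \<Lambda> UNIV f Y" and Z: "Z \<in> borel_measurable M" "AE w in M. Z w = Y w"
  shows "has_levy_integral M \<Lambda> UNIV f Z"
proof -
  obtain s where s: "\<And>n. simple_integrand (s n)" "AE q in lborel. (\<lambda>n. s n q) \<longlonglongrightarrow> f q"
    and cs: "\<And>B. B \<in> sets borel \<Longrightarrow> \<exists>Z. tendsto_in_prob M (\<lambda>n. simple_levy_integral \<Lambda> B (s n)) Z sequentially"
      "tendsto_in_prob M (\<lambda>n. simple_levy_integral \<Lambda> UNIV (s n)) Y sequentially"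
    by (rule has_levy_integral_UNIV_E[OF f]) (rule that)
  have "tendsto_in_prob M (\<lambda>n. simple_levy_integral \<Lambda> UNIV (s n)) Z sequentially"
    using Z by (intro tendsto_in_prob_cong_AE[OF cs(2)]) (auto intro!: always_eventually simple_integral_measurable s)
  from has_levy_integral_UNIV_I[OF has_levy_integral_measurable(1)[OF f] s cs(1) this] show ?thesis .
qed

text \<open>The difference of two approximating sequences approximates zero.\<close>

lemma has_levy_integral_unique:
  assumes f: "has_levy_integral M \<Lambda> UNIV f Y" and g: "has_levy_integral M \<Lambda> UNIV f Z"
  shows "AE w in M. Y w = Z w"
proof -
  have "has_levy_integral M \<Lambda> UNIV (\<lambda>q. 0) (\<lambda>w. Y w - Z w)"
    using has_levy_integral_diff[OF f g] by simp
  then have h: "has_levy_integral M \<Lambda> UNIV (\<lambda>q. 0) (\<lambda>w. Y w - Z w)" .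
  obtain s where s: "\<And>n. simple_integrand (s n)" "AE q in lborel. (\<lambda>n. s n q) \<longlonglongrightarrow> 0"
    and cs: "\<And>B. B \<in> sets borel \<Longrightarrow> \<exists>Z. tendsto_in_prob M (\<lambda>n. simple_levy_integral \<Lambda> B (s n)) Z sequentially"
      "tendsto_in_prob M (\<lambda>n. simple_levy_integral \<Lambda> UNIV (s n)) (\<lambda>w. Y w - Z w) sequentially"
    by (rule has_levy_integral_UNIV_E[OF h]) (rule that)
  have "AE w in M. Y w - Z w = 0"
    by (rule vanishing_integrands_limit[OF s cs])
  then show ?thesis by eventually_elim simp
qed

text \<open>The factor two comes from the approximation of measurable functions by simple ones in metric
  spaces.\<close>

lemma bounded_integrand_approximation:
  assumes f[measurable]: "f \<in> borel_measurable borel" and B: "B \<in> finite_area_sets"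
    and fb: "\<And>q. \<bar>f q\<bar> \<le> C * indicator B q"
  obtains s where "\<And>n. simple_integrand (s n)" "\<And>q. (\<lambda>n. s n q) \<longlonglongrightarrow> f q" "\<And>n q. \<bar>s n q\<bar> \<le> 2 * \<bar>f q\<bar>"
    "\<And>D. D \<in> sets borel \<Longrightarrow> \<exists>Z. tendsto_in_prob M (\<lambda>n. simple_levy_integral \<Lambda> D (s n)) Z sequentially"
proof -
  obtain s where s: "\<And>i. simple_function borel (s i)" "\<And>x. (\<lambda>i. s i x) \<longlonglongrightarrow> f x"
    "\<And>i x. dist (s i x) 0 \<le> 2 * dist (f x) (0::real)"
    using borel_measurable_implies_sequence_metric[OF f, of 0] by auto
  have sb: "\<bar>s n q\<bar> \<le> 2 * \<bar>f q\<bar>" for n q using s(3)[of n q] by simp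
  have si: "simple_integrand (s n)" for n
  proof (rule simple_integrandI[OF s(1) _ B])
    show "{q. s n q \<noteq> 0} \<subseteq> B"
    proof
      fix q assume "q \<in> {q. s n q \<noteq> 0}"
      then have "f q \<noteq> 0" using sb[of n q] by auto
      then show "q \<in> B" using fb[of q] by (auto split: split_indicator_asm)
    qed
  qed
  note [measurable] = simple_integrand_measurable[OF si]
  have conv: "\<exists>Z. tendsto_in_prob M (\<lambda>n. simple_levy_integral \<Lambda> D (s n)) Z sequentially" if D: "D \<in> sets borel" for D
  proof (rule Cauchy_in_prob_convergent)
    show "simple_levy_integral \<Lambda> D (s n) \<in> borel_measurable M" for n by (rule simple_integral_measurable[OF si D])
    fix e :: real assume e: "e > 0"
    define r where "r n = (\<integral>q. \<kappa> (2 * (2 / e) * \<bar>s n q - f q\<bar>) \<partial>lborel)" for n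
    have db: "\<bar>s n q - f q\<bar> \<le> (3 * C) * indicator B q" for n q
      using sb[of n q] fb[of q] by (auto split: split_indicator_asm)
    have r: "r \<longlonglongrightarrow> 0"
      unfolding r_def
      by (rule modulus_integral_tendsto[OF _ B db]) (use e s(2) in \<open>auto simp: LIM_zero_iff intro!: LIM_zero\<close>)
    have ri: "integrable lborel (\<lambda>q. \<kappa> (2 * (2 / e) * \<bar>s n q - f q\<bar>))" for n
      by (rule modulus_integrable[OF _ B db]) (use e in auto)
    have "\<forall>\<^sub>F n in sequentially. r n < e / 4" using r e by (intro order_tendstoD) auto
    then obtain N where N: "\<And>n. n \<ge> N \<Longrightarrow> r n < e / 4" by (auto simp: eventually_sequentially)
    show "\<exists>N. \<forall>m\<ge>N. \<forall>n\<ge>N. prob {w \<in> space M. e < \<bar>simple_levy_integral \<Lambda> D (s m) w - simple_levy_integral \<Lambda> D (s n) w\<bar>} \<le> e"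
    proof (intro exI allI impI)
      fix m n assume mn: "m \<ge> N" "n \<ge> N"
      have sd: "simple_integrand (\<lambda>q. s m q - s n q)" by (intro simple_integrand_diff si)
      have "prob {w \<in> space M. e < \<bar>simple_levy_integral \<Lambda> D (s m) w - simple_levy_integral \<Lambda> D (s n) w\<bar>}
        \<le> prob {w \<in> space M. e < \<bar>simple_levy_integral \<Lambda> D (\<lambda>q. s m q - s n q) w\<bar>}"
        using simple_integral_diff[OF si si D, of m n]
        by (intro tail_mono simple_integral_measurable sd D) (auto elim!: eventually_mono)
      also have "\<dots> \<le> 2 * (\<integral>q. indicator UNIV q * \<kappa> (2 / e * \<bar>s m q - s n q\<bar>) \<partial>lborel)"
        by (rule simple_integral_tail_subset[OF sd D]) (use e in auto)
      also have "(\<integral>q. indicator UNIV q * \<kappa> (2 / e * \<bar>s m q - s n q\<bar>) \<partial>lborel)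
        \<le> (\<integral>q. \<kappa> (2 * (2 / e) * \<bar>s m q - f q\<bar>) + \<kappa> (2 * (2 / e) * \<bar>s n q - f q\<bar>) \<partial>lborel)"
      proof (rule integral_mono)
        show "integrable lborel (\<lambda>q. indicator UNIV q * \<kappa> (2 / e * \<bar>s m q - s n q\<bar>))"
          by (rule simple_integral_tail(2)[OF sd]) (use e in auto)
        show "indicator UNIV q * \<kappa> (2 / e * \<bar>s m q - s n q\<bar>)
          \<le> \<kappa> (2 * (2 / e) * \<bar>s m q - f q\<bar>) + \<kappa> (2 * (2 / e) * \<bar>s n q - f q\<bar>)" for q
        proof -
          have "\<bar>s m q - s n q\<bar> \<le> \<bar>s m q - f q\<bar> + \<bar>s n q - f q\<bar>" by arith
          then show ?thesis using modulus_add_le[of "2 / e"] e by simp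
        qed
      qed (use ri in auto)
      also have "\<dots> = r m + r n" using ri by (simp add: r_def)
      finally show "prob {w \<in> space M. e < \<bar>simple_levy_integral \<Lambda> D (s m) w - simple_levy_integral \<Lambda> D (s n) w\<bar>} \<le> e"
        using N[OF mn(1)] N[OF mn(2)] by simp
    qed
  qed
  show ?thesis by (rule that[OF si s(2) sb conv])
qed

lemma has_levy_integral_exists:
  assumes f: "f \<in> borel_measurable borel" "B \<in> finite_area_sets" "\<And>q. \<bar>f q\<bar> \<le> C * indicator B q"
  shows "\<exists>Y. has_levy_integral M \<Lambda> UNIV f Y"
proof -
  obtain s where s: "\<And>n. simple_integrand (s n)" "\<And>q. (\<lambda>n. s n q) \<longlonglongrightarrow> f q"
    "\<And>D. D \<in> sets borel \<Longrightarrow> \<exists>Z. tendsto_in_prob M (\<lambda>n. simple_levy_integral \<Lambda> D (s n)) Z sequentially"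
    using bounded_integrand_approximation[OF f] by metis
  obtain Y where "tendsto_in_prob M (\<lambda>n. simple_levy_integral \<Lambda> UNIV (s n)) Y sequentially"
    using s(3)[of UNIV] by auto
  then have "has_levy_integral M \<Lambda> UNIV f Y"
    using s f(1) by (intro has_levy_integral_UNIV_I[where s = s]) simp_all
  then show ?thesis by (intro exI[of _ Y])
qed

lemma has_levy_integral_approximation:
  assumes Y: "has_levy_integral M \<Lambda> UNIV f Y"
    and f: "B \<in> finite_area_sets" "\<And>q. \<bar>f q\<bar> \<le> C * indicator B q"
  obtains s where "\<And>n. simple_integrand (s n)" "\<And>q. (\<lambda>n. s n q) \<longlonglongrightarrow> f q" "\<And>n q. \<bar>s n q\<bar> \<le> 2 * \<bar>f q\<bar>"
    "\<And>D. D \<in> sets borel \<Longrightarrow> \<exists>Z. tendsto_in_prob M (\<lambda>n. simple_levy_integral \<Lambda> D (s n)) Z sequentially"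
    "tendsto_in_prob M (\<lambda>n. simple_levy_integral \<Lambda> UNIV (s n)) Y sequentially"
proof -
  note m = has_levy_integral_measurable[OF Y]
  obtain s where s: "\<And>n. simple_integrand (s n)" "\<And>q. (\<lambda>n. s n q) \<longlonglongrightarrow> f q" "\<And>n q. \<bar>s n q\<bar> \<le> 2 * \<bar>f q\<bar>"
    "\<And>D. D \<in> sets borel \<Longrightarrow> \<exists>Z. tendsto_in_prob M (\<lambda>n. simple_levy_integral \<Lambda> D (s n)) Z sequentially"
    by (rule bounded_integrand_approximation[OF m(1) f]) (rule that)
  obtain Z where Z: "tendsto_in_prob M (\<lambda>n. simple_levy_integral \<Lambda> UNIV (s n)) Z sequentially"
    using s(4)[of UNIV] by auto
  then have "has_levy_integral M \<Lambda> UNIV f Z"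
    using s m(1) by (intro has_levy_integral_UNIV_I[where s = s]) simp_all
  from has_levy_integral_unique[OF Y this]
  have "tendsto_in_prob M (\<lambda>n. simple_levy_integral \<Lambda> UNIV (s n)) Y sequentially"
    using m(2) by (intro tendsto_in_prob_cong_AE[OF Z]) (auto intro!: always_eventually simple_integral_measurable s)
  then show ?thesis using that s by blast
qed

text \<open>The bound for simple functions loses a factor two in the level \<open>c\<close>, for the passage to the
  limit, and a factor two in the integrand, for the approximation.\<close>

lemma levy_integral_tail:
  assumes Y: "has_levy_integral M \<Lambda> UNIV f Y" and B: "B \<in> finite_area_sets"
    and fb: "\<And>q. \<bar>f q\<bar> \<le> C * indicator B q" and c: "c > 0"
  shows "prob {w \<in> space M. c < \<bar>Y w\<bar>} \<le> 2 * (\<integral>q. \<kappa> (8 / c * \<bar>f q\<bar>) \<partial>lborel)"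
proof -
  note [measurable] = has_levy_integral_measurable[OF Y]
  obtain s where s: "\<And>n. simple_integrand (s n)" "\<And>q. (\<lambda>n. s n q) \<longlonglongrightarrow> f q" "\<And>n q. \<bar>s n q\<bar> \<le> 2 * \<bar>f q\<bar>"
    "tendsto_in_prob M (\<lambda>n. simple_levy_integral \<Lambda> UNIV (s n)) Y sequentially"
    using has_levy_integral_approximation[OF Y B fb] by metis
  have "prob {w \<in> space M. c / 2 < \<bar>simple_levy_integral \<Lambda> UNIV (s n) w\<bar>} \<le> 2 * (\<integral>q. \<kappa> (8 / c * \<bar>f q\<bar>) \<partial>lborel)" for n
  proof -
    have "prob {w \<in> space M. c / 2 < \<bar>simple_levy_integral \<Lambda> UNIV (s n) w\<bar>}
      \<le> 2 * (\<integral>q. indicator UNIV q * \<kappa> (2 / (c / 2) * \<bar>s n q\<bar>) \<partial>lborel)"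
      by (rule simple_integral_tail(1)) (use s c in auto)
    also have "(\<integral>q. indicator UNIV q * \<kappa> (2 / (c / 2) * \<bar>s n q\<bar>) \<partial>lborel) \<le> (\<integral>q. \<kappa> (8 / c * \<bar>f q\<bar>) \<partial>lborel)"
    proof (rule integral_mono)
      show "integrable lborel (\<lambda>q. indicator UNIV q * \<kappa> (2 / (c / 2) * \<bar>s n q\<bar>))"
        by (rule simple_integral_tail(2)) (use s c in auto)
      show "integrable lborel (\<lambda>q. \<kappa> (8 / c * \<bar>f q\<bar>))"
        by (rule modulus_integrable[OF _ B fb]) (use c in auto)
      show "indicator UNIV q * \<kappa> (2 / (c / 2) * \<bar>s n q\<bar>) \<le> \<kappa> (8 / c * \<bar>f q\<bar>)" for q
        using s(3)[of n q] c by (auto intro!: modulus_le simp: field_simps)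
    qed
    finally show ?thesis by simp
  qed
  then have "prob {w \<in> space M. c / 2 + c / 2 < \<bar>Y w\<bar>} \<le> 2 * (\<integral>q. \<kappa> (8 / c * \<bar>f q\<bar>) \<partial>lborel)"
    using c by (intro tail_limit[OF s(4), where u = "\<lambda>_. 2 * (\<integral>q. \<kappa> (8 / c * \<bar>f q\<bar>) \<partial>lborel)"]) auto
  then show ?thesis by simp
qed

lemma levy_integral_dominated_convergence:
  assumes Y: "\<And>n. has_levy_integral M \<Lambda> UNIV (f n) (Y n)" and Z: "has_levy_integral M \<Lambda> UNIV g Z"
    and B: "B \<in> finite_area_sets"
    and fb: "\<And>n q. \<bar>f n q\<bar> \<le> C * indicator B q" "\<And>q. \<bar>g q\<bar> \<le> C * indicator B q"
    and lim: "AE q in lborel. (\<lambda>n. f n q) \<longlonglongrightarrow> g q"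
  shows "tendsto_in_prob M Y Z sequentially"
proof (rule tendsto_in_probI_bound)
  have db: "\<bar>f n q - g q\<bar> \<le> (2 * C) * indicator B q" for n q
    using fb(1)[of n q] fb(2)[of q] by (auto split: split_indicator_asm)
  note [measurable] = has_levy_integral_measurable(1)[OF Y] has_levy_integral_measurable(1)[OF Z]
  fix c :: real assume c: "c > 0"
  show "(\<lambda>n. 2 * (\<integral>q. \<kappa> (8 / c * \<bar>f n q - g q\<bar>) \<partial>lborel)) \<longlonglongrightarrow> 0"
  proof (intro tendsto_mult_right_zero modulus_integral_tendsto[OF _ B db])
    show "AE q in lborel. (\<lambda>n. f n q - g q) \<longlonglongrightarrow> 0"
      using lim by eventually_elim (rule LIM_zero)
  qed (use c in auto)
  show "\<forall>\<^sub>F n in sequentially. prob {w \<in> space M. c < \<bar>Y n w - Z w\<bar>} \<le> 2 * (\<integral>q. \<kappa> (8 / c * \<bar>f n q - g q\<bar>) \<partial>lborel)"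
    by (intro always_eventually allI levy_integral_tail[OF has_levy_integral_diff[OF Y Z] B db c])
qed (use has_levy_integral_measurable(2)[OF Y] has_levy_integral_measurable(2)[OF Z] in auto)

end

section \<open>Truncated second moments\<close>

lemma square_le_one_minus_cos:
  assumes "\<bar>u\<bar> \<le> (1::real)"
  shows "u\<^sup>2 \<le> 3 * (1 - cos u)"
proof -
  have "\<bar>Re (iexp u - (\<Sum>k \<le> 3. (\<i> * u)^k / fact k))\<bar> \<le> \<bar>u\<bar>^(Suc 3) / fact (Suc 3)"
    by (rule order_trans[OF abs_Re_le_cmod iexp_approx1])
  moreover have "Re (iexp u - (\<Sum>k \<le> 3. (\<i> * u)^k / fact k)) = cos u - 1 + u\<^sup>2 / 2"
    by (simp add: numeral_eq_Suc Re_exp fact_reduce power2_eq_square)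
  moreover have "fact (Suc 3) = (24 :: real)" by (simp add: eval_nat_numeral)
  ultimately have "\<bar>cos u - 1 + u\<^sup>2 / 2\<bar> \<le> \<bar>u\<bar> ^ 4 / 24"
    by (simp only:) simp
  moreover have "\<bar>u\<bar> ^ 4 \<le> u\<^sup>2"
    using power_decreasing[of 2 4 "\<bar>u\<bar>"] assms by simp
  moreover have "x \<le> 3 * (1 - c)" if "\<bar>c - 1 + x / 2\<bar> \<le> y / 24" "y \<le> x" "0 \<le> x" for x y c :: real
    using abs_le_D1[OF that(1)] that(2,3) by argo
  ultimately show ?thesis using zero_le_power2[of u] by blast
qed

lemma sin_minus_id_le:
  assumes "\<bar>u\<bar> \<le> (1::real)"
  shows "\<bar>u - sin u\<bar> \<le> 2 * (1 - cos u)"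
proof -
  have "\<bar>Im (iexp u - (\<Sum>k \<le> 1. (\<i> * u)^k / fact k))\<bar> \<le> \<bar>u\<bar>^(Suc 1) / fact (Suc 1)"
    by (rule order_trans[OF abs_Im_le_cmod iexp_approx1])
  moreover have "Im (iexp u - (\<Sum>k \<le> 1. (\<i> * u)^k / fact k)) = sin u - u"
    by (simp add: Im_exp)
  ultimately have "\<bar>sin u - u\<bar> \<le> u\<^sup>2 / 2"
    by (simp add: power2_eq_square)
  moreover have "\<bar>u - sin u\<bar> = \<bar>sin u - u\<bar>" by (rule abs_minus_commute)
  ultimately show ?thesis using square_le_one_minus_cos[OF assms] cos_le_one[of u] by linarith
qed

definition truncate :: "real \<Rightarrow> real \<Rightarrow> real" where
  "truncate K x = (if \<bar>x\<bar> \<le> K then x else 0)"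

lemma truncate_measurable [measurable]: "truncate K \<in> borel_measurable borel"
  unfolding truncate_def[abs_def] by measurable

lemma abs_truncate_le: "0 \<le> K \<Longrightarrow> \<bar>truncate K x\<bar> \<le> K"
  by (auto simp: truncate_def)

lemma (in prob_space) square_expectation_abs_le:
  assumes [measurable]: "X \<in> borel_measurable M" and b: "\<And>w. \<bar>X w :: real\<bar> \<le> b"
  shows "(expectation (\<lambda>w. \<bar>X w\<bar>))\<^sup>2 \<le> expectation (\<lambda>w. (X w)\<^sup>2)"
proof -
  have i1: "integrable M (\<lambda>w. \<bar>X w\<bar>)" using b by (intro integrable_const_bound[where B = b]) auto
  have i2: "integrable M (\<lambda>w. \<bar>X w\<bar>\<^sup>2)"
    using power_mono[OF b abs_ge_zero, of _ 2] by (intro integrable_const_bound[where B = "b\<^sup>2"]) auto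
  show ?thesis
    using variance_eq[OF i1 i2] variance_positive[of "\<lambda>w. \<bar>X w\<bar>"] by simp
qed

lemma (in prob_space) second_moment_indep_sum:
  assumes ind: "indep_vars (\<lambda>_. borel) X I" and fin: "finite I"
    and b: "\<And>i w. i \<in> I \<Longrightarrow> \<bar>X i w :: real\<bar> \<le> b"
  shows "expectation (\<lambda>w. (\<Sum>i\<in>I. y i * X i w)\<^sup>2)
    \<le> (\<Sum>i\<in>I. (y i)\<^sup>2 * expectation (\<lambda>w. (X i w)\<^sup>2)) + (\<Sum>i\<in>I. \<bar>y i\<bar> * \<bar>expectation (X i)\<bar>)\<^sup>2"
proof -
  have m[measurable]: "i \<in> I \<Longrightarrow> X i \<in> borel_measurable M" for i
    using ind by (auto simp: indep_vars_def)
  have i1: "i \<in> I \<Longrightarrow> integrable M (X i)" for i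
    using b by (intro integrable_const_bound[where B = b]) auto
  have i2: "integrable M (\<lambda>w. X i w * X j w)" if "i \<in> I" "j \<in> I" for i j
  proof (rule integrable_const_bound[where B = "b * b"])
    show "AE w in M. norm (X i w * X j w) \<le> b * b"
      using b that by (auto simp: abs_mult intro!: mult_mono order_trans[OF abs_ge_zero b])
  qed (use that in measurable)
  have prod: "expectation (\<lambda>w. X i w * X j w) = expectation (X i) * expectation (X j)"
    if ij: "i \<in> I" "j \<in> I" "i \<noteq> j" for i j
  proof -
    have "indep_vars (\<lambda>_. borel) X {i, j}" using ij by (intro indep_vars_subset[OF ind]) auto
    then have "expectation (\<lambda>w. \<Prod>k\<in>{i, j}. X k w) = (\<Prod>k\<in>{i, j}. expectation (X k))"
      using ij i1 by (intro indep_vars_lebesgue_integral) auto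
    then show ?thesis using ij by simp
  qed
  have "expectation (\<lambda>w. (\<Sum>i\<in>I. y i * X i w)\<^sup>2)
      = expectation (\<lambda>w. \<Sum>i\<in>I. \<Sum>j\<in>I. y i * y j * (X i w * X j w))"
    by (simp add: power2_eq_square sum_product mult_ac)
  also have "\<dots> = (\<Sum>i\<in>I. expectation (\<lambda>w. \<Sum>j\<in>I. y i * y j * (X i w * X j w)))"
    by (intro Bochner_Integration.integral_sum Bochner_Integration.integrable_sum integrable_mult_right i2)
  also have "\<dots> = (\<Sum>i\<in>I. \<Sum>j\<in>I. expectation (\<lambda>w. y i * y j * (X i w * X j w)))"
    by (intro sum.cong refl Bochner_Integration.integral_sum integrable_mult_right i2)
  also have "\<dots> = (\<Sum>i\<in>I. \<Sum>j\<in>I. y i * y j * expectation (\<lambda>w. X i w * X j w))"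
    by simp
  also have "\<dots> \<le> (\<Sum>i\<in>I. \<Sum>j\<in>I. (if i = j then (y i)\<^sup>2 * expectation (\<lambda>w. (X i w)\<^sup>2) else 0)
      + (\<bar>y i\<bar> * \<bar>expectation (X i)\<bar>) * (\<bar>y j\<bar> * \<bar>expectation (X j)\<bar>))"
  proof (intro sum_mono)
    fix i j assume ij: "i \<in> I" "j \<in> I"
    show "y i * y j * expectation (\<lambda>w. X i w * X j w)
      \<le> (if i = j then (y i)\<^sup>2 * expectation (\<lambda>w. (X i w)\<^sup>2) else 0)
      + (\<bar>y i\<bar> * \<bar>expectation (X i)\<bar>) * (\<bar>y j\<bar> * \<bar>expectation (X j)\<bar>)"
    proof (cases "i = j")
      case True
      then show ?thesis by (simp add: power2_eq_square)
    next
      case False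
      have "y i * y j * (expectation (X i) * expectation (X j)) \<le> \<bar>y i * y j * (expectation (X i) * expectation (X j))\<bar>"
        by (rule abs_ge_self)
      then show ?thesis using False prod[OF ij False] by (simp add: abs_mult mult_ac)
    qed
  qed
  also have "\<dots> = (\<Sum>i\<in>I. (y i)\<^sup>2 * expectation (\<lambda>w. (X i w)\<^sup>2)) + (\<Sum>i\<in>I. \<bar>y i\<bar> * \<bar>expectation (X i)\<bar>)\<^sup>2"
    using fin by (simp add: sum.distrib sum.delta' sum_product power2_eq_square)
  finally show ?thesis .
qed

context controlled_basis
begin

lemma basis_tail:
  assumes E: "E \<in> finite_area_sets" and K: "K > 0"
  shows "prob {w \<in> space M. K < \<bar>\<Lambda> E w\<bar>} \<le> 2 * (measure lborel E * \<kappa> (2 / K))"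
  using K by (intro tail_le_char basis_measurable E order_trans[OF char_bound[OF E]] mult_left_mono modulus_le) auto

lemma basis_one_minus_cos:
  assumes E: "E \<in> finite_area_sets" and K: "K > 0"
  shows "expectation (\<lambda>w. 1 - cos (\<Lambda> E w / K)) \<le> measure lborel E * \<kappa> (2 / K)"
proof -
  have "expectation (\<lambda>w. 1 - cos (1 / K * \<Lambda> E w)) \<le> measure lborel E * \<kappa> \<bar>1 / K\<bar>"
    by (rule order_trans[OF expectation_one_minus_cos_le char_bound]) (use E basis_measurable in auto)
  also have "\<dots> \<le> measure lborel E * \<kappa> (2 / K)"
    using K by (intro mult_left_mono modulus_le) (auto simp: field_simps)
  finally show ?thesis by simp
qed

text \<open>\<open>x\<^sup>2 \<le> 3 K\<^sup>2 (1 - cos (x / K))\<close> for \<open>\<bar>x\<bar> \<le> K\<close>, and the mean of the right-hand side is controlled by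
  the characteristic function at \<open>1 / K\<close>.\<close>

lemma truncated_second_moment:
  assumes E: "E \<in> finite_area_sets" and K: "K > 0"
  shows "expectation (\<lambda>w. (truncate K (\<Lambda> E w))\<^sup>2) \<le> 3 * K\<^sup>2 * (measure lborel E * \<kappa> (2 / K))"
proof -
  note [measurable] = basis_measurable[OF E]
  have "expectation (\<lambda>w. (truncate K (\<Lambda> E w))\<^sup>2) \<le> expectation (\<lambda>w. 3 * K\<^sup>2 * (1 - cos (\<Lambda> E w / K)))"
  proof (rule integral_mono)
    show "integrable M (\<lambda>w. (truncate K (\<Lambda> E w))\<^sup>2)"
      using K power_mono[OF abs_truncate_le[of K] abs_ge_zero, of _ 2]
      by (intro integrable_const_bound[where B = "K\<^sup>2"]) auto
    show "integrable M (\<lambda>w. 3 * K\<^sup>2 * (1 - cos (\<Lambda> E w / K)))"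
      by (intro integrable_mult_right Bochner_Integration.integrable_diff integrable_const_bound[where B = 1]) auto
    show "(truncate K (\<Lambda> E w))\<^sup>2 \<le> 3 * K\<^sup>2 * (1 - cos (\<Lambda> E w / K))" for w
    proof (cases "\<bar>\<Lambda> E w\<bar> \<le> K")
      case True
      then have "(\<Lambda> E w / K)\<^sup>2 \<le> 3 * (1 - cos (\<Lambda> E w / K))"
        using K by (intro square_le_one_minus_cos) auto
      then have "(\<Lambda> E w)\<^sup>2 / K\<^sup>2 \<le> 3 * (1 - cos (\<Lambda> E w / K))" by (simp add: power_divide)
      then have "K\<^sup>2 * ((\<Lambda> E w)\<^sup>2 / K\<^sup>2) \<le> K\<^sup>2 * (3 * (1 - cos (\<Lambda> E w / K)))"
        by (intro mult_left_mono) auto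
      then show ?thesis using True K by (simp add: truncate_def algebra_simps)
    qed (auto simp: truncate_def)
  qed
  also have "\<dots> \<le> 3 * K\<^sup>2 * (measure lborel E * \<kappa> (2 / K))"
    using basis_one_minus_cos[OF E K] by (simp add: mult_left_mono)
  finally show ?thesis .
qed

text \<open>The truncated variable is compared with \<open>K sin (x / K)\<close>, whose mean is bounded by the
  characteristic function. The error is quadratic for \<open>\<bar>x\<bar> \<le> K\<close> and at most \<open>K\<close> on the rare event \<open>\<bar>x\<bar> > K\<close>.
  It matters that the bound is proportional to the area: the mean of a sum over many cells stays
  bounded.\<close>

lemma truncated_mean:
  assumes E: "E \<in> finite_area_sets" and K: "K > 0"
  shows "\<bar>expectation (\<lambda>w. truncate K (\<Lambda> E w))\<bar> \<le> 5 * K * (measure lborel E * \<kappa> (2 / K))"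
proof -
  note [measurable] = basis_measurable[OF E]
  let ?m = "measure lborel E * \<kappa> (2 / K)"
  let ?X = "\<lambda>w. \<Lambda> E w"
  let ?bad = "{w \<in> space M. K < \<bar>?X w\<bar>}"
  have i1: "integrable M (\<lambda>w. truncate K (?X w))"
    using K abs_truncate_le[of K] by (intro integrable_const_bound[where B = K]) auto
  have i2: "integrable M (\<lambda>w. K * sin (?X w / K))"
    by (intro integrable_mult_right integrable_const_bound[where B = 1]) auto
  have i3: "integrable M (\<lambda>w. 2 * K * (1 - cos (?X w / K)))"
    by (intro integrable_mult_right Bochner_Integration.integrable_diff integrable_const_bound[where B = 1]) auto
  have i4: "integrable M (\<lambda>w. K * indicator ?bad w :: real)"
    by (intro integrable_mult_right integrable_const_bound[where B = 1]) auto
  have pt: "\<bar>truncate K (?X w) - K * sin (?X w / K)\<bar> \<le> 2 * K * (1 - cos (?X w / K)) + K * indicator ?bad w"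
    if "w \<in> space M" for w
  proof (cases "\<bar>?X w\<bar> \<le> K")
    case True
    have "\<bar>?X w / K - sin (?X w / K)\<bar> \<le> 2 * (1 - cos (?X w / K))"
      using True K by (intro sin_minus_id_le) auto
    then have "K * \<bar>?X w / K - sin (?X w / K)\<bar> \<le> K * (2 * (1 - cos (?X w / K)))"
      using K by (intro mult_left_mono) auto
    moreover have "K * \<bar>?X w / K - sin (?X w / K)\<bar> = \<bar>K * (?X w / K - sin (?X w / K))\<bar>"
      using K by (simp only: abs_mult abs_of_pos)
    moreover have "K * (?X w / K - sin (?X w / K)) = ?X w - K * sin (?X w / K)"
      using K by (simp add: right_diff_distrib)
    ultimately show ?thesis using True by (simp add: truncate_def mult_ac)
  next
    case False
    have "K * \<bar>sin (?X w / K)\<bar> \<le> K * 1" using K by (intro mult_left_mono) auto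
    moreover have "0 \<le> 2 * K * (1 - cos (?X w / K))" using K by simp
    moreover have "\<bar>truncate K (?X w) - K * sin (?X w / K)\<bar> = K * \<bar>sin (?X w / K)\<bar>"
      using False K by (simp add: truncate_def abs_mult)
    moreover have ind: "indicator ?bad w = (1 :: real)" using False that by simp
    ultimately show ?thesis unfolding ind by linarith
  qed
  have "\<bar>expectation (\<lambda>w. truncate K (?X w)) - expectation (\<lambda>w. K * sin (?X w / K))\<bar>
      = \<bar>expectation (\<lambda>w. truncate K (?X w) - K * sin (?X w / K))\<bar>"
    using i1 i2 by simp
  also have "\<dots> \<le> expectation (\<lambda>w. \<bar>truncate K (?X w) - K * sin (?X w / K)\<bar>)"
    by (rule integral_abs_bound)
  also have "\<dots> \<le> expectation (\<lambda>w. 2 * K * (1 - cos (?X w / K)) + K * indicator ?bad w)"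
    using i1 i2 i3 i4 pt by (intro integral_mono) auto
  also have "\<dots> = 2 * K * expectation (\<lambda>w. 1 - cos (?X w / K)) + K * prob ?bad"
    using i3 i4 by simp
  also have "\<dots> \<le> 2 * K * ?m + K * (2 * ?m)"
    using K basis_one_minus_cos[OF E K] basis_tail[OF E K] by (intro add_mono mult_left_mono) auto
  finally have a: "\<bar>expectation (\<lambda>w. truncate K (?X w)) - expectation (\<lambda>w. K * sin (?X w / K))\<bar> \<le> 4 * K * ?m"
    by simp
  have "\<bar>expectation (\<lambda>w. sin (1 / K * ?X w))\<bar> \<le> measure lborel E * \<kappa> \<bar>1 / K\<bar>"
    by (rule order_trans[OF expectation_sin_le char_bound]) (use E in auto)
  also have "\<dots> \<le> ?m" using K by (intro mult_left_mono modulus_le) (auto simp: field_simps)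
  finally have "K * \<bar>expectation (\<lambda>w. sin (?X w / K))\<bar> \<le> K * ?m"
    using K by (intro mult_left_mono) auto
  then have "\<bar>expectation (\<lambda>w. K * sin (?X w / K))\<bar> \<le> K * ?m"
    using K by (simp add: abs_mult)
  with a show ?thesis by linarith
qed

text \<open>The first summand bounds the second moments of the truncated values of the basis, the second
  one their means; \<open>V\<close> is the total area of the cells.\<close>

definition trunc_const :: "real \<Rightarrow> real \<Rightarrow> real" where
  "trunc_const V K = sqrt (3 * K\<^sup>2 * \<kappa> (2 / K) + (5 * K * \<kappa> (2 / K))\<^sup>2 * V)"

lemma trunc_const_nonneg: "V \<ge> 0 \<Longrightarrow> K > 0 \<Longrightarrow> 0 \<le> trunc_const V K"
  by (simp add: trunc_const_def modulus_nonneg)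

text \<open>Independence makes the variances of the truncated values add up, and the means are
  summed by the Cauchy-Schwarz inequality.\<close>

lemma truncated_sum_mean_abs:
  assumes I: "finite I" "disjoint_family_on E I" "\<And>i. i \<in> I \<Longrightarrow> E i \<in> finite_area_sets"
    and V: "(\<Sum>i\<in>I. measure lborel (E i)) \<le> V" and K: "K > 0"
  shows "expectation (\<lambda>w. \<bar>\<Sum>i\<in>I. y i * truncate K (\<Lambda> (E i) w)\<bar>)
    \<le> trunc_const V K * sqrt (\<Sum>i\<in>I. (y i)\<^sup>2 * measure lborel (E i))"
proof -
  let ?X = "\<lambda>i w. truncate K (\<Lambda> (E i) w)" let ?m = "\<lambda>i. measure lborel (E i)"
  have m[measurable]: "i \<in> I \<Longrightarrow> \<Lambda> (E i) \<in> borel_measurable M" for i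
    using I(3) basis_measurable by auto
  have k0: "0 \<le> \<kappa> (2 / K)" using K by (intro modulus_nonneg) auto
  have ind: "indep_vars (\<lambda>_. borel) ?X I"
    by (rule indep_vars_compose2[OF indep_finite_family[OF I], where Y = "\<lambda>_. truncate K"]) auto
  have bnd: "\<bar>\<Sum>i\<in>I. y i * ?X i w\<bar> \<le> (\<Sum>i\<in>I. \<bar>y i\<bar> * K)" for w
    using K abs_truncate_le[of K] by (intro order_trans[OF sum_abs] sum_mono) (auto simp: abs_mult intro!: mult_left_mono)
  have "(expectation (\<lambda>w. \<bar>\<Sum>i\<in>I. y i * ?X i w\<bar>))\<^sup>2 \<le> expectation (\<lambda>w. (\<Sum>i\<in>I. y i * ?X i w)\<^sup>2)"
    by (rule square_expectation_abs_le[OF _ bnd]) measurable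
  also have "\<dots> \<le> (\<Sum>i\<in>I. (y i)\<^sup>2 * expectation (\<lambda>w. (?X i w)\<^sup>2)) + (\<Sum>i\<in>I. \<bar>y i\<bar> * \<bar>expectation (?X i)\<bar>)\<^sup>2"
    using K by (intro second_moment_indep_sum[OF ind I(1), of K]) (auto intro: abs_truncate_le)
  also have "\<dots> \<le> (\<Sum>i\<in>I. (y i)\<^sup>2 * (3 * K\<^sup>2 * (?m i * \<kappa> (2 / K)))) + (\<Sum>i\<in>I. \<bar>y i\<bar> * (5 * K * (?m i * \<kappa> (2 / K))))\<^sup>2"
    using I(3) K by (intro add_mono sum_mono mult_left_mono truncated_second_moment power_mono truncated_mean sum_nonneg) auto
  also have "(\<Sum>i\<in>I. \<bar>y i\<bar> * (5 * K * (?m i * \<kappa> (2 / K))))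
      = 5 * K * \<kappa> (2 / K) * (\<Sum>i\<in>I. sqrt (?m i) * (\<bar>y i\<bar> * sqrt (?m i)))"
    by (simp add: sum_distrib_left mult_ac real_sqrt_mult_self)
  also have "(\<dots>)\<^sup>2 \<le> (5 * K * \<kappa> (2 / K))\<^sup>2 * (V * (\<Sum>i\<in>I. (y i)\<^sup>2 * ?m i))"
  proof -
    have "(\<Sum>i\<in>I. sqrt (?m i) * (\<bar>y i\<bar> * sqrt (?m i)))\<^sup>2 \<le> (\<Sum>i\<in>I. (sqrt (?m i))\<^sup>2) * (\<Sum>i\<in>I. (\<bar>y i\<bar> * sqrt (?m i))\<^sup>2)"
      by (rule Cauchy_Schwarz_ineq_sum)
    also have "\<dots> \<le> V * (\<Sum>i\<in>I. (y i)\<^sup>2 * ?m i)"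
      using V by (auto simp: power_mult_distrib intro!: mult_right_mono sum_nonneg)
    finally show ?thesis by (simp add: power_mult_distrib mult_left_mono)
  qed
  also have "(\<Sum>i\<in>I. (y i)\<^sup>2 * (3 * K\<^sup>2 * (?m i * \<kappa> (2 / K)))) = 3 * K\<^sup>2 * \<kappa> (2 / K) * (\<Sum>i\<in>I. (y i)\<^sup>2 * ?m i)"
    by (simp add: sum_distrib_left mult_ac)
  finally have "(expectation (\<lambda>w. \<bar>\<Sum>i\<in>I. y i * ?X i w\<bar>))\<^sup>2
     \<le> (3 * K\<^sup>2 * \<kappa> (2 / K) + (5 * K * \<kappa> (2 / K))\<^sup>2 * V) * (\<Sum>i\<in>I. (y i)\<^sup>2 * ?m i)"
    by (simp add: algebra_simps)
  then show ?thesis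
    by (simp add: real_le_rsqrt trunc_const_def flip: real_sqrt_mult)
qed

text \<open>On the event that no cell of the partition carries a value above \<open>K\<close>, integrals of simple
  functions have first moments controlled by the \<open>L\<^sup>2\<close> norm of the integrand. The probability of
  the complement is small for large \<open>K\<close>, uniformly over all partitions. This plays the role of
  splitting off the large jumps.\<close>

lemma tail_weighted_sum:
  assumes I: "finite I" "disjoint_family_on E I" "\<And>i. i \<in> I \<Longrightarrow> E i \<in> finite_area_sets"
    and V: "(\<Sum>i\<in>I. measure lborel (E i)) \<le> V" and K: "K > 0" and c: "c > 0"
    and W: "finite W" "\<And>j. j \<in> W \<Longrightarrow> 0 \<le> v j"
  shows "prob {w \<in> space M. c < \<bar>\<Sum>j\<in>W. v j * \<bar>\<Sum>i\<in>I. y j i * \<Lambda> (E i) w\<bar>\<bar>}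
    \<le> 2 * V * \<kappa> (2 / K) + trunc_const V K / c * (\<Sum>j\<in>W. v j * sqrt (\<Sum>i\<in>I. (y j i)\<^sup>2 * measure lborel (E i)))"
proof -
  have m[measurable]: "i \<in> I \<Longrightarrow> \<Lambda> (E i) \<in> borel_measurable M" for i
    using I(3) basis_measurable by auto
  have k0: "0 \<le> \<kappa> (2 / K)" using K by (intro modulus_nonneg) auto
  let ?S = "\<lambda>w. \<Sum>j\<in>W. v j * \<bar>\<Sum>i\<in>I. y j i * truncate K (\<Lambda> (E i) w)\<bar>"
  let ?bad = "\<Union>i\<in>I. {w \<in> space M. K < \<bar>\<Lambda> (E i) w\<bar>}"
  have S0: "0 \<le> ?S w" for w using W by (intro sum_nonneg) auto
  have int: "integrable M (\<lambda>w. \<bar>\<Sum>i\<in>I. y j i * truncate K (\<Lambda> (E i) w)\<bar>)" for j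
    using K abs_truncate_le[of K]
    by (intro integrable_abs Bochner_Integration.integrable_sum integrable_mult_right integrable_const_bound[where B = K]) auto
  have [measurable]: "?S \<in> borel_measurable M" by measurable
  have [measurable]: "?bad \<in> sets M"
    using I(1) by (intro sets.finite_UN) auto
  have "prob {w \<in> space M. c < \<bar>\<Sum>j\<in>W. v j * \<bar>\<Sum>i\<in>I. y j i * \<Lambda> (E i) w\<bar>\<bar>}
    \<le> prob (?bad \<union> {w \<in> space M. c \<le> ?S w})"
  proof (rule finite_measure_mono)
    show "{w \<in> space M. c < \<bar>\<Sum>j\<in>W. v j * \<bar>\<Sum>i\<in>I. y j i * \<Lambda> (E i) w\<bar>\<bar>} \<subseteq> ?bad \<union> {w \<in> space M. c \<le> ?S w}"
    proof
      fix w assume w: "w \<in> {w \<in> space M. c < \<bar>\<Sum>j\<in>W. v j * \<bar>\<Sum>i\<in>I. y j i * \<Lambda> (E i) w\<bar>\<bar>}"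
      show "w \<in> ?bad \<union> {w \<in> space M. c \<le> ?S w}"
      proof (cases "w \<in> ?bad")
        case False
        then have "truncate K (\<Lambda> (E i) w) = \<Lambda> (E i) w" if "i \<in> I" for i
          using w that by (auto simp: truncate_def not_less)
        then have "?S w = (\<Sum>j\<in>W. v j * \<bar>\<Sum>i\<in>I. y j i * \<Lambda> (E i) w\<bar>)" by simp
        then show ?thesis using w S0[of w] by auto
      qed auto
    qed
  qed measurable
  also have "\<dots> \<le> prob ?bad + prob {w \<in> space M. c \<le> ?S w}"
    by (intro measure_Un_le) measurable
  also have "prob ?bad \<le> (\<Sum>i\<in>I. prob {w \<in> space M. K < \<bar>\<Lambda> (E i) w\<bar>})"
    using I(1) by (intro finite_measure_subadditive_finite) auto
  also have "\<dots> \<le> (\<Sum>i\<in>I. 2 * (measure lborel (E i) * \<kappa> (2 / K)))"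
    using I(3) K by (intro sum_mono basis_tail) auto
  also have "\<dots> = 2 * (\<Sum>i\<in>I. measure lborel (E i)) * \<kappa> (2 / K)"
    by (simp add: sum_distrib_left sum_distrib_right mult_ac)
  also have "\<dots> \<le> 2 * V * \<kappa> (2 / K)"
    using V k0 by (intro mult_right_mono) auto
  also have "prob {w \<in> space M. c \<le> ?S w} \<le> expectation ?S / c"
    using S0 c int by (intro integral_Markov_inequality_measure[where A = "space M"]) auto
  also have "expectation ?S = (\<Sum>j\<in>W. v j * expectation (\<lambda>w. \<bar>\<Sum>i\<in>I. y j i * truncate K (\<Lambda> (E i) w)\<bar>))"
    using int by (subst Bochner_Integration.integral_sum) auto
  also have "\<dots> / c \<le> (\<Sum>j\<in>W. v j * (trunc_const V K * sqrt (\<Sum>i\<in>I. (y j i)\<^sup>2 * measure lborel (E i)))) / c"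
    using W c by (intro divide_right_mono sum_mono mult_left_mono truncated_sum_mean_abs I V K) auto
  also have "\<dots> = trunc_const V K / c * (\<Sum>j\<in>W. v j * sqrt (\<Sum>i\<in>I. (y j i)\<^sup>2 * measure lborel (E i)))"
    by (simp add: sum_distrib_left sum_divide_distrib mult_ac)
  finally show ?thesis by simp
qed

lemma tail_weighted_simple_integrals:
  assumes W: "finite W" "\<And>j. j \<in> W \<Longrightarrow> 0 \<le> v j" and f: "\<And>j. j \<in> W \<Longrightarrow> simple_integrand (f j)"
    and B: "B \<in> finite_area_sets" and sup: "\<And>j. j \<in> W \<Longrightarrow> {q. f j q \<noteq> 0} \<subseteq> B"
    and K: "K > 0" and c: "c > 0"
  shows "prob {w \<in> space M. c < \<bar>\<Sum>j\<in>W. v j * \<bar>simple_levy_integral \<Lambda> UNIV (f j) w\<bar>\<bar>}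
    \<le> 2 * measure lborel B * \<kappa> (2 / K)
      + trunc_const (measure lborel B) K / c * (\<Sum>j\<in>W. v j * sqrt (\<integral>q. (f j q)\<^sup>2 \<partial>lborel))"
proof -
  note Bm = finite_area_setsD[OF B]
  obtain I :: "('a \<Rightarrow> real) set" and E where I: "finite I" "disjoint_family_on E I"
    "\<And>i. i \<in> I \<Longrightarrow> E i \<in> finite_area_sets" "\<And>i. i \<in> I \<Longrightarrow> E i \<subseteq> B"
    and val: "\<And>i j q. i \<in> I \<Longrightarrow> j \<in> W \<Longrightarrow> q \<in> E i \<Longrightarrow> f j q = i j"
    and cov: "\<And>j. j \<in> W \<Longrightarrow> B \<inter> {q. f j q \<noteq> 0} \<subseteq> (\<Union>i\<in>I. E i)"
    by (rule common_refinement[OF W(1) f Bm(1)]) (assumption, rule that)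
  have cov': "UNIV \<inter> {q. f j q \<noteq> 0} \<subseteq> (\<Union>i\<in>I. E i)" if "j \<in> W" for j
    using cov[OF that] sup[OF that] by blast
  have AE: "AE w in M. \<forall>j\<in>W. simple_levy_integral \<Lambda> UNIV (f j) w = (\<Sum>i\<in>I. i j * \<Lambda> (E i) w)"
    using val cov' by (intro AE_finite_allI[OF W(1)] simple_integral_refinement f I(1,2,3)) auto
  have sq: "(\<integral>q. (f j q)\<^sup>2 \<partial>lborel) = (\<Sum>i\<in>I. (i j)\<^sup>2 * measure lborel (E i))" if j: "j \<in> W" for j
    using integral_refinement(2)[OF I(1,2,3) _ val[OF _ j] cov'[OF j], where \<phi> = "\<lambda>x. x\<^sup>2"] by simp
  have "(\<Sum>i\<in>I. measure lborel (E i)) = measure lborel (\<Union>i\<in>I. E i)"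
    using I(1,2) finite_area_setsD[OF I(3)]
    by (intro measure_finite_Union[symmetric]) (auto simp: less_top[symmetric])
  also have "\<dots> \<le> measure lborel B"
    using I(1,4) Bm finite_area_setsD(1)[OF I(3)] by (intro measure_mono_fmeasurable) auto
  finally have V: "(\<Sum>i\<in>I. measure lborel (E i)) \<le> measure lborel B" .
  have m[measurable]: "i \<in> I \<Longrightarrow> \<Lambda> (E i) \<in> borel_measurable M" for i
    using I(3) basis_measurable by auto
  have "prob {w \<in> space M. c < \<bar>\<Sum>j\<in>W. v j * \<bar>simple_levy_integral \<Lambda> UNIV (f j) w\<bar>\<bar>}
    \<le> prob {w \<in> space M. c < \<bar>\<Sum>j\<in>W. v j * \<bar>\<Sum>i\<in>I. i j * \<Lambda> (E i) w\<bar>\<bar>}"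
    using AE by (intro tail_mono) (auto elim!: eventually_mono)
  also have "\<dots> \<le> 2 * measure lborel B * \<kappa> (2 / K) + trunc_const (measure lborel B) K / c
      * (\<Sum>j\<in>W. v j * sqrt (\<Sum>i\<in>I. (i j)\<^sup>2 * measure lborel (E i)))"
    by (rule tail_weighted_sum[OF I(1,2,3) V K c W])
  also have "(\<Sum>j\<in>W. v j * sqrt (\<Sum>i\<in>I. (i j)\<^sup>2 * measure lborel (E i))) = (\<Sum>j\<in>W. v j * sqrt (\<integral>q. (f j q)\<^sup>2 \<partial>lborel))"
    using sq by simp
  finally show ?thesis .
qed

lemma tail_weighted_integrals:
  assumes W: "finite W" "\<And>j. j \<in> W \<Longrightarrow> 0 \<le> v j"
    and Y: "\<And>j. j \<in> W \<Longrightarrow> has_levy_integral M \<Lambda> UNIV (f j) (Y j)"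
    and B: "B \<in> finite_area_sets" and fb: "\<And>j q. j \<in> W \<Longrightarrow> \<bar>f j q\<bar> \<le> C * indicator B q"
    and K: "K > 0" and c: "c > 0"
  shows "prob {w \<in> space M. c < \<bar>\<Sum>j\<in>W. v j * \<bar>Y j w\<bar>\<bar>}
    \<le> 2 * measure lborel B * \<kappa> (2 / K)
      + 4 * trunc_const (measure lborel B) K / c * (\<Sum>j\<in>W. v j * sqrt (\<integral>q. (f j q)\<^sup>2 \<partial>lborel))"
    (is "_ \<le> ?bound")
proof -
  have "\<forall>j\<in>W. \<exists>s. (\<forall>n. simple_integrand (s n)) \<and> (\<forall>n q. \<bar>s n q\<bar> \<le> 2 * \<bar>f j q\<bar>) \<and>
      tendsto_in_prob M (\<lambda>n. simple_levy_integral \<Lambda> UNIV (s n)) (Y j) sequentially"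
  proof
    fix j assume j: "j \<in> W"
    show "\<exists>s. (\<forall>n. simple_integrand (s n)) \<and> (\<forall>n q. \<bar>s n q\<bar> \<le> 2 * \<bar>f j q\<bar>) \<and>
      tendsto_in_prob M (\<lambda>n. simple_levy_integral \<Lambda> UNIV (s n)) (Y j) sequentially"
      by (rule has_levy_integral_approximation[OF Y[OF j] B fb[OF j]]) blast
  qed
  from bchoice[OF this] obtain s where s: "\<And>j n. j \<in> W \<Longrightarrow> simple_integrand (s j n)"
    "\<And>j n q. j \<in> W \<Longrightarrow> \<bar>s j n q\<bar> \<le> 2 * \<bar>f j q\<bar>"
    "\<And>j. j \<in> W \<Longrightarrow> tendsto_in_prob M (\<lambda>n. simple_levy_integral \<Lambda> UNIV (s j n)) (Y j) sequentially" by blast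
  note fm[measurable] = has_levy_integral_measurable(1)[OF Y]
  have sq: "integrable lborel (\<lambda>q. 4 * (f j q)\<^sup>2)" if j: "j \<in> W" for j
  proof (rule Bochner_Integration.integrable_bound)
    show "integrable lborel (\<lambda>q. 4 * C\<^sup>2 * indicator B q)"
      using B by (auto simp: finite_area_sets_def)
    have "\<bar>f j q\<bar>\<^sup>2 \<le> (C * indicator B q)\<^sup>2" for q by (rule power_mono[OF fb[OF j]]) simp
    moreover have "(C * indicator B q)\<^sup>2 = C\<^sup>2 * indicator B q" for q
      by (simp add: power_mult_distrib split: split_indicator)
    ultimately have "(f j q)\<^sup>2 \<le> C\<^sup>2 * indicator B q" for q by simp
    then show "AE q in lborel. norm (4 * (f j q)\<^sup>2) \<le> norm (4 * C\<^sup>2 * indicator B q)"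
      by (intro AE_I2) simp
  qed (use j in measurable)
  have bound: "prob {w \<in> space M. c / 2 < \<bar>\<Sum>j\<in>W. v j * \<bar>simple_levy_integral \<Lambda> UNIV (s j n) w\<bar>\<bar>} \<le> ?bound" for n
  proof -
    have "{q. s j n q \<noteq> 0} \<subseteq> B" if "j \<in> W" for j
    proof
      fix q assume "q \<in> {q. s j n q \<noteq> 0}"
      then have "f j q \<noteq> 0" using s(2)[OF that, of n q] by auto
      then show "q \<in> B" using fb[OF that, of q] by (auto split: split_indicator_asm)
    qed
    then have "prob {w \<in> space M. c / 2 < \<bar>\<Sum>j\<in>W. v j * \<bar>simple_levy_integral \<Lambda> UNIV (s j n) w\<bar>\<bar>}
      \<le> 2 * measure lborel B * \<kappa> (2 / K)
        + trunc_const (measure lborel B) K / (c / 2) * (\<Sum>j\<in>W. v j * sqrt (\<integral>q. (s j n q)\<^sup>2 \<partial>lborel))"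
      using c s(1) by (intro tail_weighted_simple_integrals[OF W _ B _ K]) auto
    moreover have "(\<Sum>j\<in>W. v j * sqrt (\<integral>q. (s j n q)\<^sup>2 \<partial>lborel)) \<le> (\<Sum>j\<in>W. v j * (2 * sqrt (\<integral>q. (f j q)\<^sup>2 \<partial>lborel)))"
    proof (intro sum_mono mult_left_mono W(2))
      fix j assume j: "j \<in> W"
      have "(s j n q)\<^sup>2 \<le> 4 * (f j q)\<^sup>2" for q
        using power_mono[OF s(2)[OF j, of n q], of 2] by (simp add: power_mult_distrib)
      then have "(\<integral>q. (s j n q)\<^sup>2 \<partial>lborel) \<le> (\<integral>q. 4 * (f j q)\<^sup>2 \<partial>lborel)"
        by (intro integral_mono' sq j) auto
      then have "sqrt (\<integral>q. (s j n q)\<^sup>2 \<partial>lborel) \<le> sqrt (4 * (\<integral>q. (f j q)\<^sup>2 \<partial>lborel))"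
        by (intro real_sqrt_le_mono) simp
      then show "sqrt (\<integral>q. (s j n q)\<^sup>2 \<partial>lborel) \<le> 2 * sqrt (\<integral>q. (f j q)\<^sup>2 \<partial>lborel)"
        by (simp add: real_sqrt_mult)
    qed
    then have "trunc_const (measure lborel B) K / (c / 2) * (\<Sum>j\<in>W. v j * sqrt (\<integral>q. (s j n q)\<^sup>2 \<partial>lborel))
      \<le> trunc_const (measure lborel B) K / (c / 2) * (\<Sum>j\<in>W. v j * (2 * sqrt (\<integral>q. (f j q)\<^sup>2 \<partial>lborel)))"
      using c K trunc_const_nonneg[of "measure lborel B" K] by (intro mult_left_mono) auto
    moreover have "trunc_const (measure lborel B) K / (c / 2) * (\<Sum>j\<in>W. v j * (2 * sqrt (\<integral>q. (f j q)\<^sup>2 \<partial>lborel)))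
       = 4 * trunc_const (measure lborel B) K / c * (\<Sum>j\<in>W. v j * sqrt (\<integral>q. (f j q)\<^sup>2 \<partial>lborel))"
      by (simp add: sum_distrib_left mult_ac)
    ultimately show ?thesis by linarith
  qed
  have "tendsto_in_prob M (\<lambda>n w. \<Sum>j\<in>W. v j * \<bar>simple_levy_integral \<Lambda> UNIV (s j n) w\<bar>) (\<lambda>w. \<Sum>j\<in>W. v j * \<bar>Y j w\<bar>) sequentially"
    by (intro tendsto_in_prob_sum W(1) tendsto_in_prob_cmult tendsto_in_prob_abs s(3))
  from tail_limit[OF this, of "c / 2" "\<lambda>_. ?bound" ?bound "c / 2"]
  show ?thesis using bound c by auto
qed

end

section \<open>A stochastic Fubini theorem\<close>

lemma measurable_simple_function_into:
  assumes "simple_function N \<tau>" "\<And>x. x \<in> space N \<Longrightarrow> \<tau> x \<in> space N'"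
  shows "\<tau> \<in> measurable N N'"
  using measurable_sets[OF measurable_simple_function[OF assms(1)], of "_"] assms(2)
  by (intro measurableI) auto

lemma (in finite_measure)
  fixes \<phi> :: "'b \<Rightarrow> real"
  assumes \<tau>: "simple_function M \<tau>"
  shows integrable_simple_compose: "integrable M (\<lambda>x. \<phi> (\<tau> x))"
    and integral_simple_compose:
      "(\<integral>x. \<phi> (\<tau> x) \<partial>M) = (\<Sum>a\<in>\<tau> ` space M. measure M (\<tau> -` {a} \<inter> space M) * \<phi> a)"
proof -
  have fin: "finite (\<tau> ` space M)" and sets: "\<And>a. \<tau> -` {a} \<inter> space M \<in> sets M"
    using simple_functionD[OF \<tau>] by auto
  have eq: "\<phi> (\<tau> x) = (\<Sum>a\<in>\<tau> ` space M. \<phi> a * indicator (\<tau> -` {a} \<inter> space M) x)" if "x \<in> space M" for x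
  proof -
    have "(\<Sum>a\<in>\<tau> ` space M. \<phi> a * indicator (\<tau> -` {a} \<inter> space M) x)
      = (\<Sum>a\<in>\<tau> ` space M. if a = \<tau> x then \<phi> a else 0)"
      using that by (intro sum.cong) (auto split: split_indicator)
    then show ?thesis using fin that by simp
  qed
  have int: "integrable M (\<lambda>x. \<phi> a * indicator (\<tau> -` {a} \<inter> space M) x)" for a
    using sets by (intro integrable_mult_right integrable_const_bound[where B = 1]) (auto split: split_indicator)
  show "integrable M (\<lambda>x. \<phi> (\<tau> x))"
    by (subst Bochner_Integration.integrable_cong[OF refl eq]) (auto intro!: Bochner_Integration.integrable_sum int)
  have "(\<integral>x. \<phi> (\<tau> x) \<partial>M) = (\<integral>x. (\<Sum>a\<in>\<tau> ` space M. \<phi> a * indicator (\<tau> -` {a} \<inter> space M) x) \<partial>M)"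
    by (rule Bochner_Integration.integral_cong[OF refl eq])
  also have "\<dots> = (\<Sum>a\<in>\<tau> ` space M. measure M (\<tau> -` {a} \<inter> space M) * \<phi> a)"
    using sets int by (subst Bochner_Integration.integral_sum) (auto simp: mult.commute)
  finally show "(\<integral>x. \<phi> (\<tau> x) \<partial>M) = (\<Sum>a\<in>\<tau> ` space M. measure M (\<tau> -` {a} \<inter> space M) * \<phi> a)" .
qed

text \<open>Truncating at \<open>k\<close> turns convergence in probability into convergence of means.\<close>

lemma (in prob_space) expectation_min_tendsto_0:
  assumes A: "tendsto_in_prob M A A' sequentially" and m: "\<And>n. A n \<in> borel_measurable M" and k: "k \<ge> 0"
  shows "(\<lambda>n. expectation (\<lambda>w. min k \<bar>A' w - A n w\<bar>)) \<longlonglongrightarrow> 0"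
proof (rule LIMSEQ_I)
  note [measurable] = m tendsto_in_probD(1)[OF A]
  fix r :: real assume r: "r > 0"
  have "(\<lambda>n. r / 2 + k * prob {w \<in> space M. r / 2 < \<bar>A n w - A' w\<bar>}) \<longlonglongrightarrow> r / 2 + k * 0"
    using tendsto_in_probD(3)[OF A, of "r / 2"] r by (intro tendsto_intros) auto
  then have "\<forall>\<^sub>F n in sequentially. r / 2 + k * prob {w \<in> space M. r / 2 < \<bar>A n w - A' w\<bar>} < r"
    using r by (intro order_tendstoD(2)[where y = "r / 2 + k * 0"]) auto
  moreover have "expectation (\<lambda>w. min k \<bar>A' w - A n w\<bar>) \<le> r / 2 + k * prob {w \<in> space M. r / 2 < \<bar>A n w - A' w\<bar>}" for n
  proof -
    have "expectation (\<lambda>w. min k \<bar>A' w - A n w\<bar>)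
       \<le> expectation (\<lambda>w. r / 2 + k * indicator {w \<in> space M. r / 2 < \<bar>A n w - A' w\<bar>} w)"
    proof (rule integral_mono)
      show "integrable M (\<lambda>w. min k \<bar>A' w - A n w\<bar>)"
        using k by (intro integrable_const_bound[where B = k]) auto
      show "integrable M (\<lambda>w. r / 2 + k * indicator {w \<in> space M. r / 2 < \<bar>A n w - A' w\<bar>} w)"
        by (intro Bochner_Integration.integrable_add integrable_const integrable_mult_right integrable_const_bound[where B = 1]) auto
      show "min k \<bar>A' w - A n w\<bar> \<le> r / 2 + k * indicator {w \<in> space M. r / 2 < \<bar>A n w - A' w\<bar>} w"
        if "w \<in> space M" for w
        using k r that by (auto simp: abs_minus_commute min_def split: split_indicator)
    qed
    also have "\<dots> = r / 2 + k * prob {w \<in> space M. r / 2 < \<bar>A n w - A' w\<bar>}"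
      by (subst Bochner_Integration.integral_add)
         (auto simp: prob_space intro!: integrable_mult_right integrable_const_bound[where B = 1 and f = "indicator _"])
    finally show ?thesis .
  qed
  ultimately have "\<forall>\<^sub>F n in sequentially. expectation (\<lambda>w. min k \<bar>A' w - A n w\<bar>) < r"
    by (auto elim!: eventually_mono intro: le_less_trans)
  moreover have "0 \<le> expectation (\<lambda>w. min k \<bar>A' w - A n w\<bar>)" for n
    using k by (intro Bochner_Integration.integral_nonneg) auto
  ultimately show "\<exists>no. \<forall>n\<ge>no. norm (expectation (\<lambda>w. min k \<bar>A' w - A n w\<bar>) - 0) < r"
    by (auto simp: eventually_sequentially)
qed

text \<open>A family of bounded integrands \<open>g x\<close>, depending on a parameter \<open>x\<close> that is distributed by a finite
  measure \<open>\<mu>\<close>, and a jointly measurable version \<open>Y\<close> of their integrals. The maps \<open>\<tau> n\<close> with finitely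
  many values discretise the parameter; continuity of \<open>g\<close> along them holds only for almost every
  point of the plane, since a cut-off integrand jumps on a curve.\<close>

locale integral_family = controlled_basis M \<Lambda> \<kappa> + \<mu>: finite_measure \<mu>
  for M :: "'w measure" and \<Lambda> :: "plane set \<Rightarrow> 'w \<Rightarrow> real" and \<kappa> and \<mu> :: "'a measure" +
  fixes g :: "'a \<Rightarrow> plane \<Rightarrow> real" and Y :: "'a \<Rightarrow> 'w \<Rightarrow> real" and \<tau> :: "nat \<Rightarrow> 'a \<Rightarrow> 'a"
    and B :: "plane set" and C :: real
  assumes g_measurable [measurable]: "(\<lambda>(x, q). g x q) \<in> borel_measurable (\<mu> \<Otimes>\<^sub>M lborel)"
    and B: "B \<in> finite_area_sets"
    and g_bound: "\<And>x q. x \<in> space \<mu> \<Longrightarrow> \<bar>g x q\<bar> \<le> C * indicator B q"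
    and \<tau>_simple: "\<And>n. simple_function \<mu> (\<tau> n)"
    and \<tau>_space: "\<And>n x. x \<in> space \<mu> \<Longrightarrow> \<tau> n x \<in> space \<mu>"
    and g_lim: "\<And>x. x \<in> space \<mu> \<Longrightarrow> AE q in lborel. (\<lambda>n. g (\<tau> n x) q) \<longlonglongrightarrow> g x q"
    and Y_measurable [measurable]: "(\<lambda>(x, w). Y x w) \<in> borel_measurable (\<mu> \<Otimes>\<^sub>M M)"
    and Y_integral: "\<And>x. x \<in> space \<mu> \<Longrightarrow> has_levy_integral M \<Lambda> UNIV (g x) (Y x)"
begin

lemma \<tau>_measurable [measurable]: "\<tau> n \<in> measurable \<mu> \<mu>"
  using \<tau>_simple \<tau>_space by (rule measurable_simple_function_into)

abbreviation area :: real where "area \<equiv> measure lborel B"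

definition gap :: "nat \<Rightarrow> 'a \<Rightarrow> real" where
  "gap n x = sqrt (\<integral>q. (g x q - g (\<tau> n x) q)\<^sup>2 \<partial>lborel)"

definition mean_gap :: "nat \<Rightarrow> real" where
  "mean_gap n = (\<integral>x. gap n x \<partial>\<mu>)"

lemma gap_measurable [measurable]: "gap n \<in> borel_measurable \<mu>"
proof -
  have [measurable]: "(\<lambda>(x, q). (g x q - g (\<tau> n x) q)\<^sup>2) \<in> borel_measurable (\<mu> \<Otimes>\<^sub>M lborel)"
    by measurable
  show ?thesis unfolding gap_def[abs_def] by measurable
qed

lemma g_section_measurable [measurable]: "x \<in> space \<mu> \<Longrightarrow> g x \<in> borel_measurable borel"
  using has_levy_integral_measurable(1)[OF Y_integral] .

lemma Y_section_measurable [measurable]: "x \<in> space \<mu> \<Longrightarrow> Y x \<in> borel_measurable M"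
  using has_levy_integral_measurable(2)[OF Y_integral] .

lemma square_diff_le:
  assumes "x \<in> space \<mu>" "x' \<in> space \<mu>"
  shows "(g x q - g x' q)\<^sup>2 \<le> (2 * C)\<^sup>2 * indicator B q"
proof -
  have "\<bar>g x q - g x' q\<bar> \<le> 2 * C * indicator B q"
    using g_bound[OF assms(1), of q] g_bound[OF assms(2), of q] by linarith
  then have "\<bar>g x q - g x' q\<bar>\<^sup>2 \<le> (2 * C * indicator B q)\<^sup>2" by (rule power_mono) simp
  also have "(2 * C * indicator B q)\<^sup>2 = (2 * C)\<^sup>2 * indicator B q"
    by (simp add: power_mult_distrib split: split_indicator)
  finally show ?thesis by simp
qed

lemma dominating_integrable: "integrable lborel (\<lambda>q. D * indicator B q :: real)"
  using B by (auto simp: finite_area_sets_def)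

lemma square_diff_integrable:
  assumes "x \<in> space \<mu>" "x' \<in> space \<mu>"
  shows "integrable lborel (\<lambda>q. (g x q - g x' q)\<^sup>2)"
  by (rule Bochner_Integration.integrable_bound[OF dominating_integrable[of "(2 * C)\<^sup>2"]])
     (use assms square_diff_le[OF assms] in auto)

lemma gap_nonneg: "0 \<le> gap n x" by (simp add: gap_def)

lemma gap_le:
  assumes "x \<in> space \<mu>"
  shows "gap n x \<le> sqrt ((2 * C)\<^sup>2 * area)"
proof -
  have "(\<integral>q. (g x q - g (\<tau> n x) q)\<^sup>2 \<partial>lborel) \<le> (\<integral>q. (2 * C)\<^sup>2 * indicator B q \<partial>lborel)"
    using assms \<tau>_space by (intro integral_mono square_diff_integrable dominating_integrable square_diff_le) auto
  also have "\<dots> = (2 * C)\<^sup>2 * area" by simp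
  finally show ?thesis unfolding gap_def by (rule real_sqrt_le_mono)
qed

lemma gap_integrable: "integrable \<mu> (gap n)"
  using gap_nonneg gap_le by (intro \<mu>.integrable_const_bound[where B = "sqrt ((2 * C)\<^sup>2 * area)"]) auto

lemma gap_tendsto_0:
  assumes x: "x \<in> space \<mu>"
  shows "(\<lambda>n. gap n x) \<longlonglongrightarrow> 0"
proof -
  have "(\<lambda>n. \<integral>q. (g x q - g (\<tau> n x) q)\<^sup>2 \<partial>lborel) \<longlonglongrightarrow> (\<integral>q. 0 \<partial>(lborel :: plane measure))"
  proof (rule integral_dominated_convergence[OF _ _ dominating_integrable[of "(2 * C)\<^sup>2"]])
    show "AE q in lborel. (\<lambda>n. (g x q - g (\<tau> n x) q)\<^sup>2) \<longlonglongrightarrow> 0"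
      using g_lim[OF x]
    proof eventually_elim
      case (elim q)
      have "(\<lambda>n. (g x q - g (\<tau> n x) q)\<^sup>2) \<longlonglongrightarrow> (g x q - g x q)\<^sup>2" by (intro tendsto_intros elim)
      then show ?case by simp
    qed
    show "AE q in lborel. norm ((g x q - g (\<tau> n x) q)\<^sup>2) \<le> (2 * C)\<^sup>2 * indicator B q" for n
      using square_diff_le[OF x \<tau>_space[OF x]] by simp
  qed (use x \<tau>_space in measurable)
  then show ?thesis unfolding gap_def using tendsto_real_sqrt[of _ 0] by simp
qed

lemma mean_gap_tendsto_0: "mean_gap \<longlonglongrightarrow> 0"
proof -
  have "mean_gap \<longlonglongrightarrow> (\<integral>x. 0 \<partial>\<mu>)"
    unfolding mean_gap_def[abs_def]
  proof (rule integral_dominated_convergence[where w = "\<lambda>_. sqrt ((2 * C)\<^sup>2 * area)"])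
    show "AE x in \<mu>. (\<lambda>n. gap n x) \<longlonglongrightarrow> 0" using gap_tendsto_0 by simp
    show "AE x in \<mu>. norm (gap n x) \<le> sqrt ((2 * C)\<^sup>2 * area)" for n
      using gap_nonneg gap_le by simp
  qed auto
  then show ?thesis by simp
qed

text \<open>The truncation at \<open>k\<close> guarantees finiteness before integrability of the paths of \<open>Y\<close> is known.\<close>

definition deviation :: "real \<Rightarrow> nat \<Rightarrow> 'w \<Rightarrow> real" where
  "deviation k n w = (\<integral>x. min k \<bar>Y x w - Y (\<tau> n x) w\<bar> \<partial>\<mu>)"

lemma deviation_measurable [measurable]: "deviation k n \<in> borel_measurable M"
proof -
  have [measurable]: "(\<lambda>(w, x). min k \<bar>Y x w - Y (\<tau> n x) w\<bar>) \<in> borel_measurable (M \<Otimes>\<^sub>M \<mu>)"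
    by measurable
  show ?thesis unfolding deviation_def[abs_def] by measurable
qed

lemma section_measurable [measurable]: "w \<in> space M \<Longrightarrow> (\<lambda>x. Y x w) \<in> borel_measurable \<mu>"
  by measurable

lemma deviation_nonneg: "k \<ge> 0 \<Longrightarrow> 0 \<le> deviation k n w"
  unfolding deviation_def by (intro Bochner_Integration.integral_nonneg) auto

lemma deviation_integrable:
  assumes "k \<ge> 0"
  shows "integrable M (deviation k n)"
proof (rule integrable_const_bound[where B = "k * measure \<mu> (space \<mu>)"])
  have "deviation k n w \<le> (\<integral>x. k \<partial>\<mu>)" if "w \<in> space M" for w
    unfolding deviation_def using assms that
    by (intro integral_mono \<mu>.integrable_const_bound[where B = k]) auto
  then show "AE w in M. norm (deviation k n w) \<le> k * measure \<mu> (space \<mu>)"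
    using deviation_nonneg[OF assms] by (auto simp: mult.commute)
qed auto

text \<open>For each parameter the discretised integrals converge in probability, so the truncated mean
  distances tend to zero, and the parameter is integrated out by dominated convergence. This gives no
  rate and no control that is uniform in \<open>k\<close>.\<close>

lemma mean_deviation_tendsto_0:
  assumes k: "k \<ge> 0"
  shows "(\<lambda>n. expectation (deviation k n)) \<longlonglongrightarrow> 0"
proof -
  interpret P: pair_sigma_finite \<mu> M ..
  interpret PF: finite_measure "\<mu> \<Otimes>\<^sub>M M"
    by (rule finite_measure_pair_measure) (auto simp: \<mu>.finite_measure_axioms finite_measure_axioms)
  have [measurable]: "(\<lambda>(x, w). min k \<bar>Y x w - Y (\<tau> n x) w\<bar>) \<in> borel_measurable (\<mu> \<Otimes>\<^sub>M M)" for n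
    by measurable
  have int: "integrable (\<mu> \<Otimes>\<^sub>M M) (\<lambda>(x, w). min k \<bar>Y x w - Y (\<tau> n x) w\<bar>)" for n
    using k by (intro PF.integrable_const_bound[where B = k]) auto
  have eq: "expectation (deviation k n) = (\<integral>x. expectation (\<lambda>w. min k \<bar>Y x w - Y (\<tau> n x) w\<bar>) \<partial>\<mu>)" for n
    unfolding deviation_def by (rule P.Fubini_integral[OF int])
  have "(\<lambda>n. \<integral>x. expectation (\<lambda>w. min k \<bar>Y x w - Y (\<tau> n x) w\<bar>) \<partial>\<mu>) \<longlonglongrightarrow> (\<integral>x. 0 \<partial>\<mu>)"
  proof (rule integral_dominated_convergence[where w = "\<lambda>_. k"])
    show "(\<lambda>x. expectation (\<lambda>w. min k \<bar>Y x w - Y (\<tau> n x) w\<bar>)) \<in> borel_measurable \<mu>" for n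
      by measurable
    show "AE x in \<mu>. (\<lambda>n. expectation (\<lambda>w. min k \<bar>Y x w - Y (\<tau> n x) w\<bar>)) \<longlonglongrightarrow> 0"
    proof (intro AE_I2 expectation_min_tendsto_0)
      fix x assume x: "x \<in> space \<mu>"
      show "tendsto_in_prob M (\<lambda>n. Y (\<tau> n x)) (Y x) sequentially"
        using x \<tau>_space
        by (intro levy_integral_dominated_convergence[OF Y_integral Y_integral B g_bound g_bound g_lim]) auto
      show "Y (\<tau> n x) \<in> borel_measurable M" for n using x \<tau>_space by simp
    qed (rule k)
    show "AE x in \<mu>. norm (expectation (\<lambda>w. min k \<bar>Y x w - Y (\<tau> n x) w\<bar>)) \<le> k" for n
    proof (intro AE_I2)
      fix x assume x: "x \<in> space \<mu>"
      then have [measurable]: "Y x \<in> borel_measurable M" "Y (\<tau> n x) \<in> borel_measurable M"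
        using \<tau>_space by auto
      have "expectation (\<lambda>w. min k \<bar>Y x w - Y (\<tau> n x) w\<bar>) \<le> expectation (\<lambda>w. k)"
        using k by (intro integral_mono integrable_const_bound[where B = k]) auto
      moreover have "0 \<le> expectation (\<lambda>w. min k \<bar>Y x w - Y (\<tau> n x) w\<bar>)"
        using k by (intro Bochner_Integration.integral_nonneg) auto
      ultimately show "norm (expectation (\<lambda>w. min k \<bar>Y x w - Y (\<tau> n x) w\<bar>)) \<le> k"
        by (simp add: prob_space)
    qed
  qed auto
  then show ?thesis by (simp add: eq)
qed

text \<open>Two discretisations take finitely many pairs of values, so their distance is a finite weighted
  sum of absolute values of integrals.\<close>

lemma step_difference:
  assumes K: "K > 0" and c: "c > 0"
  shows "prob {w \<in> space M. c < \<bar>\<integral>x. \<bar>Y (\<tau> m x) w - Y (\<tau> n x) w\<bar> \<partial>\<mu>\<bar>}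
    \<le> 2 * area * \<kappa> (2 / K) + 4 * trunc_const area K / c * (2 * (mean_gap m + mean_gap n))"
proof -
  let ?\<sigma> = "\<lambda>x. (\<tau> m x, \<tau> n x)"
  have \<sigma>: "simple_function \<mu> ?\<sigma>" by (intro simple_function_Pair \<tau>_simple)
  define W where "W = ?\<sigma> ` space \<mu>"
  define v where "v a = measure \<mu> (?\<sigma> -` {a} \<inter> space \<mu>)" for a
  have W: "finite W" using simple_functionD(1)[OF \<sigma>] by (simp add: W_def)
  have Wsp: "fst a \<in> space \<mu>" "snd a \<in> space \<mu>" if "a \<in> W" for a using that \<tau>_space by (auto simp: W_def)
  have sum: "(\<integral>x. \<phi> (?\<sigma> x) \<partial>\<mu>) = (\<Sum>a\<in>W. v a * \<phi> a)" for \<phi> :: "'a \<times> 'a \<Rightarrow> real"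
    unfolding W_def v_def by (rule \<mu>.integral_simple_compose[OF \<sigma>])
  have Yd: "has_levy_integral M \<Lambda> UNIV (\<lambda>q. g (fst a) q - g (snd a) q) (\<lambda>w. Y (fst a) w - Y (snd a) w)" if "a \<in> W" for a
    using Wsp[OF that] by (intro has_levy_integral_diff Y_integral)
  have fb: "\<bar>g (fst a) q - g (snd a) q\<bar> \<le> (2 * C) * indicator B q" if "a \<in> W" for a q
    using g_bound[OF Wsp(1)[OF that], of q] g_bound[OF Wsp(2)[OF that], of q] by linarith
  have "prob {w \<in> space M. c < \<bar>\<Sum>a\<in>W. v a * \<bar>Y (fst a) w - Y (snd a) w\<bar>\<bar>}
    \<le> 2 * area * \<kappa> (2 / K) + 4 * trunc_const area K / c *
       (\<Sum>a\<in>W. v a * sqrt (\<integral>q. (g (fst a) q - g (snd a) q)\<^sup>2 \<partial>lborel))"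
    by (rule tail_weighted_integrals[OF W _ Yd B fb K c]) (simp_all add: v_def)
  also have "(\<Sum>a\<in>W. v a * sqrt (\<integral>q. (g (fst a) q - g (snd a) q)\<^sup>2 \<partial>lborel))
    = (\<integral>x. sqrt (\<integral>q. (g (\<tau> m x) q - g (\<tau> n x) q)\<^sup>2 \<partial>lborel) \<partial>\<mu>)"
    using sum[of "\<lambda>a. sqrt (\<integral>q. (g (fst a) q - g (snd a) q)\<^sup>2 \<partial>lborel)"] by simp
  finally have 1: "prob {w \<in> space M. c < \<bar>\<integral>x. \<bar>Y (\<tau> m x) w - Y (\<tau> n x) w\<bar> \<partial>\<mu>\<bar>}
    \<le> 2 * area * \<kappa> (2 / K) + 4 * trunc_const area K / c *
       (\<integral>x. sqrt (\<integral>q. (g (\<tau> m x) q - g (\<tau> n x) q)\<^sup>2 \<partial>lborel) \<partial>\<mu>)"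
    using sum[of "\<lambda>a. \<bar>Y (fst a) _ - Y (snd a) _\<bar>"] by simp
  have "(\<integral>x. sqrt (\<integral>q. (g (\<tau> m x) q - g (\<tau> n x) q)\<^sup>2 \<partial>lborel) \<partial>\<mu>) \<le> (\<integral>x. 2 * (gap m x + gap n x) \<partial>\<mu>)"
  proof (rule integral_mono)
    show "integrable \<mu> (\<lambda>x. sqrt (\<integral>q. (g (\<tau> m x) q - g (\<tau> n x) q)\<^sup>2 \<partial>lborel))"
      using \<mu>.integrable_simple_compose[OF \<sigma>, of "\<lambda>a. sqrt (\<integral>q. (g (fst a) q - g (snd a) q)\<^sup>2 \<partial>lborel)"] by simp
    show "integrable \<mu> (\<lambda>x. 2 * (gap m x + gap n x))"
      by (intro integrable_mult_right Bochner_Integration.integrable_add gap_integrable)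
    fix x assume x: "x \<in> space \<mu>"
    let ?I = "\<lambda>y z. (\<integral>q. (g y q - g z q)\<^sup>2 \<partial>lborel)"
    have "?I (\<tau> m x) (\<tau> n x) \<le> (\<integral>q. 2 * (g x q - g (\<tau> m x) q)\<^sup>2 + 2 * (g x q - g (\<tau> n x) q)\<^sup>2 \<partial>lborel)"
    proof (rule integral_mono)
      have "(s - t)\<^sup>2 \<le> 2 * (u - s)\<^sup>2 + 2 * (u - t)\<^sup>2" for s t u :: real
        using zero_le_power2[of "(u - s) + (u - t)"] by (simp add: power2_eq_square algebra_simps)
      then show "(g (\<tau> m x) q - g (\<tau> n x) q)\<^sup>2 \<le> 2 * (g x q - g (\<tau> m x) q)\<^sup>2 + 2 * (g x q - g (\<tau> n x) q)\<^sup>2" for q .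
    qed (use x \<tau>_space in \<open>auto intro!: square_diff_integrable Bochner_Integration.integrable_add integrable_mult_right\<close>)
    also have "\<dots> = 2 * ?I x (\<tau> m x) + 2 * ?I x (\<tau> n x)"
      using x \<tau>_space by (subst Bochner_Integration.integral_add) (auto intro!: square_diff_integrable integrable_mult_right)
    also have "\<dots> \<le> 4 * (?I x (\<tau> m x) + ?I x (\<tau> n x))"
      by (simp add: Bochner_Integration.integral_nonneg)
    finally have "sqrt (?I (\<tau> m x) (\<tau> n x)) \<le> sqrt (4 * (?I x (\<tau> m x) + ?I x (\<tau> n x)))"
      by (rule real_sqrt_le_mono)
    also have "\<dots> = 2 * sqrt (?I x (\<tau> m x) + ?I x (\<tau> n x))"
      by (simp only: real_sqrt_mult real_sqrt_four)
    also have "\<dots> \<le> 2 * (sqrt (?I x (\<tau> m x)) + sqrt (?I x (\<tau> n x)))"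
      by (intro mult_left_mono sqrt_add_le_add_sqrt Bochner_Integration.integral_nonneg) auto
    finally show "sqrt (?I (\<tau> m x) (\<tau> n x)) \<le> 2 * (gap m x + gap n x)" by (simp add: gap_def)
  qed
  also have "\<dots> = 2 * (mean_gap m + mean_gap n)"
    using gap_integrable by (simp add: mean_gap_def)
  finally have "4 * trunc_const area K / c * (\<integral>x. sqrt (\<integral>q. (g (\<tau> m x) q - g (\<tau> n x) q)\<^sup>2 \<partial>lborel) \<partial>\<mu>)
     \<le> 4 * trunc_const area K / c * (2 * (mean_gap m + mean_gap n))"
    using K c trunc_const_nonneg[of area K] by (intro mult_left_mono) auto
  with 1 show ?thesis by linarith
qed

text \<open>The comparison with another discretisation \<open>m\<close> replaces \<open>Y\<close> by finitely many integrals, for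
  which the moment bound holds. As \<open>m\<close> grows the cost of the replacement disappears, and the
  resulting bound is independent of \<open>k\<close>.\<close>

lemma deviation_tail:
  assumes k: "k \<ge> 0" and K: "K > 0" and c: "c > 0"
  shows "prob {w \<in> space M. c < deviation k n w} \<le> 2 * area * \<kappa> (2 / K) + 16 * trunc_const area K / c * mean_gap n"
proof -
  let ?T = "\<lambda>m. 2 * area * \<kappa> (2 / K) + 4 * trunc_const area K / (c / 2) * (2 * (mean_gap m + mean_gap n))"
  have "prob {w \<in> space M. c < deviation k n w} \<le> expectation (deviation k m) / (c / 2) + ?T m" for m
  proof -
    let ?S = "\<lambda>w. \<integral>x. \<bar>Y (\<tau> m x) w - Y (\<tau> n x) w\<bar> \<partial>\<mu>"
    have [measurable]: "?S \<in> borel_measurable M"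
    proof -
      have [measurable]: "(\<lambda>(w, x). \<bar>Y (\<tau> m x) w - Y (\<tau> n x) w\<bar>) \<in> borel_measurable (M \<Otimes>\<^sub>M \<mu>)" by measurable
      show ?thesis by measurable
    qed
    have le: "\<bar>deviation k n w\<bar> \<le> \<bar>deviation k m w\<bar> + \<bar>?S w\<bar>" if w: "w \<in> space M" for w
    proof -
      have i: "integrable \<mu> (\<lambda>x. \<bar>Y (\<tau> m x) w - Y (\<tau> n x) w\<bar>)"
        using \<mu>.integrable_simple_compose[OF simple_function_Pair[OF \<tau>_simple[of m] \<tau>_simple[of n]],
          of "\<lambda>a. \<bar>Y (fst a) w - Y (snd a) w\<bar>"] by simp
      have j: "integrable \<mu> (\<lambda>x. min k \<bar>Y x w - Y (\<tau> n x) w\<bar>)" for n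
        using k w by (intro \<mu>.integrable_const_bound[where B = k]) auto
      have "deviation k n w \<le> (\<integral>x. min k \<bar>Y x w - Y (\<tau> m x) w\<bar> + \<bar>Y (\<tau> m x) w - Y (\<tau> n x) w\<bar> \<partial>\<mu>)"
        unfolding deviation_def using i j by (intro integral_mono) auto
      also have "\<dots> = deviation k m w + ?S w" unfolding deviation_def using i j by simp
      finally show ?thesis using deviation_nonneg[OF k] by (smt (verit))
    qed
    have "prob {w \<in> space M. c < deviation k n w} \<le> prob {w \<in> space M. c / 2 + c / 2 < \<bar>deviation k n w\<bar>}"
      by (intro finite_measure_mono) auto
    also have "\<dots> \<le> prob {w \<in> space M. c / 2 < \<bar>deviation k m w\<bar>} + prob {w \<in> space M. c / 2 < \<bar>?S w\<bar>}"
      using le by (intro tail_add) auto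
    also have "prob {w \<in> space M. c / 2 < \<bar>deviation k m w\<bar>} \<le> prob {w \<in> space M. c / 2 \<le> deviation k m w}"
      using deviation_nonneg[OF k] by (intro finite_measure_mono) auto
    also have "\<dots> \<le> expectation (deviation k m) / (c / 2)"
      using deviation_nonneg[OF k] deviation_integrable[OF k] c
      by (intro integral_Markov_inequality_measure[where A = "space M"]) auto
    also have "prob {w \<in> space M. c / 2 < \<bar>?S w\<bar>} \<le> ?T m"
      using c by (intro step_difference K) auto
    finally show ?thesis by simp
  qed
  moreover have "(\<lambda>m. expectation (deviation k m) / (c / 2) + ?T m) \<longlonglongrightarrow>
      0 / (c / 2) + (2 * area * \<kappa> (2 / K) + 4 * trunc_const area K / (c / 2) * (2 * (0 + mean_gap n)))"
    using c by (intro tendsto_intros mean_deviation_tendsto_0[OF k] mean_gap_tendsto_0) auto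
  ultimately have "prob {w \<in> space M. c < deviation k n w}
    \<le> 0 / (c / 2) + (2 * area * \<kappa> (2 / K) + 4 * trunc_const area K / (c / 2) * (2 * (0 + mean_gap n)))"
    by (intro LIMSEQ_le_const) auto
  then show ?thesis by simp
qed

definition total_deviation :: "nat \<Rightarrow> 'w \<Rightarrow> ennreal" where
  "total_deviation n w = (\<integral>\<^sup>+x. ennreal \<bar>Y x w - Y (\<tau> n x) w\<bar> \<partial>\<mu>)"

lemma total_deviation_measurable [measurable]: "total_deviation n \<in> borel_measurable M"
proof -
  have [measurable]: "(\<lambda>(w, x). ennreal \<bar>Y x w - Y (\<tau> n x) w\<bar>) \<in> borel_measurable (M \<Otimes>\<^sub>M \<mu>)" by measurable
  show ?thesis unfolding total_deviation_def[abs_def] by measurable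
qed

lemma total_deviation_eq_SUP:
  assumes w: "w \<in> space M"
  shows "total_deviation n w = (SUP k::nat. ennreal (deviation (real k) n w))"
proof -
  have "ennreal (deviation (real k) n w) = (\<integral>\<^sup>+x. ennreal (min (real k) \<bar>Y x w - Y (\<tau> n x) w\<bar>) \<partial>\<mu>)" for k :: nat
    unfolding deviation_def using w
    by (intro nn_integral_eq_integral[symmetric] \<mu>.integrable_const_bound[where B = "real k"]) auto
  moreover have "(\<integral>\<^sup>+x. (SUP k::nat. ennreal (min (real k) \<bar>Y x w - Y (\<tau> n x) w\<bar>)) \<partial>\<mu>)
      = (SUP k::nat. \<integral>\<^sup>+x. ennreal (min (real k) \<bar>Y x w - Y (\<tau> n x) w\<bar>) \<partial>\<mu>)"
    using w by (intro nn_integral_monotone_convergence_SUP)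
      (auto simp: incseq_def le_fun_def intro!: ennreal_leI)
  moreover have "(SUP k::nat. ennreal (min (real k) \<bar>y\<bar>)) = ennreal \<bar>y\<bar>" for y :: real
  proof (rule antisym)
    obtain k :: nat where "\<bar>y\<bar> \<le> real k" using real_arch_simple by blast
    then have "ennreal \<bar>y\<bar> = ennreal (min (real k) \<bar>y\<bar>)" by simp
    also have "\<dots> \<le> (SUP k::nat. ennreal (min (real k) \<bar>y\<bar>))" by (rule SUP_upper) simp
    finally show "ennreal \<bar>y\<bar> \<le> (SUP k::nat. ennreal (min (real k) \<bar>y\<bar>))" .
  qed (auto intro!: SUP_least ennreal_leI)
  ultimately show ?thesis by (simp add: total_deviation_def)
qed

lemma total_deviation_tail:
  assumes K: "K > 0" and c: "c > 0"
  shows "prob {w \<in> space M. ennreal c < total_deviation n w}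
    \<le> 2 * area * \<kappa> (2 / K) + 16 * trunc_const area K / c * mean_gap n"
proof -
  define A where "A k = {w \<in> space M. c < deviation (real k) n w}" for k :: nat
  have "incseq A"
  proof (rule incseq_SucI)
    fix k
    show "A k \<subseteq> A (Suc k)"
    proof
      fix w assume w: "w \<in> A k"
      have "deviation (real k) n w \<le> deviation (real (Suc k)) n w"
        unfolding deviation_def using w
        by (intro integral_mono \<mu>.integrable_const_bound[where B = "real k"]
              \<mu>.integrable_const_bound[where B = "real (Suc k)"]) (auto simp: A_def)
      then show "w \<in> A (Suc k)" using w by (auto simp: A_def)
    qed
  qed
  moreover have "range A \<subseteq> events" by (auto simp: A_def)
  ultimately have "(\<lambda>k. prob (A k)) \<longlonglongrightarrow> prob (\<Union>k. A k)"
    by (intro finite_Lim_measure_incseq)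
  moreover have "(\<Union>k. A k) = {w \<in> space M. ennreal c < total_deviation n w}"
    using c deviation_nonneg
    by (auto simp: A_def total_deviation_eq_SUP less_SUP_iff ennreal_less_iff)
  moreover have "prob (A k) \<le> 2 * area * \<kappa> (2 / K) + 16 * trunc_const area K / c * mean_gap n" for k
    unfolding A_def by (rule deviation_tail[OF _ K c]) simp
  ultimately show ?thesis by (auto intro: LIMSEQ_le_const2)
qed

lemma modulus_at_infinity: "((\<lambda>K. 2 * area * \<kappa> (2 / K)) \<longlongrightarrow> 0) at_top"
proof -
  have "((\<lambda>K::real. 2 / K) \<longlongrightarrow> 0) at_top" by real_asymp
  from tendsto_mult_right_zero[OF modulus_tendsto[OF this], of "2 * area"] show ?thesis .
qed

lemma small_modulus:
  assumes "e > 0"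
  obtains K where "K > 0" "2 * area * \<kappa> (2 / K) < e"
proof -
  have "\<forall>\<^sub>F K in at_top. 2 * area * \<kappa> (2 / K) < e"
    using order_tendstoD(2)[OF modulus_at_infinity assms] .
  then have "\<forall>\<^sub>F K in at_top. K > 0 \<and> 2 * area * \<kappa> (2 / K) < e"
    using eventually_gt_at_top[of 0] by eventually_elim auto
  then obtain K where "K > 0" "2 * area * \<kappa> (2 / K) < e" by (auto dest: eventually_happens)
  then show ?thesis by (rule that)
qed

text \<open>In the bound for the tail above \<open>c\<close>, first \<open>c\<close> and then \<open>K\<close> tends to infinity.\<close>

lemma total_deviation_finite: "AE w in M. total_deviation n w < \<infinity>"
proof -
  let ?A = "{w \<in> space M. total_deviation n w = \<infinity>}"
  have "prob ?A \<le> 0"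
  proof (rule field_le_epsilon)
    fix e :: real assume e: "e > 0"
    obtain K where K: "K > 0" "2 * area * \<kappa> (2 / K) < e" using small_modulus[OF e] .
    have "prob ?A \<le> 2 * area * \<kappa> (2 / K) + 16 * trunc_const area K / c * mean_gap n" if "c > 0" for c
    proof -
      have "prob ?A \<le> prob {w \<in> space M. ennreal c < total_deviation n w}"
        by (intro finite_measure_mono) auto
      with total_deviation_tail[OF K(1) that, of n] show ?thesis by simp
    qed
    then have "\<forall>\<^sub>F c in at_top. prob ?A \<le> 2 * area * \<kappa> (2 / K) + 16 * trunc_const area K / c * mean_gap n"
      using eventually_gt_at_top[of 0] by (rule eventually_mono[rotated])
    moreover have "((\<lambda>c. x + y / c * z) \<longlongrightarrow> x) at_top" for x y z :: real
      by real_asymp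
    ultimately have "prob ?A \<le> 2 * area * \<kappa> (2 / K)"
      by (intro tendsto_lowerbound) auto
    then show "prob ?A \<le> 0 + e" using K by simp
  qed
  then have "prob ?A = 0" by (simp add: measure_le_0_iff)
  then have "AE w in M. \<not> total_deviation n w = \<infinity>"
    by (subst (asm) prob_eq_0) auto
  then show ?thesis by eventually_elim (simp add: less_top)
qed

theorem integrable_AE: "AE w in M. integrable \<mu> (\<lambda>x. Y x w)"
  using total_deviation_finite[of 0] AE_space
proof eventually_elim
  case (elim w)
  then have [measurable]: "(\<lambda>x. Y x w) \<in> borel_measurable \<mu>" by simp
  have "integrable \<mu> (\<lambda>x. Y x w - Y (\<tau> 0 x) w)"
    using elim(1) by (simp add: integrable_iff_bounded total_deviation_def)
  moreover have "integrable \<mu> (\<lambda>x. Y (\<tau> 0 x) w)"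
    using \<mu>.integrable_simple_compose[OF \<tau>_simple[of 0], of "\<lambda>x. Y x w"] .
  ultimately have "integrable \<mu> (\<lambda>x. (Y x w - Y (\<tau> 0 x) w) + Y (\<tau> 0 x) w)"
    by (rule Bochner_Integration.integrable_add)
  then show ?case by simp
qed

lemma step_integral:
  "has_levy_integral M \<Lambda> UNIV (\<lambda>q. \<integral>x. g (\<tau> n x) q \<partial>\<mu>) (\<lambda>w. \<integral>x. Y (\<tau> n x) w \<partial>\<mu>)"
proof -
  have sums: "has_levy_integral M \<Lambda> UNIV (\<lambda>q. \<Sum>a\<in>W. v a * g a q) (\<lambda>w. \<Sum>a\<in>W. v a * Y a w)"
    if "finite W" "W \<subseteq> space \<mu>" for W v
    using that
  proof (induction W)
    case empty
    have "tendsto_in_prob M (\<lambda>n. simple_levy_integral \<Lambda> A (\<lambda>q. 0)) (\<lambda>w. 0) sequentially" for A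
      unfolding simple_levy_integral_def[abs_def] by (simp add: tendsto_in_prob_const image_constant_conv)
    then show ?case
      by (intro has_levy_integral_UNIV_I[where s = "\<lambda>_ _. 0"]) (auto simp: simple_integrand_def)
  next
    case (insert a W)
    then show ?case by (auto intro!: has_levy_integral_add has_levy_integral_cmult Y_integral)
  qed
  have "finite (\<tau> n ` space \<mu>)" "\<tau> n ` space \<mu> \<subseteq> space \<mu>"
    using simple_functionD(1)[OF \<tau>_simple] \<tau>_space by auto
  then have "has_levy_integral M \<Lambda> UNIV
      (\<lambda>q. \<Sum>a\<in>\<tau> n ` space \<mu>. measure \<mu> (\<tau> n -` {a} \<inter> space \<mu>) * g a q)
      (\<lambda>w. \<Sum>a\<in>\<tau> n ` space \<mu>. measure \<mu> (\<tau> n -` {a} \<inter> space \<mu>) * Y a w)"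
    by (rule sums)
  moreover have "(\<integral>x. g (\<tau> n x) q \<partial>\<mu>) = (\<Sum>a\<in>\<tau> n ` space \<mu>. measure \<mu> (\<tau> n -` {a} \<inter> space \<mu>) * g a q)" for q
    by (rule \<mu>.integral_simple_compose[OF \<tau>_simple])
  moreover have "(\<integral>x. Y (\<tau> n x) w \<partial>\<mu>) = (\<Sum>a\<in>\<tau> n ` space \<mu>. measure \<mu> (\<tau> n -` {a} \<inter> space \<mu>) * Y a w)" for w
    by (rule \<mu>.integral_simple_compose[OF \<tau>_simple])
  ultimately show ?thesis by simp
qed

lemma integral_bound:
  assumes "\<And>x. x \<in> space \<mu> \<Longrightarrow> \<sigma> x \<in> space \<mu>"
  shows "\<bar>\<integral>x. g (\<sigma> x) q \<partial>\<mu>\<bar> \<le> (\<bar>C\<bar> * measure \<mu> (space \<mu>)) * indicator B q"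
proof -
  have "\<bar>\<integral>x. g (\<sigma> x) q \<partial>\<mu>\<bar> \<le> (\<integral>x. \<bar>C\<bar> * indicator B q \<partial>\<mu>)"
  proof (rule order_trans[OF integral_abs_bound])
    show "(\<integral>x. \<bar>g (\<sigma> x) q\<bar> \<partial>\<mu>) \<le> (\<integral>x. \<bar>C\<bar> * indicator B q \<partial>\<mu>)"
    proof (rule integral_mono_AE')
      show "AE x in \<mu>. \<bar>g (\<sigma> x) q\<bar> \<le> \<bar>C\<bar> * indicator B q"
      proof (intro AE_I2)
        fix x assume "x \<in> space \<mu>"
        then have "\<bar>g (\<sigma> x) q\<bar> \<le> C * indicator B q" by (intro g_bound assms)
        also have "\<dots> \<le> \<bar>C\<bar> * indicator B q" by (auto split: split_indicator)
        finally show "\<bar>g (\<sigma> x) q\<bar> \<le> \<bar>C\<bar> * indicator B q" .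
      qed
    qed auto
  qed
  then show ?thesis by (simp add: mult_ac)
qed

text \<open>For the discretised parameter this is linearity. Both sides converge: the integrals over the
  parameter because the paths are close in \<open>L\<^sup>1\<close>, and the integral of the averaged integrands by
  dominated convergence in the plane.\<close>

theorem integral_of_integrals:
  "has_levy_integral M \<Lambda> UNIV (\<lambda>q. \<integral>x. g x q \<partial>\<mu>) (\<lambda>w. \<integral>x. Y x w \<partial>\<mu>)"
proof -
  let ?h = "\<lambda>q. \<integral>x. g x q \<partial>\<mu>" and ?I = "\<lambda>w. \<integral>x. Y x w \<partial>\<mu>" and ?In = "\<lambda>n w. \<integral>x. Y (\<tau> n x) w \<partial>\<mu>"
  interpret P: pair_sigma_finite \<mu> "lborel :: plane measure" ..
  have hm: "?h \<in> borel_measurable borel"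
  proof -
    have "(\<lambda>(q, x). g x q) \<in> borel_measurable (lborel \<Otimes>\<^sub>M \<mu>)" by measurable
    then have "?h \<in> borel_measurable lborel" by (rule \<mu>.borel_measurable_lebesgue_integral)
    then show ?thesis by simp
  qed
  have Im[measurable]: "?I \<in> borel_measurable M"
  proof -
    have [measurable]: "(\<lambda>(w, x). Y x w) \<in> borel_measurable (M \<Otimes>\<^sub>M \<mu>)" by measurable
    show ?thesis by measurable
  qed
  obtain Z where Z: "has_levy_integral M \<Lambda> UNIV ?h Z"
    using has_levy_integral_exists[OF hm B] integral_bound[of "\<lambda>x. x"] by blast
  have "{z \<in> space (\<mu> \<Otimes>\<^sub>M (lborel :: plane measure)). (\<lambda>n. g (\<tau> n (fst z)) (snd z)) \<longlonglongrightarrow> g (fst z) (snd z)} \<in> sets (\<mu> \<Otimes>\<^sub>M lborel)"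
    by measurable
  then have "AE q in lborel. AE x in \<mu>. (\<lambda>n. g (\<tau> n x) q) \<longlonglongrightarrow> g x q"
    using g_lim by (subst P.AE_commute[symmetric]) auto
  then have "AE q in lborel. (\<lambda>n. \<integral>x. g (\<tau> n x) q \<partial>\<mu>) \<longlonglongrightarrow> ?h q"
  proof eventually_elim
    case (elim q)
    show ?case
    proof (rule integral_dominated_convergence[where w = "\<lambda>_. C * indicator B q", OF _ _ _ elim])
      show "AE x in \<mu>. norm (g (\<tau> n x) q) \<le> C * indicator B q" for n
        using g_bound \<tau>_space by auto
    qed auto
  qed
  then have lim1: "tendsto_in_prob M ?In Z sequentially"
    using \<tau>_space
    by (intro levy_integral_dominated_convergence[OF step_integral Z B integral_bound integral_bound]) auto
  have "tendsto_in_prob M ?In ?I sequentially"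
    unfolding tendsto_in_prob_def
  proof (intro conjI allI impI Im always_eventually)
    show "?In n \<in> borel_measurable M" for n using has_levy_integral_measurable(2)[OF step_integral] .
    fix c :: real assume c: "c > 0"
    show "(\<lambda>n. prob {w \<in> space M. c < \<bar>?In n w - ?I w\<bar>}) \<longlonglongrightarrow> 0"
    proof (rule LIMSEQ_I)
      fix e :: real assume e: "e > 0"
      obtain K where K: "K > 0" "2 * area * \<kappa> (2 / K) < e" using small_modulus[OF e] .
      have "(\<lambda>n. 2 * area * \<kappa> (2 / K) + 16 * trunc_const area K / c * mean_gap n)
          \<longlonglongrightarrow> 2 * area * \<kappa> (2 / K) + 16 * trunc_const area K / c * 0"
        by (intro tendsto_intros mean_gap_tendsto_0)
      then have "\<forall>\<^sub>F n in sequentially. 2 * area * \<kappa> (2 / K) + 16 * trunc_const area K / c * mean_gap n < e"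
        using K by (intro order_tendstoD) auto
      moreover have "prob {w \<in> space M. c < \<bar>?In n w - ?I w\<bar>}
          \<le> 2 * area * \<kappa> (2 / K) + 16 * trunc_const area K / c * mean_gap n" for n
      proof -
        have "prob {w \<in> space M. c < \<bar>?In n w - ?I w\<bar>} \<le> prob {w \<in> space M. ennreal c < total_deviation n w}"
        proof (rule finite_measure_mono_AE)
          show "AE w in M. w \<in> {w \<in> space M. c < \<bar>?In n w - ?I w\<bar>} \<longrightarrow> w \<in> {w \<in> space M. ennreal c < total_deviation n w}"
            using integrable_AE AE_space
          proof eventually_elim
            case (elim w)
            have i: "integrable \<mu> (\<lambda>x. Y (\<tau> n x) w)"
              using \<mu>.integrable_simple_compose[OF \<tau>_simple[of n], of "\<lambda>x. Y x w"] .
            have "\<bar>?In n w - ?I w\<bar> = \<bar>\<integral>x. Y x w - Y (\<tau> n x) w \<partial>\<mu>\<bar>"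
              using elim i by (simp add: abs_minus_commute)
            also have "\<dots> \<le> (\<integral>x. \<bar>Y x w - Y (\<tau> n x) w\<bar> \<partial>\<mu>)" by (rule integral_abs_bound)
            finally have "ennreal \<bar>?In n w - ?I w\<bar> \<le> ennreal (\<integral>x. \<bar>Y x w - Y (\<tau> n x) w\<bar> \<partial>\<mu>)"
              by (rule ennreal_leI)
            also have "\<dots> = total_deviation n w"
              unfolding total_deviation_def using elim i
              by (intro nn_integral_eq_integral[symmetric] integrable_abs Bochner_Integration.integrable_diff) auto
            finally have "ennreal \<bar>?In n w - ?I w\<bar> \<le> total_deviation n w" .
            then have "ennreal c < total_deviation n w" if "c < \<bar>?In n w - ?I w\<bar>"
              using less_le_trans[OF ennreal_lessI[OF _ that]] c that by auto
            then show ?case by blast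
          qed
        qed measurable
        with total_deviation_tail[OF K(1) c, of n] show ?thesis by simp
      qed
      ultimately have "\<forall>\<^sub>F n in sequentially. prob {w \<in> space M. c < \<bar>?In n w - ?I w\<bar>} < e"
        by (auto elim!: eventually_mono intro: le_less_trans)
      then show "\<exists>no. \<forall>n\<ge>no. norm (prob {w \<in> space M. c < \<bar>?In n w - ?I w\<bar>} - 0) < e"
        by (auto simp: eventually_sequentially)
    qed
  qed
  from tendsto_in_prob_unique[OF this lim1] have "AE w in M. ?I w = Z w" by simp
  from has_levy_integral_cong_AE[OF Z Im this] show ?thesis .
qed

end

section \<open>Tubes around rectifiable boundaries\<close>

text \<open>An upper bound on the Minkowski content, as a quantitative form of having finite length.\<close>

definition linear_tubes :: "plane set \<Rightarrow> bool" where
  "linear_tubes N \<longleftrightarrow> (\<exists>c. \<forall>r. 0 < r \<longrightarrow> r \<le> 1 \<longrightarrow>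
     (\<exists>A\<in>finite_area_sets. (\<Union>z\<in>N. cball z r) \<subseteq> A \<and> measure lborel A \<le> c * r))"

lemma linear_tubes_subset: "linear_tubes N \<Longrightarrow> N' \<subseteq> N \<Longrightarrow> linear_tubes N'"
proof -
  assume N: "linear_tubes N" and sub: "N' \<subseteq> N"
  obtain c where c: "\<And>r. 0 < r \<Longrightarrow> r \<le> 1 \<Longrightarrow>
     (\<exists>A\<in>finite_area_sets. (\<Union>z\<in>N. cball z r) \<subseteq> A \<and> measure lborel A \<le> c * r)"
    using N unfolding linear_tubes_def by blast
  have "(\<Union>z\<in>N'. cball z r) \<subseteq> (\<Union>z\<in>N. cball z r)" for r using sub by (rule UN_mono) simp
  then have "\<exists>A\<in>finite_area_sets. (\<Union>z\<in>N'. cball z r) \<subseteq> A \<and> measure lborel A \<le> c * r" if "0 < r" "r \<le> 1" for r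
    using c[OF that] subset_trans by metis
  then show "linear_tubes N'" unfolding linear_tubes_def by (intro exI[of _ c]) simp
qed

lemma linear_tubes_UN:
  assumes "finite I" "\<And>i. i \<in> I \<Longrightarrow> linear_tubes (N i)"
  shows "linear_tubes (\<Union>i\<in>I. N i)"
proof -
  have "\<forall>i\<in>I. \<exists>c. \<forall>r. 0 < r \<longrightarrow> r \<le> 1 \<longrightarrow>
     (\<exists>A\<in>finite_area_sets. (\<Union>z\<in>N i. cball z r) \<subseteq> A \<and> measure lborel A \<le> c * r)"
    using assms(2) unfolding linear_tubes_def by blast
  from bchoice[OF this] obtain c where c: "\<And>i r. i \<in> I \<Longrightarrow> 0 < r \<Longrightarrow> r \<le> 1 \<Longrightarrow>
     (\<exists>A\<in>finite_area_sets. (\<Union>z\<in>N i. cball z r) \<subseteq> A \<and> measure lborel A \<le> c i * r)"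
    by blast
  show ?thesis
    unfolding linear_tubes_def
  proof (intro exI[of _ "\<Sum>i\<in>I. c i"] allI impI)
    fix r :: real assume r: "0 < r" "r \<le> 1"
    have "\<forall>i\<in>I. \<exists>A. A \<in> finite_area_sets \<and> (\<Union>z\<in>N i. cball z r) \<subseteq> A \<and> measure lborel A \<le> c i * r"
      using c[OF _ r] by blast
    from bchoice[OF this] obtain A where A: "\<And>i. i \<in> I \<Longrightarrow> A i \<in> finite_area_sets"
      "\<And>i. i \<in> I \<Longrightarrow> (\<Union>z\<in>N i. cball z r) \<subseteq> A i" "\<And>i. i \<in> I \<Longrightarrow> measure lborel (A i) \<le> c i * r"
      by blast
    have "measure lborel (\<Union>i\<in>I. A i) \<le> (\<Sum>i\<in>I. measure lborel (A i))"
      using assms(1) finite_area_setsD(1)[OF A(1)] by (intro measure_UNION_le) auto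
    also have "\<dots> \<le> (\<Sum>i\<in>I. c i) * r"
      using A(3) by (simp add: sum_distrib_right sum_mono)
    finally have "measure lborel (\<Union>i\<in>I. A i) \<le> (\<Sum>i\<in>I. c i) * r" .
    moreover have "(\<Union>z\<in>\<Union>i\<in>I. N i. cball z r) \<subseteq> (\<Union>i\<in>I. A i)"
    proof
      fix x assume "x \<in> (\<Union>z\<in>\<Union>i\<in>I. N i. cball z r)"
      then obtain i z where "i \<in> I" "z \<in> N i" "x \<in> cball z r" by blast
      then show "x \<in> (\<Union>i\<in>I. A i)" using A(2)[of i] by blast
    qed
    moreover have "(\<Union>i\<in>I. A i) \<in> finite_area_sets" by (rule finite_area_sets_UN[OF assms(1) A(1)])
    ultimately show "\<exists>A\<in>finite_area_sets. (\<Union>z\<in>\<Union>i\<in>I. N i. cball z r) \<subseteq> A \<and> measure lborel A \<le> (\<Sum>i\<in>I. c i) * r"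
      by blast
  qed
qed

lemma cball_area_le:
  fixes a :: plane
  assumes "\<rho> \<ge> 0"
  shows "measure lborel (cball a \<rho>) \<le> 4 * \<rho>\<^sup>2"
proof -
  have sub: "cball a \<rho> \<subseteq> cbox (fst a - \<rho>, snd a - \<rho>) (fst a + \<rho>, snd a + \<rho>)"
  proof
    fix x assume "x \<in> cball a \<rho>"
    then have "norm (a - x) \<le> \<rho>" by (simp add: dist_norm)
    moreover have "(fst a - fst x, snd a - snd x) = a - x" by (simp add: prod_eq_iff)
    ultimately have nm: "norm (fst a - fst x, snd a - snd x) \<le> \<rho>" by simp
    have "\<bar>fst a - fst x\<bar> \<le> \<rho>"
      using order_trans[OF norm_fst_le nm] by simp
    moreover have "\<bar>snd a - snd x\<bar> \<le> \<rho>"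
      using order_trans[OF norm_snd_le nm] by simp
    ultimately have "\<bar>fst a - fst x\<bar> \<le> \<rho>" "\<bar>snd a - snd x\<bar> \<le> \<rho>" .
    then show "x \<in> cbox (fst a - \<rho>, snd a - \<rho>) (fst a + \<rho>, snd a + \<rho>)"
      by (cases x) (auto simp: cbox_Pair_eq abs_le_iff)
  qed
  have "measure lborel (cball a \<rho>) \<le> measure lborel (cbox (fst a - \<rho>, snd a - \<rho>) (fst a + \<rho>, snd a + \<rho>))"
  proof (intro measure_mono_fmeasurable sub)
    have "emeasure lborel (cbox u v) < \<infinity>" for u v :: plane by (rule emeasure_lborel_cbox_finite)
    then show "cbox (fst a - \<rho>, snd a - \<rho>) (fst a + \<rho>, snd a + \<rho>) \<in> fmeasurable lborel"
      unfolding fmeasurable_def by simp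
  qed simp
  also have "\<dots> = (2 * \<rho>) * (2 * \<rho>)"
    using assms by (subst content_Pair) simp
  finally show "measure lborel (cball a \<rho>) \<le> 4 * \<rho>\<^sup>2" by (simp add: power2_eq_square)
qed

text \<open>A curve of Lipschitz constant \<open>L\<close> stays within distance \<open>L r\<close> of about \<open>1 / r\<close> of its points, so
  its \<open>r\<close>-tube is covered by \<open>1 / r\<close> discs of radius proportional to \<open>r\<close>.\<close>

lemma linear_tubes_lipschitz_image:
  fixes g :: "real \<Rightarrow> plane"
  assumes g: "L-lipschitz_on {0..1} g"
  shows "linear_tubes (g ` {0..1})"
  unfolding linear_tubes_def
proof (intro exI[of _ "12 * (L + 1)\<^sup>2"] allI impI)
  have L: "L \<ge> 0" using lipschitz_on_nonneg[OF g] .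
  fix r :: real assume r: "0 < r" "r \<le> 1"
  define n where "n = nat \<lceil>1 / r\<rceil>"
  have n: "1 / r \<le> real n" "real n \<le> 1 / r + 1" "n > 0"
    using r real_nat_ceiling_ge[of "1 / r"] ceiling_correct[of "1 / r"] unfolding n_def by auto
  define A where "A = (\<Union>k\<in>{..n}. cball (g (real k / real n)) ((L + 1) * r))"
  have "A \<in> finite_area_sets"
    unfolding A_def by (intro finite_area_sets_UN finite_area_cball) auto
  moreover have "(\<Union>z\<in>g ` {0..1}. cball z r) \<subseteq> A"
  proof
    fix x assume "x \<in> (\<Union>z\<in>g ` {0..1}. cball z r)"
    then obtain t where t: "t \<in> {0..1}" and ab: "x \<in> cball (g t) r" by blast
    define k where "k = nat \<lfloor>t * n\<rfloor>"
    have lo: "real k \<le> t * real n" and up: "t * real n \<le> real k + 1"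
      using t of_int_floor_le[of "t * n"] floor_correct[of "t * n"] unfolding k_def by auto
    have "t * real n \<le> 1 * real n" using t by (intro mult_right_mono) auto
    with lo have "real k \<le> real n" by linarith
    moreover have "t \<le> (real k + 1) / n" using up n(3) by (simp add: pos_le_divide_eq)
    moreover have "real k / n \<le> t" using lo n(3) by (simp add: pos_divide_le_eq)
    ultimately have k: "k \<le> n" "real k / n \<le> t" "t - real k / n \<le> 1 / n"
      by (simp_all add: add_divide_distrib)
    have "dist (g t) (g (real k / n)) \<le> L * dist t (real k / n)"
      using t k n by (intro lipschitz_onD[OF g]) (auto simp: field_simps)
    also have "dist t (real k / n) \<le> 1 / n" using k by (simp add: dist_real_def)
    also have "1 / real n \<le> r" using n r by (simp add: field_simps)
    finally have "dist (g t) (g (real k / n)) \<le> L * r" using L by (simp add: mult_left_mono)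
    then have "dist (g (real k / n)) x \<le> (L + 1) * r"
      using ab dist_triangle[of "g (real k / n)" "x" "g t"]
      by (simp add: dist_commute distrib_right)
    then show "x \<in> A" using k(1) by (auto simp: A_def)
  qed
  moreover have "measure lborel A \<le> 12 * (L + 1)\<^sup>2 * r"
  proof -
    \<comment> \<open>There are \<open>n + 1 \<le> 3 / r\<close> discs, each contained in a square of side \<open>2 (L + 1) r\<close>.\<close>
    have "measure lborel A \<le> (\<Sum>k\<in>{..n}. measure lborel (cball (g (real k / real n)) ((L + 1) * r)))"
      unfolding A_def by (intro measure_UNION_le) auto
    also have "\<dots> \<le> (\<Sum>k\<in>{..n}. 4 * ((L + 1) * r)\<^sup>2)"
      using L r by (intro sum_mono cball_area_le) auto
    also have "\<dots> = (real n + 1) * r * (4 * (L + 1)\<^sup>2 * r)"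
      by (simp add: power2_eq_square algebra_simps)
    also have "\<dots> \<le> 3 * (4 * (L + 1)\<^sup>2 * r)"
    proof (rule mult_right_mono)
      have "(real n + 1) * r \<le> (1 / r + 2) * r" using n r by (intro mult_right_mono) auto
      also have "\<dots> \<le> 3" using r by (simp add: distrib_right)
      finally show "(real n + 1) * r \<le> 3" .
    qed (use r in auto)
    finally show ?thesis by simp
  qed
  ultimately show "\<exists>A\<in>finite_area_sets. (\<Union>z\<in>g ` {0..1}. cball z r) \<subseteq> A \<and> measure lborel A \<le> 12 * (L + 1)\<^sup>2 * r"
    by blast
qed

lemma linear_tubes_null:
  assumes "linear_tubes N"
  shows "AE x in lborel. x \<notin> N"
proof -
  obtain c where c: "\<And>r. 0 < r \<Longrightarrow> r \<le> 1 \<Longrightarrow>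
     (\<exists>A\<in>finite_area_sets. (\<Union>z\<in>N. cball z r) \<subseteq> A \<and> measure lborel A \<le> c * r)"
    using assms by (auto simp: linear_tubes_def)
  have "\<exists>A. A \<in> finite_area_sets \<and> N \<subseteq> A \<and> measure lborel A \<le> c * (1 / real (Suc n))" for n
  proof -
    obtain A where "A \<in> finite_area_sets" "(\<Union>z\<in>N. cball z (1 / real (Suc n))) \<subseteq> A"
      "measure lborel A \<le> c * (1 / real (Suc n))"
      using c[of "1 / real (Suc n)"] by auto
    moreover have "N \<subseteq> (\<Union>z\<in>N. cball z (1 / real (Suc n)))" by auto
    ultimately show ?thesis by blast
  qed
  then obtain A where A: "\<And>n. A n \<in> finite_area_sets" "\<And>n. N \<subseteq> A n"
    "\<And>n. measure lborel (A n) \<le> c * (1 / real (Suc n))" by metis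
  define A' where "A' = (\<Inter>n. A n)"
  have A'm: "A' \<in> sets lborel" using finite_area_setsD(1)[OF A(1)] by (auto simp: A'_def)
  have "measure lborel A' \<le> 0"
  proof (rule LIMSEQ_le_const)
    show "(\<lambda>n. c * (1 / real (Suc n))) \<longlonglongrightarrow> 0" by real_asymp
    have "measure lborel A' \<le> measure lborel (A n)" for n
      using A'm finite_area_setsD(3)[OF A(1)] by (intro measure_mono_fmeasurable) (auto simp: A'_def)
    then show "\<exists>N. \<forall>n\<ge>N. measure lborel A' \<le> c * (1 / real (Suc n))" using A(3) order_trans by blast
  qed
  moreover have "emeasure lborel A' < \<infinity>"
    using finite_area_setsD(2)[OF finite_area_sets_subset[OF A(1)[of 0], of A']] A'm by (auto simp: A'_def)
  ultimately have "A' \<in> null_sets lborel"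
    using A'm by (auto simp: null_sets_def emeasure_eq_ennreal_measure less_top[symmetric] measure_le_0_iff)
  then have "AE x in lborel. x \<notin> A'" by (rule AE_not_in)
  then show ?thesis by eventually_elim (use A(2) in \<open>auto simp: A'_def\<close>)
qed

section \<open>Circle averages of a field cut off at a boundary\<close>

definition angle :: "real measure" where
  "angle = restrict_space lborel {0..2 * pi}"

lemma finite_measure_angle: "finite_measure angle"
  using pi_ge_zero by (intro finite_measureI) (simp add: angle_def space_restrict_space emeasure_restrict_space)

interpretation angle: finite_measure angle by (rule finite_measure_angle)

lemma space_angle: "space angle = {0..2 * pi}"
  by (simp add: angle_def space_restrict_space)

lemma measure_angle: "measure angle (space angle) = 2 * pi"
  using pi_ge_zero by (simp add: angle_def measure_restrict_space space_restrict_space)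

lemma integral_angle: "(\<integral>\<theta>. f \<theta> \<partial>angle) = (LBINT \<theta>:{0..2 * pi}. f \<theta>)"
  for f :: "real \<Rightarrow> 'a :: {banach, second_countable_topology}"
  unfolding angle_def set_lebesgue_integral_def by (subst integral_restrict_space) auto

lemma measurable_angle: "f \<in> borel_measurable borel \<Longrightarrow> f \<in> borel_measurable angle"
  unfolding angle_def by (rule measurable_restrict_space1) simp

lemma integral_angle_FTC:
  assumes "\<And>\<theta>. (P has_real_derivative f \<theta>) (at \<theta>)" "\<And>\<theta>. isCont f \<theta>"
  shows "(\<integral>\<theta>. f \<theta> \<partial>angle) = P (2 * pi) - P 0"
proof -
  have "has_bochner_integral lborel (\<lambda>x. f x * indicator {0..2 * pi} x) (P (2 * pi) - P 0)"
    using assms pi_ge_zero by (intro has_bochner_integral_FTC_Icc_real) auto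
  then show ?thesis unfolding angle_def
    by (subst integral_restrict_space) (auto simp: has_bochner_integral_iff mult.commute)
qed

lemma norm_unit_dir [simp]: "norm (unit_dir \<theta>) = 1"
  by (simp add: unit_dir_def norm_Pair)

lemma norm_perp [simp]: "norm (perp x) = norm x"
  by (simp add: perp_def norm_prod_def add.commute)

lemma continuous_unit_dir: "continuous_on UNIV unit_dir"
  unfolding unit_dir_def by (intro continuous_intros)

lemma unit_dir_measurable [measurable]: "unit_dir \<in> borel_measurable borel"
  by (rule borel_measurable_continuous_onI[OF continuous_unit_dir])

lemma continuous_perp: "continuous_on UNIV perp"
  unfolding perp_def[abs_def] by (intro continuous_intros)

text \<open>The direction field \<open>e\<close> on the circle is the unit tangent for circulations and the unit normal
  for fluxes. What enters below is that it is bounded and has mean zero.\<close>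

locale cut_off_field =
  fixes S :: "plane set" and F :: "plane \<Rightarrow> plane" and D :: "plane \<Rightarrow> plane \<Rightarrow>\<^sub>L plane"
    and K m \<rho> :: real and e :: "real \<Rightarrow> plane"
  assumes S_sets [measurable]: "S \<in> sets borel" and S_sub: "S \<subseteq> cball 0 \<rho>"
    and F_measurable [measurable]: "F \<in> borel_measurable borel"
    and derivative: "\<And>x. x \<in> closure S \<Longrightarrow> (F has_derivative blinfun_apply (D x)) (at x within closure S)"
    and K: "\<And>x. x \<in> closure S \<Longrightarrow> norm (D x) \<le> K" "K \<ge> 0"
    and m: "\<And>x. x \<in> closure S \<Longrightarrow> norm (F x) \<le> m" "m \<ge> 0"
    and e_measurable [measurable]: "e \<in> borel_measurable borel"
    and e_bound: "\<And>\<theta>. norm (e \<theta>) \<le> 1"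
    and e_mean: "\<And>v. (\<integral>\<theta>. v \<bullet> e \<theta> \<partial>angle) = 0"
begin

definition G :: "plane \<Rightarrow> plane" where
  "G x = indicator S x *\<^sub>R F x"

text \<open>The circulation, or flux, of the cut-off field divided by the area of the disc.\<close>

definition avg :: "real \<Rightarrow> plane \<Rightarrow> real" where
  "avg r x = (\<integral>\<theta>. G (x + r *\<^sub>R unit_dir \<theta>) \<bullet> e \<theta> \<partial>angle) / (pi * r)"

definition avg_limit :: "plane \<Rightarrow> real" where
  "avg_limit x = (\<integral>\<theta>. D x (unit_dir \<theta>) \<bullet> e \<theta> \<partial>angle) / pi"

lemma G_measurable [measurable]: "G \<in> borel_measurable borel"
  unfolding G_def[abs_def] by measurable

lemma G_le: "norm (G x) \<le> m"
proof (cases "x \<in> S")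
  case True
  then show ?thesis using m(1)[of x] closure_subset[of S] by (auto simp: G_def)
qed (simp add: G_def m)

lemma G_le_cball: "\<bar>G x \<bullet> e \<theta>\<bar> \<le> m * indicator (cball 0 \<rho>) x"
proof -
  have "\<bar>G x \<bullet> e \<theta>\<bar> \<le> norm (G x) * norm (e \<theta>)" by (rule Cauchy_Schwarz_ineq2)
  also have "\<dots> \<le> norm (G x) * 1" by (intro mult_left_mono e_bound) simp
  also have "\<dots> \<le> m * indicator (cball 0 \<rho>) x"
    using G_le[of x] S_sub by (auto simp: G_def split: split_indicator split_indicator_asm)
  finally show ?thesis .
qed

lemma inner_integral_le:
  assumes "\<And>\<theta>. norm (f \<theta>) \<le> c"
  shows "\<bar>\<integral>\<theta>. f \<theta> \<bullet> e \<theta> \<partial>angle\<bar> \<le> 2 * pi * c"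
proof -
  have c: "0 \<le> c" using assms[of 0] norm_ge_zero order_trans by blast
  have "\<bar>\<integral>\<theta>. f \<theta> \<bullet> e \<theta> \<partial>angle\<bar> \<le> (\<integral>\<theta>. \<bar>f \<theta> \<bullet> e \<theta>\<bar> \<partial>angle)" by (rule integral_abs_bound)
  also have "\<dots> \<le> (\<integral>\<theta>. c \<partial>angle)"
  proof (rule integral_mono_AE')
    have "\<bar>f \<theta> \<bullet> e \<theta>\<bar> \<le> c * 1" for \<theta>
      using c by (intro order_trans[OF Cauchy_Schwarz_ineq2] mult_mono assms e_bound) auto
    then show "AE \<theta> in angle. \<bar>f \<theta> \<bullet> e \<theta>\<bar> \<le> c" by simp
  qed (use c in auto)
  also have "\<dots> = 2 * pi * c" using measure_angle by simp
  finally show ?thesis .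
qed

lemma bounded_inner_integrable:
  assumes "f \<in> borel_measurable borel" "\<And>\<theta>. norm (f \<theta>) \<le> c"
  shows "integrable angle (\<lambda>\<theta>. f \<theta> \<bullet> e \<theta>)"
proof (rule angle.integrable_const_bound[where B = c])
  have "0 \<le> c" using assms(2)[of 0] norm_ge_zero order_trans by blast
  then have "\<bar>f \<theta> \<bullet> e \<theta>\<bar> \<le> c * 1" for \<theta>
    by (intro order_trans[OF Cauchy_Schwarz_ineq2] mult_mono assms e_bound) auto
  then show "AE \<theta> in angle. norm (f \<theta> \<bullet> e \<theta>) \<le> c" by simp
  show "(\<lambda>\<theta>. f \<theta> \<bullet> e \<theta>) \<in> borel_measurable angle"
    by (intro measurable_angle borel_measurable_inner e_measurable assms(1))
qed

text \<open>Constants may be subtracted inside a circle average because \<open>e\<close> has mean zero.\<close>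

lemma integral_shift:
  assumes "r \<ge> 0"
  shows "(\<integral>\<theta>. G (x + r *\<^sub>R unit_dir \<theta>) \<bullet> e \<theta> \<partial>angle) = (\<integral>\<theta>. (G (x + r *\<^sub>R unit_dir \<theta>) - v) \<bullet> e \<theta> \<partial>angle)"
proof -
  have "integrable angle (\<lambda>\<theta>. G (x + r *\<^sub>R unit_dir \<theta>) \<bullet> e \<theta>)" "integrable angle (\<lambda>\<theta>. v \<bullet> e \<theta>)"
    by (rule bounded_inner_integrable[where c = m], measurable, rule G_le)
       (rule bounded_inner_integrable[where c = "norm v"], auto)
  then show ?thesis by (simp add: inner_diff_left e_mean)
qed

lemma avg_le:
  assumes r: "r > 0" and v: "\<And>\<theta>. norm (G (x + r *\<^sub>R unit_dir \<theta>) - v) \<le> c"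
  shows "\<bar>avg r x\<bar> \<le> 2 * c / r"
proof -
  have "\<bar>\<integral>\<theta>. G (x + r *\<^sub>R unit_dir \<theta>) \<bullet> e \<theta> \<partial>angle\<bar> \<le> 2 * pi * c"
    unfolding integral_shift[OF less_imp_le[OF r], of x v] by (rule inner_integral_le[OF v])
  then show ?thesis
    using r by (simp add: avg_def field_simps)
qed

lemma avg_le_coarse: "r > 0 \<Longrightarrow> \<bar>avg r x\<bar> \<le> 2 * m / r"
  using avg_le[of r x 0 m] G_le by simp

lemma avg_limit_le:
  assumes "x \<in> closure S"
  shows "\<bar>avg_limit x\<bar> \<le> 2 * K"
proof -
  have "norm (D x (unit_dir \<theta>)) \<le> K" for \<theta>
    using norm_blinfun[of "D x" "unit_dir \<theta>"] K(1)[OF assms] by simp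
  from inner_integral_le[OF this] show ?thesis by (simp add: avg_limit_def field_simps)
qed

lemma cball_cases:
  assumes "cball x r \<inter> frontier S = {}" "r > 0"
  shows "cball x r \<subseteq> S \<or> cball x r \<inter> S = {}"
  using connected_Int_frontier[of "cball x r" S] assms connected_cball[of x r] by blast

lemma on_circle: "r > 0 \<Longrightarrow> x + r *\<^sub>R unit_dir \<theta> \<in> cball x r"
  by (simp add: dist_norm)

lemma mean_value:
  assumes "cball x r \<subseteq> closure S" "y \<in> cball x r" "z \<in> cball x r"
  shows "norm (F y - F z) \<le> K * norm (y - z)"
proof (rule differentiable_bound[OF convex_cball])
  fix u assume u: "u \<in> cball x r"
  then have uS: "u \<in> closure S" using assms(1) by blast
  show "(F has_derivative blinfun_apply (D u)) (at u within cball x r)"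
    by (rule has_derivative_subset[OF derivative[OF uS] assms(1)])
  show "onorm (blinfun_apply (D u)) \<le> K" using K(1)[OF uS] by (simp add: norm_blinfun.rep_eq)
qed (use assms in auto)

text \<open>A disc that does not meet the boundary lies on one side of it, and inside \<open>S\<close> the mean value
  inequality applies because discs are convex.\<close>

lemma avg_le_away:
  assumes "cball x r \<inter> frontier S = {}" and r: "r > 0"
  shows "\<bar>avg r x\<bar> \<le> 2 * K"
  using cball_cases[OF assms]
proof
  assume sub: "cball x r \<subseteq> S"
  have "norm (G (x + r *\<^sub>R unit_dir \<theta>) - F x) \<le> K * r" for \<theta>
  proof -
    have "norm (F (x + r *\<^sub>R unit_dir \<theta>) - F x) \<le> K * norm (x + r *\<^sub>R unit_dir \<theta> - x)"
      using sub closure_subset[of S] on_circle[OF r] r by (intro mean_value[of x r]) auto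
    moreover have "x + r *\<^sub>R unit_dir \<theta> \<in> S" using sub on_circle[OF r] by blast
    ultimately show ?thesis using r by (simp add: G_def)
  qed
  from avg_le[OF r this] show ?thesis using r by simp
next
  assume dis: "cball x r \<inter> S = {}"
  have "G (x + r *\<^sub>R unit_dir \<theta>) = 0" for \<theta>
    using dis on_circle[OF r, of x \<theta>] by (auto simp: G_def split: split_indicator)
  then show ?thesis using K(2) by (simp add: avg_def)
qed

text \<open>If the field vanishes on the boundary, then the mean value inequality along the segment to
  the nearest boundary point bounds it by the distance to the boundary.\<close>

lemma G_le_infdist:
  assumes F0: "\<And>z. z \<in> frontier S \<Longrightarrow> F z = 0" and ne: "frontier S \<noteq> {}"
  shows "norm (G y) \<le> K * infdist y (frontier S)"
proof (cases "y \<in> S")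
  case True
  obtain z where z: "z \<in> frontier S" "infdist y (frontier S) = dist y z"
    using infdist_attains_inf[OF frontier_closed ne] by metis
  show ?thesis
  proof (cases "dist y z = 0")
    case True
    then show ?thesis using z F0 K(2) by (simp add: G_def split: split_indicator)
  next
    case False
    let ?d = "dist y z"
    have d: "?d > 0" using False zero_le_dist[of y z] by linarith
    have "ball y ?d \<inter> frontier S = {}"
    proof (rule ccontr)
      assume "\<not> ?thesis"
      then obtain u where "u \<in> frontier S" "dist y u < ?d" by auto
      then show False using infdist_le[of u "frontier S" y] z by simp
    qed
    moreover have "ball y ?d \<inter> S \<noteq> {}" using True d centre_in_ball[of y ?d] by blast
    ultimately have "ball y ?d - S = {}"
      using connected_Int_frontier[OF connected_ball, of y ?d S] by blast
    then have "ball y ?d \<subseteq> S" by blast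
    then have "cball y ?d \<subseteq> closure S"
      using closure_mono[of "ball y ?d" S] d by simp
    then have "norm (F y - F z) \<le> K * norm (y - z)" by (intro mean_value[of y ?d]) auto
    then show ?thesis using z F0[OF z(1)] True by (simp add: G_def dist_norm)
  qed
next
  case False
  then show ?thesis using mult_nonneg_nonneg[OF K(2) infdist_nonneg] by (simp add: G_def)
qed

lemma avg_le_vanishing:
  assumes F0: "\<And>z. z \<in> frontier S \<Longrightarrow> F z = 0" and r: "r > 0"
  shows "\<bar>avg r x\<bar> \<le> 4 * K"
proof (cases "cball x r \<inter> frontier S = {}")
  case True
  then show ?thesis using avg_le_away[OF True r] K(2) by simp
next
  case False
  then obtain z where z: "z \<in> frontier S" "dist x z \<le> r" by auto
  have "norm (G (x + r *\<^sub>R unit_dir \<theta>) - 0) \<le> K * (2 * r)" for \<theta>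
  proof -
    have "infdist (x + r *\<^sub>R unit_dir \<theta>) (frontier S) \<le> dist (x + r *\<^sub>R unit_dir \<theta>) z"
      by (rule infdist_le[OF z(1)])
    also have "\<dots> \<le> dist (x + r *\<^sub>R unit_dir \<theta>) x + dist x z" by (rule dist_triangle)
    also have "\<dots> \<le> 2 * r" using z r by (simp add: dist_norm)
    finally show ?thesis using G_le_infdist[OF F0, of "x + r *\<^sub>R unit_dir \<theta>"] z K(2)
      by (auto intro: order_trans mult_left_mono)
  qed
  from avg_le[OF r this] show ?thesis using r by simp
qed

lemma avg_outside:
  assumes "0 < r" "x \<notin> cball 0 (\<rho> + r)"
  shows "avg r x = 0"
proof -
  have "x + r *\<^sub>R unit_dir \<theta> \<notin> cball 0 \<rho>" for \<theta>
  proof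
    assume "x + r *\<^sub>R unit_dir \<theta> \<in> cball 0 \<rho>"
    then have "norm (x + r *\<^sub>R unit_dir \<theta>) \<le> \<rho>" by simp
    then have "norm x \<le> \<rho> + norm (r *\<^sub>R unit_dir \<theta>)"
      using norm_triangle_ineq4[of "x + r *\<^sub>R unit_dir \<theta>" "r *\<^sub>R unit_dir \<theta>"] by simp
    then show False using assms by simp
  qed
  then have "G (x + r *\<^sub>R unit_dir \<theta>) = 0" for \<theta>
    using S_sub by (auto simp: G_def split: split_indicator)
  then show ?thesis by (simp add: avg_def)
qed

lemma avg_tendsto:
  assumes x: "x \<notin> frontier S"
  shows "((\<lambda>r. avg r x) \<longlongrightarrow> indicator S x * avg_limit x) (at_right 0)"
proof (cases "x \<in> S")
  case False
  then have "x \<in> - closure S" using x closure_subset by (auto simp: frontier_def interior_subset[THEN subsetD])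
  then obtain d where d: "d > 0" "cball x d \<subseteq> - closure S"
    using open_contains_cball[of "- closure S"] by blast
  have "avg r x = 0" if "0 < r" "r < d" for r
  proof -
    have "x + r *\<^sub>R unit_dir \<theta> \<notin> S" for \<theta>
    proof -
      have "x + r *\<^sub>R unit_dir \<theta> \<in> cball x d" using that by (simp add: dist_norm)
      then show ?thesis using d(2) closure_subset[of S] by blast
    qed
    then show ?thesis by (simp add: avg_def G_def)
  qed
  then have "\<forall>\<^sub>F r in at_right 0. avg r x = indicator S x * avg_limit x"
    using d(1) False unfolding eventually_at_right_field by (intro exI[of _ d]) auto
  then show ?thesis by (rule tendsto_eventually)
next
  case True
  then have int: "x \<in> interior S" using x closure_subset by (auto simp: frontier_def)
  then have xS: "x \<in> closure S" using True closure_subset by blast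
  obtain d where d: "d > 0" "cball x d \<subseteq> S" using int by (auto simp: mem_interior_cball)
  have "(F has_derivative blinfun_apply (D x)) (at x)"
  proof -
    have "x \<in> interior (closure S)" using int interior_mono[OF closure_subset] by blast
    then show ?thesis using derivative[OF xS] at_within_interior by metis
  qed
  then have lin: "\<exists>d>0. \<forall>y. norm (y - x) < d \<longrightarrow> norm (F y - F x - D x (y - x)) \<le> \<epsilon> * norm (y - x)" if "\<epsilon> > 0" for \<epsilon>
    using that by (auto simp: has_derivative_at_alt)
  show ?thesis
  proof (rule tendstoI)
    fix \<epsilon> :: real assume e: "\<epsilon> > 0"
    obtain d' where d': "d' > 0" "\<And>y. norm (y - x) < d' \<Longrightarrow> norm (F y - F x - D x (y - x)) \<le> \<epsilon> / 4 * norm (y - x)"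
      using lin[of "\<epsilon> / 4"] e by auto
    have "dist (avg r x) (indicator S x * avg_limit x) < \<epsilon>" if r: "0 < r" "r < min d d'" for r
    proof -
      let ?u = "\<lambda>\<theta>. x + r *\<^sub>R unit_dir \<theta>"
      have uS: "?u \<theta> \<in> S" for \<theta>
      proof -
        have "?u \<theta> \<in> cball x d" using r by (simp add: dist_norm)
        then show ?thesis using d by blast
      qed
      have meas: "(\<lambda>\<theta>. G (?u \<theta>) - F x) \<in> borel_measurable borel" by measurable
      have bnd: "norm (G (?u \<theta>) - F x) \<le> m + norm (F x)" for \<theta>
        using norm_triangle_ineq4[of "G (?u \<theta>)" "F x"] G_le[of "?u \<theta>"] by linarith
      have meas2: "(\<lambda>\<theta>. r *\<^sub>R D x (unit_dir \<theta>)) \<in> borel_measurable borel"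
        by (intro borel_measurable_continuous_onI continuous_intros continuous_on_compose2[OF continuous_unit_dir])
           (auto intro!: continuous_intros continuous_on_compose2[OF _ continuous_unit_dir])
      have bnd2: "norm (r *\<^sub>R D x (unit_dir \<theta>)) \<le> r * K" for \<theta>
        using norm_blinfun[of "D x" "unit_dir \<theta>"] K(1)[OF xS] r by simp
      have "(\<integral>\<theta>. G (?u \<theta>) \<bullet> e \<theta> \<partial>angle) - r * (\<integral>\<theta>. D x (unit_dir \<theta>) \<bullet> e \<theta> \<partial>angle)
        = (\<integral>\<theta>. (G (?u \<theta>) - F x) \<bullet> e \<theta> \<partial>angle) - (\<integral>\<theta>. (r *\<^sub>R D x (unit_dir \<theta>)) \<bullet> e \<theta> \<partial>angle)"
        using integral_shift[of r x "F x"] r by simp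
      also have "\<dots> = (\<integral>\<theta>. (G (?u \<theta>) - F x - r *\<^sub>R D x (unit_dir \<theta>)) \<bullet> e \<theta> \<partial>angle)"
        using bounded_inner_integrable[OF meas bnd] bounded_inner_integrable[OF meas2 bnd2]
        by (subst Bochner_Integration.integral_diff[symmetric]) (simp_all add: inner_diff_left)
      finally have eq: "(\<integral>\<theta>. G (?u \<theta>) \<bullet> e \<theta> \<partial>angle) - r * (\<integral>\<theta>. D x (unit_dir \<theta>) \<bullet> e \<theta> \<partial>angle)
        = (\<integral>\<theta>. (G (?u \<theta>) - F x - r *\<^sub>R D x (unit_dir \<theta>)) \<bullet> e \<theta> \<partial>angle)" .
      have "norm (G (?u \<theta>) - F x - r *\<^sub>R D x (unit_dir \<theta>)) \<le> \<epsilon> / 4 * r" for \<theta>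
        using d'(2)[of "?u \<theta>"] r uS by (simp add: G_def blinfun.scaleR_right)
      from inner_integral_le[where f = "\<lambda>\<theta>. G (?u \<theta>) - F x - r *\<^sub>R D x (unit_dir \<theta>)", OF this] have "\<bar>(\<integral>\<theta>. G (?u \<theta>) \<bullet> e \<theta> \<partial>angle) - r * (\<integral>\<theta>. D x (unit_dir \<theta>) \<bullet> e \<theta> \<partial>angle)\<bar> \<le> pi * r * (\<epsilon> / 2)"
        unfolding eq by (simp add: mult_ac)
      then have "\<bar>(\<integral>\<theta>. G (?u \<theta>) \<bullet> e \<theta> \<partial>angle) - r * (\<integral>\<theta>. D x (unit_dir \<theta>) \<bullet> e \<theta> \<partial>angle)\<bar> / (pi * r) \<le> \<epsilon> / 2"
        using r by (simp add: pos_divide_le_eq mult_ac)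
      moreover have "avg r x - avg_limit x = ((\<integral>\<theta>. G (?u \<theta>) \<bullet> e \<theta> \<partial>angle) - r * (\<integral>\<theta>. D x (unit_dir \<theta>) \<bullet> e \<theta> \<partial>angle)) / (pi * r)"
        using r by (simp add: avg_def avg_limit_def diff_divide_distrib)
      ultimately have "\<bar>avg r x - avg_limit x\<bar> \<le> \<epsilon> / 2" using r by (simp add: abs_mult)
      then show ?thesis using True e by (simp add: dist_real_def)
    qed
    then show "\<forall>\<^sub>F r in at_right 0. dist (avg r x) (indicator S x * avg_limit x) < \<epsilon>"
      using d(1) d'(1) unfolding eventually_at_right_field by (intro exI[of _ "min d d'"]) auto
  qed
qed

lemma avg_measurable [measurable]: "avg r \<in> borel_measurable borel"
proof -
  have [measurable]: "unit_dir \<in> borel_measurable angle" "e \<in> borel_measurable angle"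
    by (rule measurable_angle[OF unit_dir_measurable], rule measurable_angle[OF e_measurable])
  have "(\<lambda>(x, \<theta>). G (x + r *\<^sub>R unit_dir \<theta>) \<bullet> e \<theta>) \<in> borel_measurable (borel \<Otimes>\<^sub>M angle)"
    by measurable
  then have "(\<lambda>x. \<integral>\<theta>. G (x + r *\<^sub>R unit_dir \<theta>) \<bullet> e \<theta> \<partial>angle) \<in> borel_measurable borel"
    by (rule angle.borel_measurable_lebesgue_integral)
  then show ?thesis unfolding avg_def[abs_def] by measurable
qed

end

section \<open>Moduli of Levy bases\<close>

text \<open>The mean value inequality in the half-plane where the exponential is at most one.\<close>

lemma cmod_exp_minus_1_le:
  assumes "Re w \<le> 0"
  shows "cmod (exp w - 1) \<le> cmod w"
proof -
  have "cmod (exp w - exp 0) \<le> 1 * cmod (w - 0)"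
  proof (rule field_differentiable_bound)
    show "convex {z. Re z \<le> 0}" by (rule convex_halfspace_Re_le)
    show "(exp has_field_derivative exp z) (at z within {z. Re z \<le> 0})" for z :: complex
      by (auto intro!: derivative_eq_intros)
    show "cmod (exp z) \<le> 1" if "z \<in> {z. Re z \<le> 0}" for z using that by (simp add: norm_exp_eq_Re)
  qed (use assms in auto)
  then show ?thesis by simp
qed

text \<open>The exponent of the shifted basis has nonpositive real part, because its exponential is a
  characteristic function; so the exponential differs from one by at most the exponent.\<close>

lemma controlled_basis_shifted:
  assumes M: "prob_space M" and L: "homogeneous_levy_basis M \<gamma> b \<nu> L"
    and mono: "mono \<kappa>" and \<kappa>0: "\<kappa> 0 = 0" and lim: "(\<kappa> \<longlongrightarrow> 0) (at 0)"
    and bound: "\<And>z. cmod (levy_exponent \<gamma> b \<nu> z - \<i> * of_real (c * z)) \<le> \<kappa> \<bar>z\<bar>"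
  shows "controlled_basis M (shifted_basis L c) \<kappa>"
proof -
  interpret prob_space M by (rule M)
  have Lm: "L B \<in> borel_measurable M" if "B \<in> finite_area_sets" for B
    using L that by (simp add: homogeneous_levy_basis_def)
  have Lc: "char (distr M borel (L B)) z = exp (of_real (measure lborel B) * levy_exponent \<gamma> b \<nu> z)"
    if "B \<in> finite_area_sets" for B z
    using L that by (simp add: homogeneous_levy_basis_def)
  have Lind: "indep_vars (\<lambda>_. borel) (\<lambda>i. L (B i)) UNIV"
    if "range B \<subseteq> finite_area_sets" "disjoint_family B" for B :: "nat \<Rightarrow> plane set"
    using L that by (simp add: homogeneous_levy_basis_def)
  have Lsig: "AE w in M. (\<lambda>i. L (B i) w) sums L (\<Union>i. B i) w"
    if "range B \<subseteq> finite_area_sets" "disjoint_family B" "(\<Union>i. B i) \<in> finite_area_sets" for B :: "nat \<Rightarrow> plane set"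
    using L that by (simp add: homogeneous_levy_basis_def)
  show ?thesis
  proof
    fix B :: "plane set" assume B: "B \<in> finite_area_sets"
    note [measurable] = Lm[OF B]
    show "shifted_basis L c B \<in> borel_measurable M"
      unfolding shifted_basis_def[abs_def] by measurable
    fix z :: real
    let ?a = "measure lborel B" and ?w = "levy_exponent \<gamma> b \<nu> z - \<i> * of_real (c * z)"
    have "char (distr M borel (shifted_basis L c B)) z
      = (CLINT w|M. iexp (- (z * c * ?a)) * iexp (z * L B w))"
      unfolding char_def shifted_basis_def[abs_def]
      by (subst integral_distr) (auto simp: algebra_simps exp_diff exp_minus exp_add divide_inverse)
    also have "\<dots> = iexp (- (z * c * ?a)) * char (distr M borel (L B)) z"
      unfolding char_def by (subst integral_distr) auto
    also have "\<dots> = exp (of_real ?a * ?w)"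
      by (simp add: Lc[OF B] algebra_simps flip: exp_add)
    finally have eq: "char (distr M borel (shifted_basis L c B)) z = exp (of_real ?a * ?w)" .
    have "real_distribution (distr M borel (shifted_basis L c B))"
      using \<open>shifted_basis L c B \<in> borel_measurable M\<close> by (rule real_distribution_distr)
    then have "cmod (exp (of_real ?a * ?w)) \<le> 1"
      using real_distribution.cmod_char_le_1 eq by metis
    then have "Re (of_real ?a * ?w) \<le> 0" by (simp add: norm_exp_eq_Re)
    then have "cmod (exp (of_real ?a * ?w) - 1) \<le> cmod (of_real ?a * ?w)"
      by (rule cmod_exp_minus_1_le)
    also have "\<dots> = ?a * cmod ?w" by (simp add: norm_mult)
    also have "\<dots> \<le> ?a * \<kappa> \<bar>z\<bar>" by (intro mult_left_mono bound) simp
    finally show "cmod (char (distr M borel (shifted_basis L c B)) z - 1) \<le> ?a * \<kappa> \<bar>z\<bar>"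
      unfolding eq .
  next
    fix B :: "nat \<Rightarrow> plane set"
    assume B: "range B \<subseteq> finite_area_sets" "disjoint_family B"
    show "indep_vars (\<lambda>_. borel) (\<lambda>i. shifted_basis L c (B i)) UNIV"
      unfolding shifted_basis_def[abs_def]
      by (rule indep_vars_compose2[OF Lind[OF B], where Y = "\<lambda>i x. x - c * measure lborel (B i)"]) auto
    assume U: "(\<Union>i. B i) \<in> finite_area_sets"
    have "(\<lambda>i. measure lborel (B i)) sums measure lborel (\<Union>i. B i)"
      using B U by (intro measure_UNION) (auto simp: finite_area_sets_def)
    from sums_mult[OF this, of c] Lsig[OF B U]
    show "AE w in M. (\<lambda>i. shifted_basis L c (B i) w) sums shifted_basis L c (\<Union>i. B i) w"
      unfolding shifted_basis_def by (auto intro: sums_diff)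
  qed (fact mono \<kappa>0 lim)+
qed

lemma tendsto_0_of_mono:
  fixes \<phi> :: "real \<Rightarrow> real"
  assumes mono: "mono \<phi>" and neg: "\<And>z. z \<le> 0 \<Longrightarrow> \<phi> z = 0" and lim: "(\<lambda>n. \<phi> (1 / real (Suc n))) \<longlonglongrightarrow> 0"
  shows "(\<phi> \<longlongrightarrow> 0) (at 0)"
proof (rule tendstoI)
  fix e :: real assume "e > 0"
  then have "\<forall>\<^sub>F n in sequentially. \<phi> (1 / real (Suc n)) < e" using order_tendstoD(2)[OF lim] by blast
  then obtain n where n: "\<phi> (1 / real (Suc n)) < e" by (auto dest: eventually_happens)
  have "dist (\<phi> z) 0 < e" if "\<bar>z\<bar> < 1 / real (Suc n)" for z
  proof -
    have "\<phi> z \<le> \<phi> (1 / real (Suc n))" using that by (intro monoD[OF mono]) auto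
    moreover have "0 \<le> \<phi> z" using neg[of "min z 0"] monoD[OF mono, of "min z 0" z] by simp
    ultimately show ?thesis using n by simp
  qed
  then show "\<forall>\<^sub>F z in at 0. dist (\<phi> z) 0 < e"
    unfolding eventually_at by (intro exI[of _ "1 / real (Suc n)"]) (auto simp: dist_real_def)
qed

text \<open>The moduli below are integrals of kernels that increase with their first argument. By
  monotonicity it suffices to approach zero along \<open>1 / n\<close>, where the kernel at one dominates. The
  maximum with zero extends the integral to a monotone function on the whole line.\<close>

lemma kernel_modulus:
  fixes k :: "real \<Rightarrow> real \<Rightarrow> real"
  assumes m[measurable]: "\<And>z. k z \<in> borel_measurable \<nu>" and int: "\<And>z. integrable \<nu> (k z)"
    and mono: "\<And>x z z'. 0 \<le> z \<Longrightarrow> z \<le> z' \<Longrightarrow> k z x \<le> k z' x" and zero: "\<And>x. k 0 x = 0"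
    and lim: "\<And>x. (\<lambda>n. k (1 / real (Suc n)) x) \<longlonglongrightarrow> 0"
  defines "\<phi> \<equiv> \<lambda>z. (\<integral>x. k (max 0 z) x \<partial>\<nu>)"
  shows "mono \<phi>" "\<phi> 0 = 0" "(\<phi> \<longlongrightarrow> 0) (at 0)"
proof -
  show mono': "mono \<phi>"
    unfolding \<phi>_def by (intro monoI integral_mono int mono) auto
  have k0: "k 0 = (\<lambda>_. 0)" using zero by auto
  show z: "\<phi> 0 = 0" by (simp add: \<phi>_def k0)
  show "(\<phi> \<longlongrightarrow> 0) (at 0)"
  proof (rule tendsto_0_of_mono[OF mono'])
    show "\<phi> z = 0" if "z \<le> 0" for z using that by (simp add: \<phi>_def k0 max_absorb1)
    have "(\<lambda>n. \<integral>x. k (1 / real (Suc n)) x \<partial>\<nu>) \<longlonglongrightarrow> (\<integral>x. 0 \<partial>\<nu>)"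
    proof (rule integral_dominated_convergence[where w = "k 1"])
      show "AE x in \<nu>. norm (k (1 / real (Suc n)) x) \<le> k 1 x" for n
        using mono[of 0 "1 / real (Suc n)"] mono[of "1 / real (Suc n)" 1] zero by auto
    qed (use int lim in auto)
    then show "(\<lambda>n. \<phi> (1 / real (Suc n))) \<longlonglongrightarrow> 0" by (simp add: \<phi>_def)
  qed
qed

lemma cmod_integral_le:
  assumes "J \<in> borel_measurable N" "integrable N k" "\<And>x. cmod (J x) \<le> k x"
  shows "cmod (\<integral>x. J x \<partial>N) \<le> (\<integral>x. k x \<partial>N)"
proof -
  have "integrable N J"
    using assms by (intro Bochner_Integration.integrable_bound[OF assms(2,1)]) (auto intro: order_trans[OF _ abs_ge_self])
  then have "(\<integral>x. cmod (J x) \<partial>N) \<le> (\<integral>x. k x \<partial>N)"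
    using assms by (intro integral_mono) auto
  then show ?thesis using integral_norm_bound[of N J] by linarith
qed

lemma levy_measure_integrable:
  assumes \<nu>: "levy_measure \<nu>" and f: "f \<in> borel_measurable borel" and le: "\<And>x. \<bar>f x\<bar> \<le> C * min 1 (x\<^sup>2)"
  shows "integrable \<nu> (f :: real \<Rightarrow> real)"
proof -
  have [measurable_cong]: "sets \<nu> = sets borel" using \<nu> by (simp add: levy_measure_def)
  have "integrable \<nu> (\<lambda>x. min 1 (x\<^sup>2))"
    using \<nu> by (intro integrableI_nonneg) (auto simp: levy_measure_def)
  then have "integrable \<nu> (\<lambda>x. C * min 1 (x\<^sup>2))" by simp
  then show ?thesis
  proof (rule Bochner_Integration.integrable_bound)
    show "f \<in> borel_measurable \<nu>" using f by measurable
    show "AE x in \<nu>. norm (f x) \<le> norm (C * min 1 (x\<^sup>2))"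
      using le by (auto intro: order_trans[OF _ abs_ge_self])
  qed
qed

text \<open>Small jumps are compensated, so they enter quadratically.\<close>

definition small_jump_kernel :: "real \<Rightarrow> real \<Rightarrow> real" where
  "small_jump_kernel z x = (if \<bar>x\<bar> \<le> 1 then z\<^sup>2 * x\<^sup>2 / 2 else min 2 (\<bar>z\<bar> * \<bar>x\<bar>))"

lemma cmod_iexp_minus_1_le: "cmod (iexp u - 1) \<le> min 2 \<bar>u\<bar>"
proof -
  have "cmod (iexp u - 1) \<le> cmod (iexp u) + cmod 1" by (rule norm_triangle_ineq4)
  moreover have "cmod (iexp u - 1) \<le> \<bar>u\<bar>" using iexp_approx1[of u 0] by simp
  ultimately show ?thesis by simp
qed

lemma cmod_jump_le:
  "cmod (iexp (z * x) - 1 - \<i> * complex_of_real (z * x * indicator {-1..1} x)) \<le> small_jump_kernel z x"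
proof (cases "\<bar>x\<bar> \<le> 1")
  case True
  have "cmod (iexp (z * x) - (1 + \<i> * complex_of_real (z * x))) \<le> (z * x)\<^sup>2 / 2"
    using iexp_approx1[of "z * x" 1] by (simp add: power2_eq_square)
  then show ?thesis using True by (simp add: small_jump_kernel_def abs_le_iff power_mult_distrib diff_diff_eq)
next
  case False
  then show ?thesis using cmod_iexp_minus_1_le[of "z * x"]
    by (auto simp: small_jump_kernel_def abs_mult split: split_indicator)
qed

lemma small_jump_kernel_integrable:
  assumes "levy_measure \<nu>"
  shows "integrable \<nu> (small_jump_kernel z)"
proof (rule levy_measure_integrable[OF assms])
  show "small_jump_kernel z \<in> borel_measurable borel" unfolding small_jump_kernel_def[abs_def] by measurable
  fix x
  show "\<bar>small_jump_kernel z x\<bar> \<le> (z\<^sup>2 / 2 + 2) * min 1 (x\<^sup>2)"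
  proof (cases "\<bar>x\<bar> \<le> 1")
    case True
    then have "x\<^sup>2 \<le> 1" by (simp add: abs_square_le_1)
    then have "min 1 (x\<^sup>2) = x\<^sup>2" by simp
    moreover have "z\<^sup>2 * x\<^sup>2 / 2 \<le> (z\<^sup>2 / 2 + 2) * x\<^sup>2" by (simp add: distrib_right)
    ultimately show ?thesis using True by (simp add: small_jump_kernel_def)
  next
    case False
    then have "1 \<le> x\<^sup>2" by (simp add: abs_square_le_1 less_imp_le not_le[symmetric] abs_square_less_1 not_less)
    then have "min 1 (x\<^sup>2) = 1" by simp
    moreover have "min 2 (\<bar>z\<bar> * \<bar>x\<bar>) \<le> z\<^sup>2 / 2 + 2" using zero_le_power2[of z] by linarith
    ultimately show ?thesis using False by (simp add: small_jump_kernel_def)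
  qed
qed

definition general_modulus :: "real \<Rightarrow> real \<Rightarrow> real measure \<Rightarrow> real \<Rightarrow> real" where
  "general_modulus a b \<nu> z = \<bar>a\<bar> * max 0 z + b\<^sup>2 * (max 0 z)\<^sup>2 / 2 + (\<integral>x. small_jump_kernel (max 0 z) x \<partial>\<nu>)"

lemma general_modulus:
  assumes \<nu>: "levy_measure \<nu>"
  shows "mono (general_modulus a b \<nu>)" "general_modulus a b \<nu> 0 = 0" "(general_modulus a b \<nu> \<longlongrightarrow> 0) (at 0)"
    and "cmod (levy_exponent \<gamma> b \<nu> z - \<i> * of_real (c * z)) \<le> general_modulus (\<gamma> - c) b \<nu> \<bar>z\<bar>"
proof -
  have [measurable_cong]: "sets \<nu> = sets borel" using \<nu> by (simp add: levy_measure_def)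
  have km: "small_jump_kernel z \<in> borel_measurable \<nu>" for z
    unfolding small_jump_kernel_def[abs_def] by measurable
  have mono: "small_jump_kernel z x \<le> small_jump_kernel z' x" if "0 \<le> z" "z \<le> z'" for x z z'
  proof -
    have "z\<^sup>2 * x\<^sup>2 \<le> z'\<^sup>2 * x\<^sup>2" using that by (intro mult_right_mono power_mono) auto
    moreover have "z * \<bar>x\<bar> \<le> z' * \<bar>x\<bar>" using that by (intro mult_right_mono) auto
    ultimately show ?thesis using that by (auto simp: small_jump_kernel_def)
  qed
  have lim: "(\<lambda>n. small_jump_kernel (1 / real (Suc n)) x) \<longlonglongrightarrow> 0" for x
  proof (cases "\<bar>x\<bar> \<le> 1")
    case True
    have "(\<lambda>n. (1 / real (Suc n))\<^sup>2 * x\<^sup>2 / 2) \<longlonglongrightarrow> 0" by real_asymp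
    then show ?thesis using True by (simp add: small_jump_kernel_def)
  next
    case False
    have "(\<lambda>n. (1 / real (Suc n)) * \<bar>x\<bar>) \<longlonglongrightarrow> 0" by real_asymp
    then have "(\<lambda>n. min 2 ((1 / real (Suc n)) * \<bar>x\<bar>)) \<longlonglongrightarrow> min 2 0" by (intro tendsto_min tendsto_const)
    then show ?thesis using False by (simp add: small_jump_kernel_def)
  qed
  note km' = kernel_modulus[of small_jump_kernel, OF km small_jump_kernel_integrable[OF \<nu>] mono _ lim]
  have zero: "small_jump_kernel 0 x = 0" for x by (simp add: small_jump_kernel_def)
  note km' = km'[OF _ _ zero]
  have "max 0 z \<le> max 0 z'" if "z \<le> z'" for z z' :: real using that by auto
  then show "mono (general_modulus a b \<nu>)"
    unfolding general_modulus_def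
    by (intro monoI add_mono mult_left_mono divide_right_mono power_mono monoD[OF km'(1)]) auto
  show "general_modulus a b \<nu> 0 = 0" using km'(2) by (simp add: general_modulus_def)
  have "((\<lambda>z. \<bar>a\<bar> * max 0 z + b\<^sup>2 * (max 0 z)\<^sup>2 / 2 + (\<integral>x. small_jump_kernel (max 0 z) x \<partial>\<nu>))
      \<longlongrightarrow> \<bar>a\<bar> * max 0 0 + b\<^sup>2 * (max 0 0)\<^sup>2 / 2 + 0) (at 0)"
    by (intro tendsto_intros km'(3)) auto
  then show "(general_modulus a b \<nu> \<longlongrightarrow> 0) (at 0)" by (simp add: general_modulus_def[abs_def])
  let ?J = "\<lambda>x. iexp (z * x) - 1 - \<i> * complex_of_real (z * x * indicator {-1..1} x)"
  have Jm: "?J \<in> borel_measurable \<nu>" by measurable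
  have "cmod (CLINT x|\<nu>. ?J x) \<le> (\<integral>x. small_jump_kernel z x \<partial>\<nu>)"
    by (rule cmod_integral_le[OF Jm small_jump_kernel_integrable[OF \<nu>] cmod_jump_le])
  moreover have "small_jump_kernel z = small_jump_kernel \<bar>z\<bar>"
    by (auto simp: small_jump_kernel_def fun_eq_iff)
  ultimately have J: "cmod (CLINT x|\<nu>. ?J x) \<le> (\<integral>x. small_jump_kernel (max 0 \<bar>z\<bar>) x \<partial>\<nu>)" by simp
  have "levy_exponent \<gamma> b \<nu> z - \<i> * of_real (c * z)
    = \<i> * of_real ((\<gamma> - c) * z) + (- of_real (b\<^sup>2 * z\<^sup>2 / 2) + (CLINT x|\<nu>. ?J x))"
    by (simp add: levy_exponent_def algebra_simps)
  also have "cmod \<dots> \<le> cmod (\<i> * of_real ((\<gamma> - c) * z)) + (cmod (- of_real (b\<^sup>2 * z\<^sup>2 / 2)) + cmod (CLINT x|\<nu>. ?J x))"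
    by (intro order_trans[OF norm_triangle_ineq] add_left_mono norm_triangle_ineq)
  also have "\<dots> = \<bar>\<gamma> - c\<bar> * \<bar>z\<bar> + (b\<^sup>2 * z\<^sup>2 / 2 + cmod (CLINT x|\<nu>. ?J x))"
    by (simp only: norm_mult norm_minus_cancel norm_of_real norm_ii) (simp add: abs_mult)
  finally show "cmod (levy_exponent \<gamma> b \<nu> z - \<i> * of_real (c * z)) \<le> general_modulus (\<gamma> - c) b \<nu> \<bar>z\<bar>"
    using J by (simp add: general_modulus_def)
qed

definition finite_variation_modulus :: "real measure \<Rightarrow> real \<Rightarrow> real" where
  "finite_variation_modulus \<nu> z = (\<integral>x. min 2 (max 0 z * \<bar>x\<bar>) \<partial>\<nu>)"

text \<open>Without a Gaussian part, subtracting the drift leaves the exponent \<open>\<integral> (exp (i z x) - 1) \<nu>(dx)\<close>.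
  In the last claim, \<open>r min 2 (a \<bar>x\<bar> / r) = min (2 r) (a \<bar>x\<bar>)\<close> is again
  a monotone kernel, now in \<open>r\<close>.\<close>

lemma finite_variation_modulus:
  assumes \<nu>: "levy_measure \<nu>" and fv: "(\<integral>\<^sup>+x. ennreal (min 1 \<bar>x\<bar>) \<partial>\<nu>) < \<infinity>"
  shows "mono (finite_variation_modulus \<nu>)" "finite_variation_modulus \<nu> 0 = 0"
    "(finite_variation_modulus \<nu> \<longlongrightarrow> 0) (at 0)"
    and "cmod (levy_exponent \<gamma> 0 \<nu> z - \<i> * of_real ((\<gamma> - (LINT x:{-1..1}|\<nu>. x)) * z)) \<le> finite_variation_modulus \<nu> \<bar>z\<bar>"
    and "a > 0 \<Longrightarrow> ((\<lambda>r. r * finite_variation_modulus \<nu> (a / r)) \<longlongrightarrow> 0) (at_right 0)"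
proof -
  have [measurable_cong]: "sets \<nu> = sets borel" using \<nu> by (simp add: levy_measure_def)
  have int1: "integrable \<nu> (\<lambda>x. min 1 \<bar>x\<bar>)"
    using fv by (intro integrableI_nonneg) auto
  have int: "integrable \<nu> f" if "f \<in> borel_measurable borel" "\<And>x. \<bar>f x\<bar> \<le> C * min 1 \<bar>x\<bar>" for f :: "real \<Rightarrow> real" and C
  proof (rule Bochner_Integration.integrable_bound[OF integrable_mult_right[OF int1, of C]])
    show "f \<in> borel_measurable \<nu>" using that(1) by measurable
    show "AE x in \<nu>. norm (f x) \<le> norm (C * min 1 \<bar>x\<bar>)"
      using that(2) by (auto intro: order_trans[OF _ abs_ge_self])
  qed
  have intk: "integrable \<nu> (\<lambda>x. min (2 * u) (v * \<bar>x\<bar>))" if "u \<ge> 0" "v \<ge> 0" for u v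
  proof (rule int)
    fix x :: real
    have "min (2 * u) (v * \<bar>x\<bar>) \<le> (2 * u + v) * min 1 \<bar>x\<bar>"
    proof (cases "1 \<le> \<bar>x\<bar>")
      case True
      then show ?thesis using that by simp
    next
      case False
      have "min (2 * u) (v * \<bar>x\<bar>) \<le> v * \<bar>x\<bar>" by simp
      also have "\<dots> \<le> (2 * u + v) * \<bar>x\<bar>" using that by (intro mult_right_mono) auto
      finally show ?thesis using False by simp
    qed
    then show "\<bar>min (2 * u) (v * \<bar>x\<bar>)\<bar> \<le> (2 * u + v) * min 1 \<bar>x\<bar>" using that by simp
  qed measurable
  let ?k = "\<lambda>z x. min 2 (\<bar>z\<bar> * \<bar>x\<bar>)"
  have kmono: "?k z x \<le> ?k z' x" if "0 \<le> z" "z \<le> z'" for x z z' :: real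
    using mult_right_mono[OF that(2) abs_ge_zero[of x]] that by (simp add: min_le_iff_disj)
  have klim: "(\<lambda>n. ?k (1 / real (Suc n)) x) \<longlonglongrightarrow> 0" for x :: real
  proof -
    have "(\<lambda>n. (1 / real (Suc n)) * \<bar>x\<bar>) \<longlonglongrightarrow> 0" by real_asymp
    then have "(\<lambda>n. min 2 ((1 / real (Suc n)) * \<bar>x\<bar>)) \<longlonglongrightarrow> min 2 0" by (intro tendsto_min tendsto_const)
    then show ?thesis by simp
  qed
  have kint: "integrable \<nu> (?k z)" for z using intk[of 1 "\<bar>z\<bar>"] by simp
  note k = kernel_modulus[of ?k, OF borel_measurable_integrable[OF kint] kint kmono _ klim, simplified]
  have eq: "finite_variation_modulus \<nu> = (\<lambda>z. \<integral>x. ?k (max 0 z) x \<partial>\<nu>)"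
    by (auto simp: finite_variation_modulus_def fun_eq_iff)
  show "mono (finite_variation_modulus \<nu>)" "finite_variation_modulus \<nu> 0 = 0"
    "(finite_variation_modulus \<nu> \<longlongrightarrow> 0) (at 0)"
    unfolding eq using k by simp_all
  show "((\<lambda>r. r * finite_variation_modulus \<nu> (a / r)) \<longlongrightarrow> 0) (at_right 0)" if a: "a > 0"
  proof -
    let ?h = "\<lambda>z x. min (2 * \<bar>z\<bar>) (a * \<bar>x\<bar>)"
    have "((\<lambda>z. \<integral>x. ?h (max 0 z) x \<partial>\<nu>) \<longlongrightarrow> 0) (at 0)"
    proof (rule kernel_modulus[of ?h])
      fix x z z' :: real
      show "?h z x \<le> ?h z' x" if "0 \<le> z" "z \<le> z'" using that by auto
      have "(\<lambda>n. 2 * (1 / real (Suc n))) \<longlonglongrightarrow> 0" by real_asymp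
      then have "(\<lambda>n. min (2 * (1 / real (Suc n))) (a * \<bar>x\<bar>)) \<longlonglongrightarrow> min 0 (a * \<bar>x\<bar>)"
        by (intro tendsto_min tendsto_const)
      then show "(\<lambda>n. ?h (1 / real (Suc n)) x) \<longlonglongrightarrow> 0" using a by (simp add: min_absorb1)
    qed (use intk[of "\<bar>_\<bar>" a] a in auto)
    then have "((\<lambda>z. \<integral>x. ?h (max 0 z) x \<partial>\<nu>) \<longlongrightarrow> 0) (at_right 0)"
      by (rule filterlim_mono) (auto intro: at_le)
    moreover have "\<forall>\<^sub>F r in at_right 0. (\<integral>x. ?h (max 0 r) x \<partial>\<nu>) = r * finite_variation_modulus \<nu> (a / r)"
      unfolding eventually_at_right_field
    proof (intro exI[of _ 1] conjI allI impI)
      fix r :: real assume r: "0 < r"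
      have "min (2 * r) (a * \<bar>x\<bar>) = r * min 2 (a / r * \<bar>x\<bar>)" for x
        using r by (simp add: min_def field_simps)
      then show "(\<integral>x. ?h (max 0 r) x \<partial>\<nu>) = r * finite_variation_modulus \<nu> (a / r)"
        using r a by (simp add: finite_variation_modulus_def)
    qed simp
    ultimately show ?thesis by (rule Lim_transform_eventually)
  qed
  let ?J = "\<lambda>x. iexp (z * x) - 1 - \<i> * complex_of_real (z * x * indicator {-1..1} x)"
  let ?I = "\<lambda>x. iexp (z * x) - 1"
  have i1: "integrable \<nu> (\<lambda>x. x * indicator {-1..1} x)"
    by (rule int[where C = 1]) (auto split: split_indicator)
  have i2: "integrable \<nu> ?I"
  proof (rule Bochner_Integration.integrable_bound[OF kint[of z]])
    show "AE x in \<nu>. cmod (?I x) \<le> norm (?k z x)"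
      using cmod_iexp_minus_1_le[of "z * _"] by (auto simp: abs_mult)
  qed measurable
  have i3: "integrable \<nu> (\<lambda>x. \<i> * of_real (z * x * indicator {-1..1} x))"
    using integrable_mult_right[OF i1, of z] by (intro integrable_mult_right integrable_of_real) (simp add: mult.assoc)
  have "(CLINT x|\<nu>. ?J x) = (CLINT x|\<nu>. ?I x) - (CLINT x|\<nu>. \<i> * of_real (z * x * indicator {-1..1} x))"
    by (rule Bochner_Integration.integral_diff[OF i2 i3])
  also have "(CLINT x|\<nu>. \<i> * of_real (z * x * indicator {-1..1} x)) = \<i> * of_real (z * (LINT x:{-1..1}|\<nu>. x))"
  proof -
    have "(CLINT x|\<nu>. \<i> * of_real (z * x * indicator {-1..1} x)) = \<i> * (CLINT x|\<nu>. of_real (z * x * indicator {-1..1} x))"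
      by (rule integral_mult_right_zero)
    also have "\<dots> = \<i> * of_real (\<integral>x. z * x * indicator {-1..1} x \<partial>\<nu>)"
      by (simp only: integral_complex_of_real)
    also have "(\<integral>x. z * x * indicator {-1..1} x \<partial>\<nu>) = z * (\<integral>x. x * indicator {-1..1} x \<partial>\<nu>)"
      by (simp only: mult.assoc integral_mult_right_zero)
    finally show ?thesis by (simp add: set_lebesgue_integral_def mult.commute)
  qed
  finally have "levy_exponent \<gamma> 0 \<nu> z - \<i> * of_real ((\<gamma> - (LINT x:{-1..1}|\<nu>. x)) * z) = (CLINT x|\<nu>. ?I x)"
    by (simp add: levy_exponent_def algebra_simps)
  also have "cmod \<dots> \<le> (\<integral>x. ?k z x \<partial>\<nu>)"
  proof (rule cmod_integral_le[OF borel_measurable_integrable[OF i2] kint[of z]])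
    show "cmod (?I x) \<le> ?k z x" for x using cmod_iexp_minus_1_le[of "z * x"] by (simp add: abs_mult)
  qed
  finally show "cmod (levy_exponent \<gamma> 0 \<nu> z - \<i> * of_real ((\<gamma> - (LINT x:{-1..1}|\<nu>. x)) * z)) \<le> finite_variation_modulus \<nu> \<bar>z\<bar>"
    by (simp add: finite_variation_modulus_def)
qed

section \<open>Convergence of circle averages\<close>

lemma lborel_reflect: "distr lborel borel (\<lambda>q. p - q) = (lborel :: plane measure)"
  using lborel_affine[of "-1" p] by (simp add: density_1 one_ennreal_def[symmetric])

lemma AE_reflect:
  assumes "AE x in lborel. P x"
  shows "AE q in lborel. P (p - q :: plane)"
proof (rule AE_distrD[where f = "\<lambda>q. p - q" and M' = borel])
  show "AE x in distr lborel borel (\<lambda>q. p - q). P x" unfolding lborel_reflect by (rule assms)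
qed simp

lemma integral_reflect:
  fixes f :: "plane \<Rightarrow> real"
  assumes "f \<in> borel_measurable borel"
  shows "(\<integral>q. f (p - q) \<partial>lborel) = (\<integral>x. f x \<partial>lborel)"
proof -
  have "(\<integral>x. f x \<partial>lborel) = (\<integral>x. f x \<partial>distr lborel borel (\<lambda>q. p - q))" by (simp only: lborel_reflect)
  also have "\<dots> = (\<integral>q. f (p - q) \<partial>lborel)" using assms by (subst integral_distr) auto
  finally show ?thesis ..
qed

lemma tendsto_in_prob_cong_eventually:
  assumes "tendsto_in_prob M A Z G" "\<forall>\<^sub>F i in G. B i = A i"
  shows "tendsto_in_prob M B Z G"
  unfolding tendsto_in_prob_def
proof (intro conjI allI impI)
  note a = tendsto_in_probD[OF assms(1)]
  show "Z \<in> borel_measurable M" by (rule a(1))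
  show "\<forall>\<^sub>F i in G. B i \<in> borel_measurable M" using a(2) assms(2) by eventually_elim simp
  fix \<epsilon> :: real assume "\<epsilon> > 0"
  have "\<forall>\<^sub>F i in G. measure M {w \<in> space M. \<epsilon> < \<bar>A i w - Z w\<bar>} = measure M {w \<in> space M. \<epsilon> < \<bar>B i w - Z w\<bar>}"
    using assms(2) by eventually_elim simp
  then show "((\<lambda>i. measure M {w \<in> space M. \<epsilon> < \<bar>B i w - Z w\<bar>}) \<longlongrightarrow> 0) G"
    by (rule Lim_transform_eventually[OF a(3)[OF \<open>\<epsilon> > 0\<close>]])
qed

lemma floor_grid:
  assumes "n > 0" "0 \<le> \<theta>"
  shows "0 \<le> of_int \<lfloor>real n * \<theta>\<rfloor> / real n" "of_int \<lfloor>real n * \<theta>\<rfloor> / real n \<le> \<theta>"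
    "\<theta> - 1 / real n \<le> of_int \<lfloor>real n * \<theta>\<rfloor> / real n"
proof -
  show "0 \<le> of_int \<lfloor>real n * \<theta>\<rfloor> / real n" using assms by simp
  show "of_int \<lfloor>real n * \<theta>\<rfloor> / real n \<le> \<theta>"
    using assms of_int_floor_le[of "real n * \<theta>"] by (simp add: pos_divide_le_eq mult.commute)
  have "\<theta> \<le> (of_int \<lfloor>real n * \<theta>\<rfloor> + 1) / real n"
    using assms floor_correct[of "real n * \<theta>"] by (simp add: pos_le_divide_eq mult.commute)
  then show "\<theta> - 1 / real n \<le> of_int \<lfloor>real n * \<theta>\<rfloor> / real n" by (simp add: add_divide_distrib)
qed

text \<open>The step \<open>1 / Suc n\<close> rather than \<open>1 / n\<close> avoids a division by zero.\<close>

definition grid :: "nat \<Rightarrow> real \<Rightarrow> real" where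
  "grid n \<theta> = of_int \<lfloor>real (Suc n) * \<theta>\<rfloor> / real (Suc n)"

lemma grid_space: "\<theta> \<in> space angle \<Longrightarrow> grid n \<theta> \<in> space angle"
  using floor_grid[of "Suc n" \<theta>] by (auto simp: space_angle grid_def)

lemma grid_tendsto:
  assumes "\<theta> \<in> space angle"
  shows "(\<lambda>n. grid n \<theta>) \<longlonglongrightarrow> \<theta>"
proof (rule tendsto_sandwich)
  show "(\<lambda>n. \<theta> - 1 / real (Suc n)) \<longlonglongrightarrow> \<theta>" by real_asymp
  show "\<forall>\<^sub>F n in sequentially. \<theta> - 1 / real (Suc n) \<le> grid n \<theta>" "\<forall>\<^sub>F n in sequentially. grid n \<theta> \<le> \<theta>"
    using floor_grid[of "Suc _" \<theta>] assms by (auto simp: space_angle grid_def simp del: of_nat_Suc)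
qed simp

lemma grid_simple: "simple_function angle (grid n)"
proof (rule simple_function_borel_measurable)
  have "grid n \<in> borel_measurable borel" unfolding grid_def[abs_def] by measurable
  then show "grid n \<in> borel_measurable angle" by (rule measurable_angle)
  have "grid n ` space angle \<subseteq> (\<lambda>k. of_int k / real (Suc n)) ` {0..\<lfloor>real (Suc n) * (2 * pi)\<rfloor>}"
    unfolding space_angle grid_def
    by (auto intro!: imageI floor_mono mult_left_mono simp del: of_nat_Suc)
  then show "finite (grid n ` space angle)" by (rule finite_subset) simp
qed

text \<open>The field \<open>V\<close> is integrated with respect to \<open>\<Lambda>\<close>, which will be the basis without its drift. The
  last assumption is the dichotomy of the theorem.\<close>

locale circle_limit = controlled_basis M \<Lambda> \<kappa> + cut_off_field S F D K m \<rho> e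
  for M :: "'w measure" and \<Lambda> \<kappa> S F D K m \<rho> e +
  fixes V :: "plane \<Rightarrow> 'w \<Rightarrow> plane"
  assumes e_continuous: "continuous_on UNIV e"
    and tubes: "linear_tubes (frontier S)"
    and V_measurable [measurable]: "(\<lambda>(p, w). V p w) \<in> borel_measurable (borel \<Otimes>\<^sub>M M)"
    and V_fst: "\<And>p. has_levy_integral M \<Lambda> UNIV (\<lambda>q. fst (G (p - q))) (\<lambda>w. fst (V p w))"
    and V_snd: "\<And>p. has_levy_integral M \<Lambda> UNIV (\<lambda>q. snd (G (p - q))) (\<lambda>w. snd (V p w))"
    and limit_measurable [measurable]: "(\<lambda>x. indicator S x * avg_limit x) \<in> borel_measurable borel"
    and balance: "(\<forall>z\<in>frontier S. F z = 0) \<or> (\<forall>a>0. ((\<lambda>r. r * \<kappa> (a / r)) \<longlongrightarrow> 0) (at_right 0))"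
begin

lemma V_inner:
  "has_levy_integral M \<Lambda> UNIV (\<lambda>q. G (p - q) \<bullet> v) (\<lambda>w. V p w \<bullet> v)"
  using has_levy_integral_add[OF has_levy_integral_cmult[OF V_fst, of "fst v" p] has_levy_integral_cmult[OF V_snd, of "snd v" p]]
  by (simp add: inner_prod_def mult.commute)

lemma G_continuous:
  assumes x: "x \<notin> frontier S" and lim: "y \<longlonglongrightarrow> x"
  shows "(\<lambda>n. G (y n)) \<longlonglongrightarrow> G x"
proof (cases "x \<in> closure S")
  case True
  then have int: "x \<in> interior S" using x by (simp add: frontier_def)
  have "(F has_derivative blinfun_apply (D x)) (at x)"
  proof -
    have "x \<in> interior (closure S)" using int interior_mono[OF closure_subset] by blast
    then show ?thesis using derivative[OF True] at_within_interior by metis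
  qed
  then have "isCont F x" by (rule has_derivative_continuous)
  then have "(\<lambda>n. F (y n)) \<longlonglongrightarrow> F x" using lim by (rule isCont_tendsto_compose)
  moreover have "\<forall>\<^sub>F n in sequentially. F (y n) = G (y n)"
    using topological_tendstoD[OF lim open_interior int]
    by eventually_elim (use interior_subset[of S] in \<open>auto simp: G_def\<close>)
  ultimately have "(\<lambda>n. G (y n)) \<longlonglongrightarrow> F x" by (rule Lim_transform_eventually)
  moreover have "F x = G x" using int interior_subset[of S] by (auto simp: G_def)
  ultimately show ?thesis by simp
next
  case False
  have "\<forall>\<^sub>F n in sequentially. y n \<in> - closure S"
    using False by (intro topological_tendstoD[OF lim]) auto
  then have "\<forall>\<^sub>F n in sequentially. G (y n) = G x"
    by eventually_elim (use False closure_subset[of S] in \<open>auto simp: G_def split: split_indicator\<close>)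
  then show ?thesis by (rule tendsto_eventually)
qed

text \<open>The stochastic Fubini theorem, applied to the angle. For fixed \<open>\<theta>\<close> the integrand is continuous in
  the angle except where \<open>p + r u(\<theta>) - q\<close> lies on the boundary, which is a null set of points \<open>q\<close>.\<close>

lemma circle_average_integral:
  assumes r: "r > 0"
  shows "has_levy_integral M \<Lambda> UNIV (\<lambda>q. avg r (p - q)) (\<lambda>w. (\<integral>\<theta>. V (p + r *\<^sub>R unit_dir \<theta>) w \<bullet> e \<theta> \<partial>angle) / (pi * r))"
proof -
  have [measurable]: "unit_dir \<in> borel_measurable angle" "e \<in> borel_measurable angle"
    by (rule measurable_angle[OF unit_dir_measurable], rule measurable_angle[OF e_measurable])
  interpret fam: integral_family M \<Lambda> \<kappa> angle "\<lambda>\<theta> q. G (p + r *\<^sub>R unit_dir \<theta> - q) \<bullet> e \<theta>"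
    "\<lambda>\<theta> w. V (p + r *\<^sub>R unit_dir \<theta>) w \<bullet> e \<theta>" grid "cball 0 (norm p + r + \<rho>)" m
  proof
    show "(\<lambda>(\<theta>, q). G (p + r *\<^sub>R unit_dir \<theta> - q) \<bullet> e \<theta>) \<in> borel_measurable (angle \<Otimes>\<^sub>M lborel)" by measurable
    show "cball 0 (norm p + r + \<rho>) \<in> finite_area_sets" by (rule finite_area_cball)
    show "\<bar>G (p + r *\<^sub>R unit_dir \<theta> - q) \<bullet> e \<theta>\<bar> \<le> m * indicator (cball 0 (norm p + r + \<rho>)) q" for \<theta> q
    proof -
      have "norm q \<le> norm p + r + \<rho>" if "norm (p + r *\<^sub>R unit_dir \<theta> - q) \<le> \<rho>"
      proof -
        have "norm q \<le> norm (p + r *\<^sub>R unit_dir \<theta>) + norm (p + r *\<^sub>R unit_dir \<theta> - q)"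
          using norm_triangle_ineq4[of "p + r *\<^sub>R unit_dir \<theta>" "p + r *\<^sub>R unit_dir \<theta> - q"] by simp
        also have "norm (p + r *\<^sub>R unit_dir \<theta>) \<le> norm p + r"
          using norm_triangle_ineq[of p "r *\<^sub>R unit_dir \<theta>"] r by simp
        finally show ?thesis using that by simp
      qed
      then have "m * indicator (cball 0 \<rho>) (p + r *\<^sub>R unit_dir \<theta> - q) \<le> m * indicator (cball 0 (norm p + r + \<rho>)) q"
        using m(2) by (auto split: split_indicator)
      then show ?thesis using G_le_cball order_trans by blast
    qed
    show "simple_function angle (grid n)" for n by (rule grid_simple)
    show "grid n \<theta> \<in> space angle" if "\<theta> \<in> space angle" for n \<theta> using that by (rule grid_space)
    show "AE q in lborel. (\<lambda>n. G (p + r *\<^sub>R unit_dir (grid n \<theta>) - q) \<bullet> e (grid n \<theta>)) \<longlonglongrightarrow> G (p + r *\<^sub>R unit_dir \<theta> - q) \<bullet> e \<theta>"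
      if \<theta>: "\<theta> \<in> space angle" for \<theta>
      using AE_reflect[OF linear_tubes_null[OF tubes], of "p + r *\<^sub>R unit_dir \<theta>"]
    proof eventually_elim
      case (elim q)
      have cont: "isCont unit_dir \<theta>" "isCont e \<theta>"
        using continuous_unit_dir e_continuous by (simp_all add: continuous_on_eq_continuous_at)
      have u: "(\<lambda>n. unit_dir (grid n \<theta>)) \<longlonglongrightarrow> unit_dir \<theta>" "(\<lambda>n. e (grid n \<theta>)) \<longlonglongrightarrow> e \<theta>"
        by (rule isCont_tendsto_compose[OF cont(1) grid_tendsto[OF \<theta>]],
            rule isCont_tendsto_compose[OF cont(2) grid_tendsto[OF \<theta>]])
      show ?case
        by (intro tendsto_inner u G_continuous[OF elim] tendsto_intros)
    qed
    have [measurable]: "(\<lambda>(\<theta>, w). V (p + r *\<^sub>R unit_dir \<theta>) w) \<in> borel_measurable (angle \<Otimes>\<^sub>M M)"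
    proof -
      have "(\<lambda>(\<theta>, w). (p + r *\<^sub>R unit_dir \<theta>, w)) \<in> measurable (angle \<Otimes>\<^sub>M M) (borel \<Otimes>\<^sub>M M)" by measurable
      from measurable_compose[OF this V_measurable] show ?thesis by (simp add: case_prod_beta)
    qed
    show "(\<lambda>(\<theta>, w). V (p + r *\<^sub>R unit_dir \<theta>) w \<bullet> e \<theta>) \<in> borel_measurable (angle \<Otimes>\<^sub>M M)" by measurable
    show "has_levy_integral M \<Lambda> UNIV (\<lambda>q. G (p + r *\<^sub>R unit_dir \<theta> - q) \<bullet> e \<theta>) (\<lambda>w. V (p + r *\<^sub>R unit_dir \<theta>) w \<bullet> e \<theta>)" for \<theta>
      by (rule V_inner)
  qed
  have "has_levy_integral M \<Lambda> UNIV (\<lambda>q. 1 / (pi * r) * (\<integral>\<theta>. G (p + r *\<^sub>R unit_dir \<theta> - q) \<bullet> e \<theta> \<partial>angle))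
     (\<lambda>w. 1 / (pi * r) * (\<integral>\<theta>. V (p + r *\<^sub>R unit_dir \<theta>) w \<bullet> e \<theta> \<partial>angle))"
    by (rule has_levy_integral_cmult[OF fam.integral_of_integrals])
  moreover have "p + r *\<^sub>R unit_dir \<theta> - q = p - q + r *\<^sub>R unit_dir \<theta>" for \<theta> q by simp
  ultimately show ?thesis by (simp add: avg_def)
qed

definition error :: "real \<Rightarrow> plane \<Rightarrow> real" where
  "error r x = avg r x - indicator S x * avg_limit x"

lemma error_measurable [measurable]: "error r \<in> borel_measurable borel"
  unfolding error_def[abs_def] by measurable

lemma limit_le: "\<bar>indicator S x * avg_limit x\<bar> \<le> 2 * K"
  using avg_limit_le[of x] K(2) closure_subset[of S] by (auto split: split_indicator)

lemma limit_le_cball: "\<bar>indicator S x * avg_limit x\<bar> \<le> 2 * K * indicator (cball 0 \<rho>) x"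
proof (cases "x \<in> S")
  case True
  then show ?thesis using limit_le[of x] S_sub by auto
qed (use K(2) in simp)

lemma error_outside:
  assumes "0 < r" "r \<le> 1" "x \<notin> cball 0 (\<rho> + 1)"
  shows "error r x = 0"
proof -
  have "x \<notin> cball 0 (\<rho> + r)" "x \<notin> S" using assms S_sub by auto
  then show ?thesis using avg_outside[OF assms(1)] by (simp add: error_def)
qed

text \<open>Away from the boundary the averages are bounded
  by the derivative. In a tube of width \<open>r\<close> around the boundary they are still bounded if the field
  vanishes on the boundary; otherwise they are of order \<open>1 / r\<close>, and since the tube has area of order
  \<open>r\<close> its contribution is of order \<open>r \<kappa> (a / r)\<close>.\<close>

lemma error_modulus_tendsto:
  assumes a: "a > 0" and r: "\<And>n. 0 < r n" "\<And>n. r n \<le> 1" "r \<longlonglongrightarrow> 0"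
  shows "(\<lambda>n. \<integral>x. \<kappa> (a * \<bar>error (r n) x\<bar>) \<partial>lborel) \<longlonglongrightarrow> 0"
proof -
  have r0: "filterlim r (at_right 0) sequentially"
    using r less_imp_neq[OF r(1), THEN not_sym] by (auto simp: filterlim_at intro!: always_eventually)
  have lim: "AE x in lborel. (\<lambda>n. error (r n) x) \<longlonglongrightarrow> 0"
    using linear_tubes_null[OF tubes]
  proof eventually_elim
    case (elim x)
    have "(\<lambda>n. avg (r n) x) \<longlonglongrightarrow> indicator S x * avg_limit x"
      by (rule filterlim_compose[OF avg_tendsto[OF elim] r0])
    then show ?case unfolding error_def by (rule LIM_zero)
  qed
  have far: "\<bar>error (r n) x\<bar> \<le> c * indicator (cball 0 (\<rho> + 1)) x" if "\<bar>avg (r n) x\<bar> \<le> c - 2 * K" for n x c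
  proof (cases "x \<in> cball 0 (\<rho> + 1)")
    case True
    then show ?thesis using that limit_le[of x] by (simp add: error_def)
  next
    case False
    then show ?thesis using error_outside[OF r(1,2) False] by simp
  qed
  from balance show ?thesis
  proof
    assume F0: "\<forall>z\<in>frontier S. F z = 0"
    have "\<bar>error (r n) x\<bar> \<le> 6 * K * indicator (cball 0 (\<rho> + 1)) x" for n x
      using avg_le_vanishing[OF _ r(1), of n x] F0 by (intro far) simp
    then show ?thesis
      using a by (intro modulus_integral_tendsto[OF _ finite_area_cball _ _ lim]) auto
  next
    assume small: "\<forall>a>0. ((\<lambda>r. r * \<kappa> (a / r)) \<longlongrightarrow> 0) (at_right 0)"
    obtain c where c: "\<And>r. 0 < r \<Longrightarrow> r \<le> 1 \<Longrightarrow>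
        (\<exists>A\<in>finite_area_sets. (\<Union>z\<in>frontier S. cball z r) \<subseteq> A \<and> measure lborel A \<le> c * r)"
      using tubes by (auto simp: linear_tubes_def)
    have "\<forall>n. \<exists>A. A \<in> finite_area_sets \<and> (\<Union>z\<in>frontier S. cball z (r n)) \<subseteq> A \<and> measure lborel A \<le> c * r n"
      using c r by blast
    from choice[OF this] obtain A where A: "\<And>n. A n \<in> finite_area_sets"
      "\<And>n. (\<Union>z\<in>frontier S. cball z (r n)) \<subseteq> A n" "\<And>n. measure lborel (A n) \<le> c * r n" by blast
    have [measurable]: "A n \<in> sets borel" for n using finite_area_setsD(1)[OF A(1)] .
    \<comment> \<open>The summand one ensures that \<open>m'\<close> is positive.\<close>
    define m' where "m' = 2 * m + 2 * K + 1"
    have m': "m' > 0" using m(2) K(2) by (simp add: m'_def)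
    let ?E = "\<lambda>n x. indicator (- A n) x * error (r n) x"
    have E_bound: "\<bar>?E n x\<bar> \<le> 4 * K * indicator (cball 0 (\<rho> + 1)) x" for n x
    proof (cases "x \<in> A n")
      case True
      then show ?thesis using K(2) by simp
    next
      case False
      then have "cball x (r n) \<inter> frontier S = {}" using A(2)[of n] by (force simp: dist_commute)
      from far[OF order_trans[OF avg_le_away[OF this r(1)]], of "4 * K"]
      show ?thesis using False by simp
    qed
    have E_lim: "AE x in lborel. (\<lambda>n. ?E n x) \<longlonglongrightarrow> 0"
      using lim
    proof eventually_elim
      case (elim x)
      then have "(\<lambda>n. \<bar>error (r n) x\<bar>) \<longlonglongrightarrow> 0" by (rule tendsto_rabs_zero)
      then show ?case
        by (rule Lim_null_comparison[rotated]) (auto intro!: always_eventually split: split_indicator)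
    qed
    have E_int: "(\<lambda>n. \<integral>x. \<kappa> (a * \<bar>?E n x\<bar>) \<partial>lborel) \<longlonglongrightarrow> 0"
      using a by (intro modulus_integral_tendsto[OF _ finite_area_cball E_bound _ E_lim]) auto
    have near: "\<kappa> (a * \<bar>error (r n) x\<bar>) \<le> \<kappa> (a * \<bar>?E n x\<bar>) + indicator (A n) x * \<kappa> (a * m' / r n)" for n x
    proof (cases "x \<in> A n")
      case True
      have "\<bar>error (r n) x\<bar> \<le> 2 * m / r n + 2 * K"
        using avg_le_coarse[OF r(1), of n x] limit_le[of x] by (simp add: error_def)
      also have "2 * K \<le> 2 * K / r n" using r(1)[of n] r(2)[of n] K(2) by (simp add: pos_le_divide_eq mult_left_le)
      also have "2 * m / r n + 2 * K / r n \<le> m' / r n"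
        using r(1)[of n] by (simp add: m'_def add_divide_distrib[symmetric] divide_right_mono)
      finally have "\<bar>error (r n) x\<bar> \<le> m' / r n" by simp
      from mult_left_mono[OF this less_imp_le[OF a]] have "a * \<bar>error (r n) x\<bar> \<le> a * (m' / r n)" .
      then have "\<kappa> (a * \<bar>error (r n) x\<bar>) \<le> \<kappa> (a * m' / r n)" by (intro modulus_le) simp
      then show ?thesis using True by (simp add: modulus_0)
    next
      case False
      then show ?thesis by simp
    qed
    have E_integrable: "integrable lborel (\<lambda>x. \<kappa> (a * \<bar>?E n x\<bar>))" for n
      using a by (intro modulus_integrable[OF _ finite_area_cball E_bound]) auto
    have bound: "(\<integral>x. \<kappa> (a * \<bar>error (r n) x\<bar>) \<partial>lborel) \<le> (\<integral>x. \<kappa> (a * \<bar>?E n x\<bar>) \<partial>lborel) + c * (r n * \<kappa> (a * m' / r n))" for n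
    proof -
      have i: "integrable lborel (\<lambda>x. indicator (A n) x * \<kappa> (a * m' / r n))"
        using finite_area_setsD(2)[OF A(1)[of n]] by (intro integrable_mult_left) simp
      have "(\<integral>x. \<kappa> (a * \<bar>error (r n) x\<bar>) \<partial>lborel)
        \<le> (\<integral>x. \<kappa> (a * \<bar>?E n x\<bar>) + indicator (A n) x * \<kappa> (a * m' / r n) \<partial>lborel)"
      proof (rule integral_mono'[OF Bochner_Integration.integrable_add[OF E_integrable i] near])
        show "0 \<le> \<kappa> (a * \<bar>?E n x\<bar>) + indicator (A n) x * \<kappa> (a * m' / r n)" for x
          using a m' r(1)[of n] by (intro add_nonneg_nonneg mult_nonneg_nonneg modulus_nonneg) auto
      qed
      also have "\<dots> = (\<integral>x. \<kappa> (a * \<bar>?E n x\<bar>) \<partial>lborel) + measure lborel (A n) * \<kappa> (a * m' / r n)"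
        using E_integrable i by (subst Bochner_Integration.integral_add) auto
      also have "measure lborel (A n) * \<kappa> (a * m' / r n) \<le> (c * r n) * \<kappa> (a * m' / r n)"
        using A(3) a m' r(1)[of n] by (intro mult_right_mono modulus_nonneg) auto
      finally show ?thesis by (simp add: mult.assoc)
    qed
    have "((\<lambda>r. r * \<kappa> (a * m' / r)) \<longlongrightarrow> 0) (at_right 0)" using small a m' by simp
    from filterlim_compose[OF this r0] have "(\<lambda>n. r n * \<kappa> (a * m' / r n)) \<longlonglongrightarrow> 0" .
    from tendsto_add[OF E_int tendsto_mult_right_zero[OF this, of c]]
    have upper: "(\<lambda>n. (\<integral>x. \<kappa> (a * \<bar>?E n x\<bar>) \<partial>lborel) + c * (r n * \<kappa> (a * m' / r n))) \<longlonglongrightarrow> 0" by simp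
    show ?thesis
      by (rule tendsto_sandwich[OF _ _ tendsto_const upper])
         (use bound a modulus_nonneg in \<open>auto intro!: always_eventually Bochner_Integration.integral_nonneg\<close>)
  qed
qed

lemma limit_integrable: "\<exists>Z. has_levy_integral M \<Lambda> UNIV (\<lambda>q. indicator S (p - q) * avg_limit (p - q)) Z"
proof (rule has_levy_integral_exists[OF _ finite_area_cball])
  have "(\<lambda>x. indicator S x * avg_limit x) \<circ> (\<lambda>q. p - q) \<in> borel_measurable borel"
    by (rule measurable_comp[OF _ limit_measurable]) measurable
  then show "(\<lambda>q. indicator S (p - q) * avg_limit (p - q)) \<in> borel_measurable borel" by (simp add: comp_def)
  show "\<bar>indicator S (p - q) * avg_limit (p - q)\<bar> \<le> 2 * K * indicator (cball 0 (norm p + \<rho>)) q" for q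
  proof (rule order_trans[OF limit_le_cball])
    have "norm q \<le> norm p + \<rho>" if "norm (p - q) \<le> \<rho>"
      using that norm_triangle_ineq4[of p "p - q"] by simp
    then show "2 * K * indicator (cball 0 \<rho>) (p - q) \<le> 2 * K * indicator (cball 0 (norm p + \<rho>)) q"
      using K(2) by (auto split: split_indicator)
  qed
qed

theorem circle_average_tendsto:
  assumes Z: "has_levy_integral M \<Lambda> UNIV (\<lambda>q. indicator S (p - q) * avg_limit (p - q)) Z"
  shows "tendsto_in_prob M (\<lambda>r w. (\<integral>\<theta>. V (p + r *\<^sub>R unit_dir \<theta>) w \<bullet> e \<theta> \<partial>angle) / (pi * r)) Z (at_right 0)"
proof (rule tendsto_in_probI_bound)
  show "Z \<in> borel_measurable M" by (rule has_levy_integral_measurable(2)[OF Z])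
  have pos: "\<forall>\<^sub>F r in at_right 0. (0::real) < r \<and> r \<le> 1"
    unfolding eventually_at_right_field by (intro exI[of _ 1]) auto
  show "\<forall>\<^sub>F r in at_right 0. (\<lambda>w. (\<integral>\<theta>. V (p + r *\<^sub>R unit_dir \<theta>) w \<bullet> e \<theta> \<partial>angle) / (pi * r)) \<in> borel_measurable M"
    using pos by eventually_elim (use circle_average_integral has_levy_integral_measurable(2) in blast)
  fix c :: real assume c: "c > 0"
  let ?u = "\<lambda>r. 2 * (\<integral>x. \<kappa> (8 / c * \<bar>error r x\<bar>) \<partial>lborel)"
  show "(?u \<longlongrightarrow> 0) (at_right 0)"
    unfolding tendsto_at_iff_sequentially
  proof (intro allI impI)
    fix s :: "nat \<Rightarrow> real" assume s: "\<forall>i. s i \<in> {0<..} - {0}" "s \<longlonglongrightarrow> 0"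
    have "\<forall>\<^sub>F n in sequentially. s n < 1" using order_tendstoD(2)[OF s(2)] by simp
    then obtain N where N: "\<And>n. n \<ge> N \<Longrightarrow> s n < 1" by (auto simp: eventually_sequentially)
    have "(\<lambda>n. \<integral>x. \<kappa> (8 / c * \<bar>error (s (n + N)) x\<bar>) \<partial>lborel) \<longlonglongrightarrow> 0"
      using s N c by (intro error_modulus_tendsto LIMSEQ_ignore_initial_segment) (auto intro: less_imp_le)
    then have "(\<lambda>n. \<integral>x. \<kappa> (8 / c * \<bar>error (s n) x\<bar>) \<partial>lborel) \<longlonglongrightarrow> 0" by (rule LIMSEQ_offset)
    from tendsto_mult_right_zero[OF this, of 2] show "(?u \<circ> s) \<longlonglongrightarrow> 0" by (simp add: comp_def)
  qed
  show "\<forall>\<^sub>F r in at_right 0. prob {w \<in> space M. c < \<bar>(\<integral>\<theta>. V (p + r *\<^sub>R unit_dir \<theta>) w \<bullet> e \<theta> \<partial>angle) / (pi * r) - Z w\<bar>} \<le> ?u r"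
    using pos
  proof eventually_elim
    case (elim r)
    then have r: "0 < r" "r \<le> 1" by auto
    have d: "has_levy_integral M \<Lambda> UNIV (\<lambda>q. error r (p - q))
        (\<lambda>w. (\<integral>\<theta>. V (p + r *\<^sub>R unit_dir \<theta>) w \<bullet> e \<theta> \<partial>angle) / (pi * r) - Z w)"
      unfolding error_def by (rule has_levy_integral_diff[OF circle_average_integral[OF r(1)] Z])
    have bnd: "\<bar>error r (p - q)\<bar> \<le> (2 * m / r + 2 * K) * indicator (cball 0 (norm p + \<rho> + 1)) q" for q
    proof (cases "p - q \<in> cball 0 (\<rho> + 1)")
      case True
      then have "norm q \<le> norm p + \<rho> + 1" using norm_triangle_ineq4[of p "p - q"] by simp
      moreover have "\<bar>error r (p - q)\<bar> \<le> 2 * m / r + 2 * K"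
        using avg_le_coarse[OF r(1), of "p - q"] limit_le[of "p - q"] by (simp add: error_def)
      ultimately show ?thesis by simp
    next
      case False
      then show ?thesis using error_outside[OF r False] m(2) K(2) r by simp
    qed
    have "prob {w \<in> space M. c < \<bar>(\<integral>\<theta>. V (p + r *\<^sub>R unit_dir \<theta>) w \<bullet> e \<theta> \<partial>angle) / (pi * r) - Z w\<bar>}
      \<le> 2 * (\<integral>q. \<kappa> (8 / c * \<bar>error r (p - q)\<bar>) \<partial>lborel)"
      by (rule levy_integral_tail[OF d finite_area_cball bnd c])
    also have "(\<integral>q. \<kappa> (8 / c * \<bar>error r (p - q)\<bar>) \<partial>lborel) = (\<integral>x. \<kappa> (8 / c * \<bar>error r x\<bar>) \<partial>lborel)"
      by (rule integral_reflect) measurable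
    finally show ?case .
  qed
qed

end

section \<open>Admissible ambit sets and the limit theorem\<close>

lemma closure_uminus: "closure (uminus ` R) = uminus ` closure (R :: plane set)"
  using closure_scaleR[of "-1" R] by simp

lemma frontier_uminus: "frontier (uminus ` R) = uminus ` frontier (R :: plane set)"
proof -
  have "inj (uminus :: plane \<Rightarrow> plane)" by (simp add: inj_on_def)
  then show ?thesis
    by (simp add: frontier_def closure_uminus interior_negations image_set_diff)
qed

lemma admissible_ambit_set_region:
  assumes "admissible_ambit_set R"
  shows "bounded R" "R \<in> sets borel" "linear_tubes (frontier (uminus ` R))"
proof -
  obtain n :: nat and Q :: "nat \<Rightarrow> plane set" where n: "1 \<le> n" and R: "R = Q 1 - (\<Union>i\<in>{2..n}. Q i)"
    and dom: "\<forall>i\<in>{1..n}. jordan_domain (Q i) \<and> lipschitz_regular_boundary (Q i)"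
    using assms unfolding admissible_ambit_set_def by (elim exE conjE) (rule that, assumption+)
  have Q: "jordan_domain (Q i)" "lipschitz_regular_boundary (Q i)" if "i \<in> {1..n}" for i
    using dom that by simp_all
  have compact: "compact (Q i)" if "i \<in> {1..n}" for i using Q(1)[OF that] by (simp add: jordan_domain_def)
  show "bounded R"
    by (rule bounded_subset[OF compact_imp_bounded[OF compact[of 1]]]) (use n R in auto)
  have Qm: "Q i \<in> sets borel" if "i \<in> {1..n}" for i by (rule borel_compact[OF compact[OF that]])
  show "R \<in> sets borel"
    unfolding R using n Qm by (intro sets.Diff sets.finite_UN) auto
  have "frontier R \<subseteq> frontier (Q 1) \<union> frontier (\<Union> (Q ` {2..n}))"
    unfolding R Diff_eq using frontier_Int_subset[of "Q 1" "- (\<Union> (Q ` {2..n}))"] by (simp only: frontier_complement)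
  also have "frontier (\<Union> (Q ` {2..n})) \<subseteq> (\<Union>A\<in>Q ` {2..n}. frontier A)"
    by (rule frontier_Union_subset) simp
  finally have "frontier R \<subseteq> (\<Union>i\<in>{1..n}. frontier (Q i))" using n by fastforce
  then have sub: "frontier (uminus ` R) \<subseteq> (\<Union>i\<in>{1..n}. uminus ` frontier (Q i))"
    unfolding frontier_uminus by blast
  have "linear_tubes (uminus ` frontier (Q i))" if i: "i \<in> {1..n}" for i
  proof -
    obtain g C where g: "path_image g = frontier (Q i)" "C-lipschitz_on {0..1} g"
      using Q(2)[OF i] by (auto simp: lipschitz_regular_boundary_def)
    have "C-lipschitz_on {0..1} (\<lambda>t. - g t)"
      using g(2) by (auto simp: lipschitz_on_def dist_minus)
    from linear_tubes_lipschitz_image[OF this]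
    show ?thesis using g(1) by (simp add: path_image_def image_image flip: g(1))
  qed
  then show "linear_tubes (frontier (uminus ` R))"
    by (intro linear_tubes_subset[OF _ sub] linear_tubes_UN) auto
qed

text \<open>The same simple functions approximate both integrals; the drift terms converge by dominated
  convergence. An arbitrary approximating sequence would not do, since its drift terms need not
  converge.\<close>

lemma (in controlled_basis) has_levy_integral_shift:
  assumes Y: "has_levy_integral M \<Lambda> UNIV f Y" and B: "B \<in> finite_area_sets"
    and fb: "\<And>q. \<bar>f q\<bar> \<le> C * indicator B q"
  shows "has_levy_integral M (shifted_basis \<Lambda> c) UNIV f (\<lambda>w. Y w - c * (\<integral>q. f q \<partial>lborel))"
proof -
  note fm[measurable] = has_levy_integral_measurable(1)[OF Y]
  obtain s where s: "\<And>n. simple_integrand (s n)" "\<And>q. (\<lambda>n. s n q) \<longlonglongrightarrow> f q" "\<And>n q. \<bar>s n q\<bar> \<le> 2 * \<bar>f q\<bar>"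
    "\<And>D. D \<in> sets borel \<Longrightarrow> \<exists>Z. tendsto_in_prob M (\<lambda>n. simple_levy_integral \<Lambda> D (s n)) Z sequentially"
    "tendsto_in_prob M (\<lambda>n. simple_levy_integral \<Lambda> UNIV (s n)) Y sequentially"
    by (rule has_levy_integral_approximation[OF Y B fb]) (rule that)
  note [measurable] = simple_integrand_measurable[OF s(1)]
  have simple: "simple_levy_integral (shifted_basis \<Lambda> c) D (s n)
      = (\<lambda>w. simple_levy_integral \<Lambda> D (s n) w - c * (\<integral>q. indicator D q * s n q \<partial>lborel))"
    if D: "D \<in> sets borel" for D n
  proof -
    let ?E = "\<lambda>y. D \<inter> s n -` {y}"
    have "(\<integral>q. indicator D q * (\<lambda>x. x) (s n q) \<partial>lborel) = (\<Sum>y\<in>range (s n) - {0}. y * measure lborel (?E y))"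
    proof (rule integral_refinement(2))
      show "finite (range (s n) - {0})" using s(1)[of n] by (auto simp: simple_integrand_def simple_function_def)
      show "?E y \<in> finite_area_sets" if "y \<in> range (s n) - {0}" for y
        using simple_integrand_level_set[OF s(1) D] that by auto
    qed (auto simp: disjoint_family_on_def)
    then show ?thesis
      by (simp add: simple_levy_integral_def shifted_basis_def fun_eq_iff right_diff_distrib sum_subtractf
          sum_distrib_left mult.left_commute)
  qed
  have drift: "tendsto_in_prob M (\<lambda>n w. c * (\<integral>q. indicator D q * s n q \<partial>lborel)) (\<lambda>w. c * (\<integral>q. indicator D q * f q \<partial>lborel)) sequentially"
    if D[measurable]: "D \<in> sets borel" for D
  proof -
    have "(\<lambda>n. \<integral>q. indicator D q * s n q \<partial>lborel) \<longlonglongrightarrow> (\<integral>q. indicator D q * f q \<partial>lborel)"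
    proof (rule integral_dominated_convergence[where w = "\<lambda>q. 2 * C * indicator B q"])
      show "integrable lborel (\<lambda>q. 2 * C * indicator B q)" using B by (auto simp: finite_area_sets_def)
      show "AE q in lborel. (\<lambda>n. indicator D q * s n q) \<longlonglongrightarrow> indicator D q * f q"
        using s(2) by (intro AE_I2 tendsto_mult tendsto_const)
      have "\<bar>indicator D q * s n q\<bar> \<le> 2 * C * indicator B q" for n q
      proof -
        have "\<bar>indicator D q * s n q\<bar> \<le> \<bar>s n q\<bar>" by (auto split: split_indicator)
        then show ?thesis using s(3)[of n q] fb[of q] by linarith
      qed
      then show "AE q in lborel. norm (indicator D q * s n q) \<le> 2 * C * indicator B q" for n by simp
    qed measurable
    then show ?thesis
      by (intro tendsto_in_prob_AE AE_I2 tendsto_mult_left) auto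
  qed
  show ?thesis
  proof (rule has_levy_integral_UNIV_I[where s = s])
    show "AE q in lborel. (\<lambda>n. s n q) \<longlonglongrightarrow> f q" using s(2) by simp
    show "\<exists>Z. tendsto_in_prob M (\<lambda>n. simple_levy_integral (shifted_basis \<Lambda> c) D (s n)) Z sequentially"
      if D: "D \<in> sets borel" for D
    proof -
      obtain Z where "tendsto_in_prob M (\<lambda>n. simple_levy_integral \<Lambda> D (s n)) Z sequentially" using s(4)[OF D] by blast
      from tendsto_in_prob_diff[OF this drift[OF D]] show ?thesis
        unfolding simple[OF D] by (intro exI[of _ "\<lambda>w. Z w - c * (\<integral>q. indicator D q * f q \<partial>lborel)"])
    qed
    show "tendsto_in_prob M (\<lambda>n. simple_levy_integral (shifted_basis \<Lambda> c) UNIV (s n)) (\<lambda>w. Y w - c * (\<integral>q. f q \<partial>lborel)) sequentially"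
      using tendsto_in_prob_diff[OF s(5) drift[of UNIV]] simple[of UNIV] by simp
  qed (rule fm, rule s(1))
qed

lemma shifted_basis_0: "shifted_basis L 0 = L"
  by (simp add: shifted_basis_def fun_eq_iff)

lemma indicator_translate:
  fixes p q :: plane and R :: "plane set"
  shows "indicator ((\<lambda>x. x + p) ` R) q = (indicator (uminus ` R) (p - q) :: real)"
proof -
  have "q \<in> (\<lambda>x. x + p) ` R \<longleftrightarrow> q - p \<in> R"
  proof
    assume "q - p \<in> R"
    then have "(q - p) + p \<in> (\<lambda>x. x + p) ` R" by (rule imageI)
    then show "q \<in> (\<lambda>x. x + p) ` R" by (simp only: diff_add_cancel)
  next
    assume "q \<in> (\<lambda>x. x + p) ` R"
    then obtain x where "x \<in> R" "q = x + p" by blast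
    then show "q - p \<in> R" by (simp only: add_diff_cancel)
  qed
  moreover have "p - q \<in> uminus ` R \<longleftrightarrow> q - p \<in> R"
  proof
    assume "q - p \<in> R"
    then have "- (q - p) \<in> uminus ` R" by (rule imageI)
    then show "p - q \<in> uminus ` R" by (simp only: minus_diff_eq)
  next
    assume "p - q \<in> uminus ` R"
    then obtain x where "x \<in> R" "p - q = - x" by blast
    moreover from this(2) have "q - p = x" by (metis minus_diff_eq minus_minus)
    ultimately show "q - p \<in> R" by simp
  qed
  ultimately show ?thesis by (simp add: indicator_def)
qed

text \<open>The two halves of the theorem are the cases where \<open>e\<close> is the unit tangent and the unit normal.\<close>

lemma ambit_average_limit:
  fixes M :: "'w measure" and L :: "plane set \<Rightarrow> 'w \<Rightarrow> real" and e :: "real \<Rightarrow> plane" and h :: "plane \<Rightarrow> real"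
    and DF :: "plane \<Rightarrow> plane \<Rightarrow>\<^sub>L plane"
  assumes M: "prob_space M" and R: "admissible_ambit_set R"
    and L: "homogeneous_levy_basis M \<gamma> b \<nu> L" and F: "F \<in> borel_measurable borel"
    and DF: "has_continuous_derivative_on F DF (uminus ` closure R)"
    and X: "ambit_field M L R F X"
    and cases: "(b = 0 \<and> (\<integral>\<^sup>+x. ennreal (min 1 \<bar>x\<bar>) \<partial>\<nu>) < \<infinity> \<and> \<gamma>d = \<gamma> - (LINT x:{-1..1}|\<nu>. x)) \<or>
         ((\<forall>x\<in>uminus ` frontier R. F x = 0) \<and> \<gamma>d = \<gamma>)"
    and e: "continuous_on UNIV e" "\<And>\<theta>. norm (e \<theta>) \<le> 1" "\<And>v. (\<integral>\<theta>. v \<bullet> e \<theta> \<partial>angle) = 0"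
    and h: "continuous_on (uminus ` closure R) h" "\<And>x. (\<integral>\<theta>. DF x (unit_dir \<theta>) \<bullet> e \<theta> \<partial>angle) / pi = h x"
  shows "levy_integrable M (shifted_basis L \<gamma>d) ((\<lambda>x. x + p) ` R) (\<lambda>q. h (p - q)) \<and>
    tendsto_in_prob M (\<lambda>r w. (\<integral>\<theta>. X (p + r *\<^sub>R unit_dir \<theta>) w \<bullet> e \<theta> \<partial>angle) / (pi * r))
      (levy_integral M (shifted_basis L \<gamma>d) ((\<lambda>x. x + p) ` R) (\<lambda>q. h (p - q))) (at_right 0)"
proof -
  define S where "S = uminus ` R"
  have clS: "closure S = uminus ` closure R" and frS: "frontier S = uminus ` frontier R"
    by (simp_all add: S_def closure_uminus frontier_uminus)
  note reg = admissible_ambit_set_region[OF R]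
  have \<nu>: "levy_measure \<nu>" using L by (simp add: homogeneous_levy_basis_def)
  have bS: "bounded S" using reg(1) by (simp add: S_def)
  then obtain \<rho> where \<rho>: "S \<subseteq> cball 0 \<rho>" by (auto simp: bounded_iff subset_iff)
  have Sm: "S \<in> sets borel"
  proof -
    have "S = uminus -` R \<inter> space borel" by (force simp: S_def image_iff)
    moreover have "uminus -` R \<inter> space borel \<in> sets (borel :: plane measure)"
      by (rule measurable_sets[OF _ reg(2)]) measurable
    ultimately show ?thesis by simp
  qed
  have comp: "compact (closure S)" using bS by (simp add: compact_closure)
  have Fd: "(F has_derivative blinfun_apply (DF x)) (at x within closure S)" if "x \<in> closure S" for x
    using DF that unfolding has_continuous_derivative_on_def clS by blast
  have "bounded (DF ` closure S)"
    using DF by (intro compact_imp_bounded compact_continuous_image comp) (simp add: has_continuous_derivative_on_def clS)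
  then obtain K0 where K0: "\<And>x. x \<in> closure S \<Longrightarrow> norm (DF x) \<le> K0" by (auto simp: bounded_iff)
  have "continuous_on (closure S) F"
    using Fd by (auto simp: continuous_on_eq_continuous_within intro: has_derivative_continuous)
  then have "bounded (F ` closure S)" by (intro compact_imp_bounded compact_continuous_image comp)
  then obtain m0 where m0: "\<And>x. x \<in> closure S \<Longrightarrow> norm (F x) \<le> m0" by (auto simp: bounded_iff)
  \<comment> \<open>The bounds are made nonnegative because \<open>S\<close> may be empty.\<close>
  interpret cut: cut_off_field S F DF "max 0 K0" "max 0 m0" \<rho> e
  proof
    show "norm (DF x) \<le> max 0 K0" if "x \<in> closure S" for x using K0[OF that] by simp
    show "norm (F x) \<le> max 0 m0" if "x \<in> closure S" for x using m0[OF that] by simp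
    show "e \<in> borel_measurable borel" using e(1) by (rule borel_measurable_continuous_onI)
  qed (use \<rho> Sm F Fd e in auto)
  interpret L: controlled_basis M L "general_modulus \<gamma> b \<nu>"
    using controlled_basis_shifted[OF M L general_modulus(1-3)[OF \<nu>] , of 0 "\<gamma> - 0" b] general_modulus(4)[OF \<nu>, of \<gamma> b _ 0]
    by (simp add: shifted_basis_0)
  obtain \<kappa> where \<kappa>: "controlled_basis M (shifted_basis L \<gamma>d) \<kappa>"
    and balance: "(\<forall>z\<in>frontier S. F z = 0) \<or> (\<forall>a>0. ((\<lambda>r. r * \<kappa> (a / r)) \<longlongrightarrow> 0) (at_right 0))"
    using cases
  proof
    assume i: "b = 0 \<and> (\<integral>\<^sup>+x. ennreal (min 1 \<bar>x\<bar>) \<partial>\<nu>) < \<infinity> \<and> \<gamma>d = \<gamma> - (LINT x:{-1..1}|\<nu>. x)"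
    then have fv: "(\<integral>\<^sup>+x. ennreal (min 1 \<bar>x\<bar>) \<partial>\<nu>) < \<infinity>" by blast
    note fvm = finite_variation_modulus[OF \<nu> fv]
    have "controlled_basis M (shifted_basis L \<gamma>d) (finite_variation_modulus \<nu>)"
      using fvm(4) i by (intro controlled_basis_shifted[OF M L fvm(1-3)]) simp
    then show thesis using fvm(5) by (intro that[of "finite_variation_modulus \<nu>"]) auto
  next
    assume ii: "(\<forall>x\<in>uminus ` frontier R. F x = 0) \<and> \<gamma>d = \<gamma>"
    have "controlled_basis M (shifted_basis L \<gamma>d) (general_modulus (\<gamma> - \<gamma>d) b \<nu>)"
      by (rule controlled_basis_shifted[OF M L general_modulus[OF \<nu>]])
    then show thesis using ii by (intro that[of "general_modulus (\<gamma> - \<gamma>d) b \<nu>"]) (auto simp: frS)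
  qed
  \<comment> \<open>Passing from the basis to its shift changes the field by a constant vector only.\<close>
  define a where "a = ((\<integral>x. fst (cut.G x) \<partial>lborel), (\<integral>x. snd (cut.G x) \<partial>lborel))"
  define V where "V p w = X p w - \<gamma>d *\<^sub>R a" for p w
  have Gb: "\<bar>fst (cut.G (p - q))\<bar> \<le> max 0 m0 * indicator (cball 0 (norm p + \<rho>)) q"
    "\<bar>snd (cut.G (p - q))\<bar> \<le> max 0 m0 * indicator (cball 0 (norm p + \<rho>)) q" for p q
  proof -
    have "norm (cut.G (p - q)) \<le> max 0 m0 * indicator (cball 0 (norm p + \<rho>)) q"
    proof (cases "p - q \<in> S")
      case True
      then have "norm (p - q) \<le> \<rho>" using \<rho> by auto
      then have "norm q \<le> norm p + \<rho>" using norm_triangle_ineq4[of p "p - q"] by simp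
      then show ?thesis using cut.G_le[of "p - q"] by simp
    qed (simp add: cut.G_def)
    then show "\<bar>fst (cut.G (p - q))\<bar> \<le> max 0 m0 * indicator (cball 0 (norm p + \<rho>)) q"
      "\<bar>snd (cut.G (p - q))\<bar> \<le> max 0 m0 * indicator (cball 0 (norm p + \<rho>)) q"
      using order_trans[OF norm_fst_le[of "fst (cut.G (p - q))" "snd (cut.G (p - q))"]]
        order_trans[OF norm_snd_le[of "snd (cut.G (p - q))" "fst (cut.G (p - q))"]] by auto
  qed
  have Gm: "(\<lambda>x. fst (cut.G x)) \<in> borel_measurable borel" "(\<lambda>x. snd (cut.G x)) \<in> borel_measurable borel"
    by (intro measurable_compose[OF cut.G_measurable borel_measurable_continuous_onI] continuous_intros)+
  have X_int: "has_levy_integral M L UNIV (\<lambda>q. fst (cut.G (p - q))) (\<lambda>w. fst (X p w))"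
    "has_levy_integral M L UNIV (\<lambda>q. snd (cut.G (p - q))) (\<lambda>w. snd (X p w))" for p
  proof -
    have G: "indicator ((\<lambda>x. x + p) ` R) q * fst (F (p - q)) = fst (cut.G (p - q))"
      "indicator ((\<lambda>x. x + p) ` R) q * snd (F (p - q)) = snd (cut.G (p - q))" for q
      unfolding indicator_translate S_def[symmetric] by (simp_all add: cut.G_def)
    have "has_levy_integral M L ((\<lambda>x. x + p) ` R) (\<lambda>q. fst (F (p - q))) (\<lambda>w. fst (X p w))"
      "has_levy_integral M L ((\<lambda>x. x + p) ` R) (\<lambda>q. snd (F (p - q))) (\<lambda>w. snd (X p w))"
      using X unfolding ambit_field_def by blast+
    then show "has_levy_integral M L UNIV (\<lambda>q. fst (cut.G (p - q))) (\<lambda>w. fst (X p w))"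
      "has_levy_integral M L UNIV (\<lambda>q. snd (cut.G (p - q))) (\<lambda>w. snd (X p w))"
      unfolding has_levy_integral_indicator[of _ _ "(\<lambda>x. x + p) ` R"] G .
  qed
  interpret circle_limit M "shifted_basis L \<gamma>d" \<kappa> S F DF "max 0 K0" "max 0 m0" \<rho> e V
  proof (intro circle_limit.intro \<kappa> cut.cut_off_field_axioms circle_limit_axioms.intro)
    show "continuous_on UNIV e" by (rule e(1))
    show "linear_tubes (frontier S)" using reg(3) by (simp add: S_def)
    have [measurable]: "(\<lambda>(p, w). X p w) \<in> borel_measurable (borel \<Otimes>\<^sub>M M)" using X by (simp add: ambit_field_def)
    show "(\<lambda>(p, w). V p w) \<in> borel_measurable (borel \<Otimes>\<^sub>M M)" unfolding V_def by measurable
    show "has_levy_integral M (shifted_basis L \<gamma>d) UNIV (\<lambda>q. fst (cut.G (p - q))) (\<lambda>w. fst (V p w))" for p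
      using L.has_levy_integral_shift[OF X_int(1)[of p] finite_area_cball Gb(1), of \<gamma>d]
      by (simp add: V_def a_def integral_reflect[OF Gm(1)])
    show "has_levy_integral M (shifted_basis L \<gamma>d) UNIV (\<lambda>q. snd (cut.G (p - q))) (\<lambda>w. snd (V p w))" for p
      using L.has_levy_integral_shift[OF X_int(2)[of p] finite_area_cball Gb(2), of \<gamma>d]
      by (simp add: V_def a_def integral_reflect[OF Gm(2)])
    have "(\<lambda>x. indicator (closure S) x *\<^sub>R h x) \<in> borel_measurable borel"
      using h(1) borel_closed[OF closed_closure[of S]] unfolding clS[symmetric]
      by (intro borel_measurable_continuous_on_indicator)
    then have "(\<lambda>x. indicator S x * (indicator (closure S) x *\<^sub>R h x)) \<in> borel_measurable borel"
      using Sm by measurable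
    moreover have "indicator S x * (indicator (closure S) x *\<^sub>R h x) = indicator S x * cut.avg_limit x" for x
      using closure_subset[of S] by (auto simp: cut.avg_limit_def h(2) split: split_indicator)
    ultimately show "(\<lambda>x. indicator S x * cut.avg_limit x) \<in> borel_measurable borel" by (simp only:)
    show "(\<forall>z\<in>frontier S. F z = 0) \<or> (\<forall>a>0. ((\<lambda>r. r * \<kappa> (a / r)) \<longlongrightarrow> 0) (at_right 0))" by (rule balance)
  qed
  have iff: "has_levy_integral M (shifted_basis L \<gamma>d) ((\<lambda>x. x + p) ` R) (\<lambda>q. h (p - q)) Z
    \<longleftrightarrow> has_levy_integral M (shifted_basis L \<gamma>d) UNIV (\<lambda>q. indicator S (p - q) * cut.avg_limit (p - q)) Z" for Z
    by (simp add: has_levy_integral_indicator[of _ _ "(\<lambda>x. x + p) ` R"] indicator_translate S_def[symmetric] cut.avg_limit_def h(2))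
  have ex: "\<exists>Z. has_levy_integral M (shifted_basis L \<gamma>d) ((\<lambda>x. x + p) ` R) (\<lambda>q. h (p - q)) Z"
    unfolding iff by (rule limit_integrable)
  have "has_levy_integral M (shifted_basis L \<gamma>d) ((\<lambda>x. x + p) ` R) (\<lambda>q. h (p - q))
      (levy_integral M (shifted_basis L \<gamma>d) ((\<lambda>x. x + p) ` R) (\<lambda>q. h (p - q)))"
    unfolding levy_integral_def by (rule someI_ex[OF ex])
  from circle_average_tendsto[OF this[unfolded iff]]
  have lim: "tendsto_in_prob M (\<lambda>r w. (\<integral>\<theta>. V (p + r *\<^sub>R unit_dir \<theta>) w \<bullet> e \<theta> \<partial>angle) / (pi * r))
      (levy_integral M (shifted_basis L \<gamma>d) ((\<lambda>x. x + p) ` R) (\<lambda>q. h (p - q))) (at_right 0)" .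
  have "(\<integral>\<theta>. V (p + r *\<^sub>R unit_dir \<theta>) w \<bullet> e \<theta> \<partial>angle) = (\<integral>\<theta>. X (p + r *\<^sub>R unit_dir \<theta>) w \<bullet> e \<theta> \<partial>angle)" for r w
  proof -
    have c: "integrable angle (\<lambda>\<theta>. (\<gamma>d *\<^sub>R a) \<bullet> e \<theta>)"
      by (rule cut.bounded_inner_integrable[where c = "norm (\<gamma>d *\<^sub>R a)"]) auto
    show ?thesis
    proof (cases "integrable angle (\<lambda>\<theta>. X (p + r *\<^sub>R unit_dir \<theta>) w \<bullet> e \<theta>)")
      case True
      then show ?thesis using c e(3) by (simp add: V_def inner_diff_left)
    next
      case False
      \<comment> \<open>Both integrals then have the default value.\<close>
      have "\<not> integrable angle (\<lambda>\<theta>. V (p + r *\<^sub>R unit_dir \<theta>) w \<bullet> e \<theta>)"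
      proof
        assume "integrable angle (\<lambda>\<theta>. V (p + r *\<^sub>R unit_dir \<theta>) w \<bullet> e \<theta>)"
        from Bochner_Integration.integrable_add[OF this c] False show False
          by (simp add: V_def inner_diff_left)
      qed
      then show ?thesis using False by (simp add: not_integrable_integral_eq)
    qed
  qed
  then show ?thesis using ex lim by (simp add: levy_integrable_def)
qed

lemma integral_angle_trig:
  fixes a b c k :: real
  shows "(\<integral>\<theta>. a * cos \<theta> + b * sin \<theta> \<partial>angle) = 0"
    and "(\<integral>\<theta>. a * (cos \<theta>)\<^sup>2 + b * (sin \<theta>)\<^sup>2 + c * (sin \<theta> * cos \<theta>) \<partial>angle) = pi * (a + b)"
proof -
  have "(\<integral>\<theta>. a * cos \<theta> + b * sin \<theta> \<partial>angle) = (a * sin (2 * pi) - b * cos (2 * pi)) - (a * sin 0 - b * cos 0)"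
    by (rule integral_angle_FTC) (auto intro!: derivative_eq_intros continuous_intros)
  then show "(\<integral>\<theta>. a * cos \<theta> + b * sin \<theta> \<partial>angle) = 0" by simp
  let ?P = "\<lambda>\<theta>. a * (\<theta> + sin \<theta> * cos \<theta>) / 2 + b * (\<theta> - sin \<theta> * cos \<theta>) / 2 + c * (sin \<theta>)\<^sup>2 / 2"
  have "(?P has_real_derivative a * (cos \<theta>)\<^sup>2 + b * (sin \<theta>)\<^sup>2 + c * (sin \<theta> * cos \<theta>)) (at \<theta>)" for \<theta>
  proof -
    have "(?P has_real_derivative a * (1 + (cos \<theta> * cos \<theta> - sin \<theta> * sin \<theta>)) / 2
        + b * (1 - (cos \<theta> * cos \<theta> - sin \<theta> * sin \<theta>)) / 2 + c * (2 * sin \<theta> * cos \<theta>) / 2) (at \<theta>)"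
      by (auto intro!: derivative_eq_intros)
    moreover have "1 + (cos \<theta> * cos \<theta> - sin \<theta> * sin \<theta>) = 2 * (cos \<theta>)\<^sup>2" "1 - (cos \<theta> * cos \<theta> - sin \<theta> * sin \<theta>) = 2 * (sin \<theta>)\<^sup>2"
      using sin_cos_squared_add[of \<theta>] by (simp_all add: power2_eq_square)
    ultimately show ?thesis by (simp add: mult.assoc)
  qed
  then have "(\<integral>\<theta>. a * (cos \<theta>)\<^sup>2 + b * (sin \<theta>)\<^sup>2 + c * (sin \<theta> * cos \<theta>) \<partial>angle) = ?P (2 * pi) - ?P 0"
    by (rule integral_angle_FTC) (auto intro!: continuous_intros)
  then show "(\<integral>\<theta>. a * (cos \<theta>)\<^sup>2 + b * (sin \<theta>)\<^sup>2 + c * (sin \<theta> * cos \<theta>) \<partial>angle) = pi * (a + b)"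
    by (simp add: field_simps)
qed

lemma blinfun_unit_dir:
  fixes A :: "plane \<Rightarrow>\<^sub>L plane"
  shows "A (unit_dir \<theta>) = cos \<theta> *\<^sub>R A (1, 0) + sin \<theta> *\<^sub>R A (0, 1)"
proof -
  have "unit_dir \<theta> = cos \<theta> *\<^sub>R (1, 0) + sin \<theta> *\<^sub>R (0, 1)" by (simp add: unit_dir_def)
  then show ?thesis by (simp only: blinfun.add_right blinfun.scaleR_right)
qed

lemma circle_integral_curl:
  fixes DF :: "plane \<Rightarrow> plane \<Rightarrow>\<^sub>L plane"
  shows "(\<integral>\<theta>. DF x (unit_dir \<theta>) \<bullet> perp (unit_dir \<theta>) \<partial>angle) / pi = curl DF x"
proof -
  have "DF x (unit_dir \<theta>) \<bullet> perp (unit_dir \<theta>)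
      = snd (DF x (1, 0)) * (cos \<theta>)\<^sup>2 + (- fst (DF x (0, 1))) * (sin \<theta>)\<^sup>2
        + (snd (DF x (0, 1)) - fst (DF x (1, 0))) * (sin \<theta> * cos \<theta>)" for \<theta>
    unfolding blinfun_unit_dir
    by (simp add: inner_prod_def perp_def unit_dir_def power2_eq_square algebra_simps)
  then show ?thesis by (simp only: integral_angle_trig(2)) (simp add: curl_def)
qed

lemma circle_integral_divergence:
  fixes DF :: "plane \<Rightarrow> plane \<Rightarrow>\<^sub>L plane"
  shows "(\<integral>\<theta>. DF x (unit_dir \<theta>) \<bullet> unit_dir \<theta> \<partial>angle) / pi = divergence DF x"
proof -
  have "DF x (unit_dir \<theta>) \<bullet> unit_dir \<theta>
      = fst (DF x (1, 0)) * (cos \<theta>)\<^sup>2 + snd (DF x (0, 1)) * (sin \<theta>)\<^sup>2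
        + (fst (DF x (0, 1)) + snd (DF x (1, 0))) * (sin \<theta> * cos \<theta>)" for \<theta>
    unfolding blinfun_unit_dir
    by (simp add: inner_prod_def unit_dir_def power2_eq_square algebra_simps)
  then show ?thesis by (simp only: integral_angle_trig(2)) (simp add: divergence_def)
qed

lemma continuous_curl_divergence:
  fixes DF :: "plane \<Rightarrow> plane \<Rightarrow>\<^sub>L plane"
  assumes "continuous_on A DF"
  shows "continuous_on A (curl DF)" "continuous_on A (divergence DF)"
  unfolding curl_def[abs_def] divergence_def[abs_def]
  using assms by (auto intro!: continuous_intros)

theorem theorem2:
  fixes M :: "'w measure"
    and L :: "plane set \<Rightarrow> 'w \<Rightarrow> real"
    and \<gamma> b \<gamma>d :: real
    and \<nu> :: "real measure"
    and R :: "plane set"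
    and F :: "plane \<Rightarrow> plane"
    and DF :: "plane \<Rightarrow> plane \<Rightarrow>\<^sub>L plane"
    and X :: "plane \<Rightarrow> 'w \<Rightarrow> plane"
  assumes "prob_space M"
    and "admissible_ambit_set R"
    and "homogeneous_levy_basis M \<gamma> b \<nu> L"
    and "F \<in> borel_measurable borel"
    and "has_continuous_derivative_on F DF (uminus ` closure R)"
    and "ambit_field M L R F X"
    and "(b = 0 \<and> (\<integral>\<^sup>+x. ennreal (min 1 \<bar>x\<bar>) \<partial>\<nu>) < \<infinity> \<and> \<gamma>d = \<gamma> - (LINT x:{-1..1}|\<nu>. x)) \<or>
         ((\<forall>x\<in>uminus ` frontier R. F x = 0) \<and> \<gamma>d = \<gamma>)"
  shows "\<forall>p.
    levy_integrable M (shifted_basis L \<gamma>d) ((\<lambda>x. x + p) ` R) (\<lambda>q. curl DF (p - q)) \<and>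
    levy_integrable M (shifted_basis L \<gamma>d) ((\<lambda>x. x + p) ` R) (\<lambda>q. divergence DF (p - q)) \<and>
    tendsto_in_prob M (\<lambda>r w. circulation X r p w / (pi * r\<^sup>2))
      (levy_integral M (shifted_basis L \<gamma>d) ((\<lambda>x. x + p) ` R) (\<lambda>q. curl DF (p - q)))
      (at_right 0) \<and>
    tendsto_in_prob M (\<lambda>r w. flux X r p w / (pi * r\<^sup>2))
      (levy_integral M (shifted_basis L \<gamma>d) ((\<lambda>x. x + p) ` R) (\<lambda>q. divergence DF (p - q)))
      (at_right 0)"
proof
  fix p
  have DF: "continuous_on (uminus ` closure R) DF"
    using assms(5) by (simp add: has_continuous_derivative_on_def)
  have mean: "(\<integral>\<theta>. v \<bullet> perp (unit_dir \<theta>) \<partial>angle) = 0" "(\<integral>\<theta>. v \<bullet> unit_dir \<theta> \<partial>angle) = 0" for v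
    using integral_angle_trig(1)[of "snd v" "- fst v"] integral_angle_trig(1)[of "fst v" "snd v"]
    by (simp_all add: inner_prod_def perp_def unit_dir_def)
  have "continuous_on UNIV (\<lambda>\<theta>. perp (unit_dir \<theta>))"
    by (rule continuous_on_compose2[OF continuous_perp continuous_unit_dir]) simp
  note curl = ambit_average_limit[OF assms this _ mean(1) continuous_curl_divergence(1)[OF DF] circle_integral_curl, of p, simplified]
  note div = ambit_average_limit[OF assms continuous_unit_dir _ mean(2) continuous_curl_divergence(2)[OF DF] circle_integral_divergence, of p, simplified]
  have pos: "\<forall>\<^sub>F r in at_right (0::real). 0 < r" by (simp add: eventually_at_right_less)
  have c: "\<forall>\<^sub>F r in at_right 0. (\<lambda>w. circulation X r p w / (pi * r\<^sup>2))
      = (\<lambda>w. (\<integral>\<theta>. X (p + r *\<^sub>R unit_dir \<theta>) w \<bullet> perp (unit_dir \<theta>) \<partial>angle) / (pi * r))"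
    using pos by eventually_elim (simp add: circulation_def integral_angle fun_eq_iff power2_eq_square)
  have f: "\<forall>\<^sub>F r in at_right 0. (\<lambda>w. flux X r p w / (pi * r\<^sup>2))
      = (\<lambda>w. (\<integral>\<theta>. X (p + r *\<^sub>R unit_dir \<theta>) w \<bullet> unit_dir \<theta> \<partial>angle) / (pi * r))"
    using pos by eventually_elim (simp add: flux_def integral_angle fun_eq_iff power2_eq_square)
  show "levy_integrable M (shifted_basis L \<gamma>d) ((\<lambda>x. x + p) ` R) (\<lambda>q. curl DF (p - q)) \<and>
    levy_integrable M (shifted_basis L \<gamma>d) ((\<lambda>x. x + p) ` R) (\<lambda>q. divergence DF (p - q)) \<and>
    tendsto_in_prob M (\<lambda>r w. circulation X r p w / (pi * r\<^sup>2))
      (levy_integral M (shifted_basis L \<gamma>d) ((\<lambda>x. x + p) ` R) (\<lambda>q. curl DF (p - q)))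
      (at_right 0) \<and>
    tendsto_in_prob M (\<lambda>r w. flux X r p w / (pi * r\<^sup>2))
      (levy_integral M (shifted_basis L \<gamma>d) ((\<lambda>x. x + p) ` R) (\<lambda>q. divergence DF (p - q)))
      (at_right 0)"
    using curl div tendsto_in_prob_cong_eventually[OF _ c] tendsto_in_prob_cong_eventually[OF _ f] by blast
qed

end
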